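(* Let $\Theta,\Lambda$ be ordinals. The logic $\mathsf{GLP}^0_\Lambda$ is sound for both the Kripke frame $\mathfrak I^\Theta_\Lambda$ and the polytopological space $\mathfrak T^\Theta_\Lambda$; that is, every formula derivable in $\mathsf{GLP}^0_\Lambda$ is true at every point of $\mathfrak I^\Theta_\Lambda$ and at every point of $\mathfrak T^\Theta_\Lambda$.
   Context: **Logic.** Formulas of $\mathsf{GLP}^0_\Lambda$ are built from $\bot$ (there are no propositional variables) using $\neg,\wedge$ and a unary modality $[\xi]$ for each ordinal $\xi<\Lambda$; $\langle\xi\rangle$ abbreviates $\neg[\xi]\neg$, and other Booleans are defined as usual. $\mathsf{GLP}^0_\Lambda$ has as axioms: all propositional tautologies; $[\xi](\phi\to\psi)\to([\xi]\phi\to[\xi]\psi)$ for $\xi<\Lambda$; $[\xi]([\xi]\phi\to\phi)\to[\xi]\phi$ for $\xi<\Lambda$; $\langle\zeta\rangle\phi\to\langle\xi\rangle\phi$ for $\xi<\zeta<\Lambda$; $\langle\xi\rangle\phi\to[\zeta]\langle\xi\rangle\phi$ for $\xi<\zeta<\Lambda$; the rules are modus ponens and necessitation (from $\phi$ infer $[\xi]\phi$). **Ordinal functions.** For $\xi\le\zeta$, $-\xi+\zeta$ is the unique $\eta$ with $\xi+\eta=\zeta$. Let $e(\xi)=-1+\omega^\xi$. The hyperexponentials $e^\zeta$ are: $e^0\xi=\xi$; $e^\xi 0=0$; $e^1=e$; $e^{\omega^\rho+\xi}=e^{\omega^\rho}e^\xi$ (composition) if $\xi<\omega^\rho+\xi$;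 $e^{\omega^\rho}(\xi+1)=\lim_{\zeta\to\omega^\rho}e^\zeta(e^{\omega^\rho}(\xi)+1)$ for $\rho>0$; $e^{\omega^\rho}\xi=\lim_{\zeta\to\xi}e^{\omega^\rho}\zeta$ for $\xi$ a limit ordinal, $\rho>0$. The hyperlogarithms $\ell^\xi$ are: $\ell^0\alpha=\alpha$; $\ell^\xi0=0$; $\ell^\xi(\alpha+\beta)=\ell^\xi\beta$ if $\xi,\beta>0$; $\ell^\xi1=0$ for $\xi>0$; $\ell^{\omega^\rho+\xi}=\ell^\xi\ell^{\omega^\rho}$ if $\xi<\omega^\rho+\xi$; and $\ell^{\omega^\rho}e^{\omega^\delta}\xi$ equals $\ell^{\omega^\rho}\xi$ if $\delta<\rho$, $\xi$ if $\delta=\rho$, and $e^{\omega^\delta}\xi$ if $\delta>\rho$. Write $\ell=\ell^1$; in particular $\ell(\zeta+\omega^\rho)=\rho$. **Kripke frame.** An ordinal is identified with the set of smaller ordinals. An $\ell$-sequence of depth $\Theta$ and length $\Lambda$ is a function $f:\Lambda\to\Theta$ such that for every $\zeta\in(0,\Lambda)$ there is $\vartheta<\zeta$ with $f(\zeta)\le\ell^{-\xi+\zeta}f(\xi)$ for all $\xi\in[\vartheta,\zeta)$. $D^\Theta_\Lambda$ is the set of these. $\mathfrak I^\Theta_\Lambda=\langle D^\Theta_\Lambda,\langle<_\xi\rangle_{\xi<\Lambda}\rangle$, where $f<_\xi g$ iff $f(\zeta)=g(\zeta)$ for all $\zeta<\xi$ and $f(\xi)<g(\xi)$. Truth: Booleans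 as usual, and $\langle\mathfrak I^\Theta_\Lambda,g\rangle\models\langle\xi\rangle\phi$ iff there is $f<_\xi g$ with $\langle\mathfrak I^\Theta_\Lambda,f\rangle\models\phi$. **Polytopological space.** $\mathfrak T^\Theta_\Lambda=\langle\Theta,\langle\mathcal T_\lambda\rangle_{\lambda<\Lambda}\rangle$, where $\mathcal T_\lambda$ is the topology on $\Theta$ with subbasis the sets $\{\zeta<\Theta:\alpha<\ell^\xi\zeta\le\beta\}$ for $\xi<\lambda$, $\alpha<\beta\le\Theta$, and $\{\zeta<\Theta:\ell^\xi\zeta\le\beta\}$ for $\xi\le\lambda$, $\beta\le\Theta$ (equivalently, $\mathcal T_\lambda$ is induced via $\zeta\mapsto\langle\ell^\xi\zeta\rangle_{\xi<\Lambda}$ from the product topology on functions $\Lambda\to\Theta$ with the order topology on coordinates below $\lambda$, the initial segment topology on coordinate $\lambda$, and the trivial topology on coordinates above $\lambda$). Truth: Booleans as usual, and $\langle\mathfrak T^\Theta_\Lambda,\xi\rangle\models\langle\lambda\rangle\phi$ iff every $U\in\mathcal T_\lambda$ containing $\xi$ contains some $\zeta\ne\xi$ with $\langle\mathfrak T^\Theta_\Lambda,\zeta\rangle\models\phi$ (derived-set semantics). *)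

theory Defs
  imports "HOL-Analysis.Analysis" "HOL-Library.Infinite_Typeclass"
begin

section \<open>Ordinals\<close>

text \<open>
  An element of \<open>'a ordinal\<close> is an order type of a well-order whose field is a subset of
  \<open>'a\<close>. For infinite \<open>'a\<close> these are precisely the ordinals below the cardinal successor of
  \<open>|'a|\<close>, a regular uncountable cardinal; hence all operations below stay inside the type,
  and every ordinal occurs in \<open>'a ordinal\<close> for a suitable \<open>'a\<close>.
\<close>

quotient_type 'a ordinal = "'a rel" / partial: "\<lambda>r s. (r, s) \<in> (ordIso :: ('a rel \<times> 'a rel) set)"
proof (rule part_equivpI)
  show "\<exists>r :: 'a rel. (r, r) \<in> ordIso"
    by (rule exI[of _ "{}"]) (auto intro!: ordIso_reflexive simp: well_order_on_empty)
  show "symp (\<lambda>r s. (r, s) \<in> (ordIso :: ('a rel \<times> 'a rel) set))"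
    by (auto intro: sympI ordIso_symmetric)
  show "transp (\<lambda>r s. (r, s) \<in> (ordIso :: ('a rel \<times> 'a rel) set))"
    by (auto intro: transpI ordIso_transitive)
qed

instantiation ordinal :: (type) linorder
begin

lift_definition less_eq_ordinal :: "'a ordinal \<Rightarrow> 'a ordinal \<Rightarrow> bool"
  is "\<lambda>r s. (r, s) \<in> ordLeq"
  by (meson ordIso_ordLeq_trans ordIso_symmetric ordLeq_ordIso_trans)

lift_definition less_ordinal :: "'a ordinal \<Rightarrow> 'a ordinal \<Rightarrow> bool"
  is "\<lambda>r s. (r, s) \<in> ordLess"
  by (meson ordIso_ordLess_trans ordIso_symmetric ordLess_ordIso_trans)

instance
proof
  fix x y z :: "'a ordinal"
  show "(x < y) = (x \<le> y \<and> \<not> y \<le> x)"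
    by transfer (metis not_ordLess_ordLeq not_ordLeq_ordLess ordLess_imp_ordLeq ordLess_or_ordLeq ordIso_imp_ordLeq ordLeq_Well_order_simp)
  show "x \<le> x"
    by transfer (simp add: ordIso_imp_ordLeq)
  show "x \<le> y \<Longrightarrow> y \<le> z \<Longrightarrow> x \<le> z"
    by transfer (rule ordLeq_transitive)
  show "x \<le> y \<Longrightarrow> y \<le> x \<Longrightarrow> x = y"
    by transfer (simp add: ordIso_iff_ordLeq)
  show "x \<le> y \<or> y \<le> x"
    by transfer (metis ordLess_imp_ordLeq ordLess_or_ordLeq ordIso_imp_ordLeq ordLeq_Well_order_simp)
qed

end

instance ordinal :: (type) wellorder
proof
  fix P :: "'a ordinal \<Rightarrow> bool" and a
  assume step: "\<And>x. (\<And>y. y < x \<Longrightarrow> P y) \<Longrightarrow> P x"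
  have abs: "P (abs_ordinal r)" if "(r, r) \<in> ordIso" for r :: "'a rel"
    using that
  proof (induction r rule: wf_induct_rule[OF wf_ordLess])
    case (1 r)
    have "y < abs_ordinal r \<Longrightarrow> P y" for y
    proof (induction y rule: ordinal.abs_induct)
      case (1 s)
      with \<open>(r, r) \<in> ordIso\<close> have "(s, r) \<in> ordLess" by (simp add: less_ordinal.abs_eq)
      with \<open>(s, s) \<in> ordIso\<close> show ?case by (intro "1.IH")
    qed
    then show ?case by (rule step)
  qed
  show "P a"
    by (induction a rule: ordinal.abs_induct) (rule abs)
qed

instantiation ordinal :: (type) conditionally_complete_linorder
begin

definition sup_ordinal :: "'a ordinal \<Rightarrow> 'a ordinal \<Rightarrow> 'a ordinal" where "sup_ordinal = max"
definition inf_ordinal :: "'a ordinal \<Rightarrow> 'a ordinal \<Rightarrow> 'a ordinal" where "inf_ordinal = min"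
definition Sup_ordinal :: "'a ordinal set \<Rightarrow> 'a ordinal" where
  "Sup_ordinal A = (LEAST b. \<forall>a\<in>A. a \<le> b)"
definition Inf_ordinal :: "'a ordinal set \<Rightarrow> 'a ordinal" where
  "Inf_ordinal A = (LEAST a. a \<in> A)"

instance
proof
  fix x y z :: "'a ordinal" and A :: "'a ordinal set"
  show "inf x y \<le> x" "inf x y \<le> y" "x \<le> y \<Longrightarrow> x \<le> z \<Longrightarrow> x \<le> inf y z"
    "x \<le> sup x y" "y \<le> sup x y" "y \<le> x \<Longrightarrow> z \<le> x \<Longrightarrow> sup y z \<le> x"
    unfolding inf_ordinal_def sup_ordinal_def
    by (rule min.cobounded1 min.cobounded2 min.boundedI max.cobounded1 max.cobounded2 max.boundedI;
        assumption?)+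
  show "x \<in> A \<Longrightarrow> bdd_below A \<Longrightarrow> Inf A \<le> x"
    unfolding Inf_ordinal_def by (rule Least_le)
  show "A \<noteq> {} \<Longrightarrow> (\<And>x. x \<in> A \<Longrightarrow> z \<le> x) \<Longrightarrow> z \<le> Inf A"
    unfolding Inf_ordinal_def by (meson LeastI_ex ex_in_conv)
  show "x \<in> A \<Longrightarrow> bdd_above A \<Longrightarrow> x \<le> Sup A"
    using LeastI_ex[of "\<lambda>b. \<forall>a\<in>A. a \<le> b"] unfolding Sup_ordinal_def bdd_above_def by blast
  show "A \<noteq> {} \<Longrightarrow> (\<And>x. x \<in> A \<Longrightarrow> x \<le> z) \<Longrightarrow> Sup A \<le> z"
    unfolding Sup_ordinal_def by (rule Least_le) blast
qed

end

definition osuc :: "'a ordinal \<Rightarrow> 'a ordinal" where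
  "osuc a = (LEAST b. a < b)"

instantiation ordinal :: (type) "{zero, one}"
begin
definition zero_ordinal :: "'a ordinal" where "zero_ordinal = (LEAST a. True)"
definition one_ordinal :: "'a ordinal" where "one_ordinal = osuc 0"
instance ..
end

definition limit_ord :: "'a ordinal \<Rightarrow> bool" where
  "limit_ord a \<longleftrightarrow> a \<noteq> 0 \<and> (\<forall>b<a. osuc b < a)"

text \<open>
  Transfinite recursion with a value at zero, a successor step and suprema at limits;
  see \<open>ord_rec_zero\<close>, \<open>ord_rec_suc\<close> and \<open>ord_rec_limit\<close> below.
\<close>

function ord_rec :: "'a ordinal \<Rightarrow> ('a ordinal \<Rightarrow> 'a ordinal) \<Rightarrow> 'a ordinal \<Rightarrow> 'a ordinal" where
  "ord_rec z s a =
    (if a = 0 then z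
     else if \<exists>b<a. a = osuc b then s (ord_rec z s (SOME b. b < a \<and> a = osuc b))
     else Sup (ord_rec z s ` {..<a}))"
  by auto
termination
proof (relation "inv_image {(b, a). b < a} (\<lambda>(z, s, a). a)")
  show "wf (inv_image {(b, a :: 'a ordinal). b < a} (\<lambda>(z :: 'a ordinal, s :: 'a ordinal \<Rightarrow> 'a ordinal, a). a))"
    by (rule wf_inv_image[OF wf])
next
  fix z :: "'a ordinal" and s a
  assume "\<exists>b<a. a = osuc b"
  from someI_ex[OF this] show "((z, s, SOME b. b < a \<and> a = osuc b), (z, s, a)) \<in>
      inv_image {(b, a). b < a} (\<lambda>(z, s, a). a)"
    by simp
qed simp

declare ord_rec.simps [simp del]

instantiation ordinal :: (type) "{plus, times}"
begin
definition plus_ordinal :: "'a ordinal \<Rightarrow> 'a ordinal \<Rightarrow> 'a ordinal" where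
  "a + b = ord_rec a osuc b"
definition times_ordinal :: "'a ordinal \<Rightarrow> 'a ordinal \<Rightarrow> 'a ordinal" where
  "a * b = ord_rec 0 (\<lambda>x. x + a) b"
instance ..
end

definition omega :: "'a ordinal" where
  "omega = (LEAST a. limit_ord a)"

definition omega_pow :: "'a ordinal \<Rightarrow> 'a ordinal" where
  "omega_pow a = ord_rec 1 (\<lambda>x. x * omega) a"

text \<open>Left subtraction: \<open>left_minus a b\<close> is the ordinal written \<open>-a + b\<close>, for \<open>a \<le> b\<close>.\<close>

definition left_minus :: "'a ordinal \<Rightarrow> 'a ordinal \<Rightarrow> 'a ordinal" where
  "left_minus a b = (THE c. a + c = b)"


section \<open>Hyperexponentials and hyperlogarithms\<close>

text \<open>
  \<open>is_hyperexp\<close> and \<open>is_hyperlog\<close> list the defining clauses; that they determine unique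
  families is proved below (\<open>ex1_hyperexp\<close>, \<open>ex1_hyperlog\<close>). The limits in the last two clauses
  of \<open>is_hyperexp\<close> are limits of nondecreasing families of ordinals, hence suprema.
\<close>

definition is_hyperexp :: "('a ordinal \<Rightarrow> 'a ordinal \<Rightarrow> 'a ordinal) \<Rightarrow> bool" where
  "is_hyperexp E \<longleftrightarrow>
     (\<forall>x. E 0 x = x) \<and>
     (\<forall>a. E a 0 = 0) \<and>
     (\<forall>x. E 1 x = left_minus 1 (omega_pow x)) \<and>
     (\<forall>r a x. a < omega_pow r + a \<longrightarrow> E (omega_pow r + a) x = E (omega_pow r) (E a x)) \<and>
     (\<forall>r x. 0 < r \<longrightarrow>
        E (omega_pow r) (x + 1) = (SUP b\<in>{..<omega_pow r}. E b (E (omega_pow r) x + 1))) \<and>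
     (\<forall>r x. 0 < r \<longrightarrow> limit_ord x \<longrightarrow>
        E (omega_pow r) x = (SUP y\<in>{..<x}. E (omega_pow r) y))"

definition hyperexp :: "'a ordinal \<Rightarrow> 'a ordinal \<Rightarrow> 'a ordinal" where
  "hyperexp = (THE E. is_hyperexp E)"

definition is_hyperlog :: "('a ordinal \<Rightarrow> 'a ordinal \<Rightarrow> 'a ordinal) \<Rightarrow> bool" where
  "is_hyperlog L \<longleftrightarrow>
     (\<forall>x. L 0 x = x) \<and>
     (\<forall>a. L a 0 = 0) \<and>
     (\<forall>a x y. 0 < a \<longrightarrow> 0 < y \<longrightarrow> L a (x + y) = L a y) \<and>
     (\<forall>a. 0 < a \<longrightarrow> L a 1 = 0) \<and>
     (\<forall>r a x. a < omega_pow r + a \<longrightarrow> L (omega_pow r + a) x = L a (L (omega_pow r) x)) \<and>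
     (\<forall>r d x. L (omega_pow r) (hyperexp (omega_pow d) x) =
        (if d < r then L (omega_pow r) x
         else if d = r then x
         else hyperexp (omega_pow d) x))"

definition hyperlog :: "'a ordinal \<Rightarrow> 'a ordinal \<Rightarrow> 'a ordinal" where
  "hyperlog = (THE L. is_hyperlog L)"


section \<open>The logic\<close>

datatype 'a fm = Bot | Neg "'a fm" | Conj "'a fm" "'a fm" | Box "'a ordinal" "'a fm"

definition Dia :: "'a ordinal \<Rightarrow> 'a fm \<Rightarrow> 'a fm" where
  "Dia a p = Neg (Box a (Neg p))"

definition Imp :: "'a fm \<Rightarrow> 'a fm \<Rightarrow> 'a fm" where
  "Imp p q = Neg (Conj p (Neg q))"

primrec in_lang :: "'a ordinal \<Rightarrow> 'a fm \<Rightarrow> bool" where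
  "in_lang \<Lambda> Bot \<longleftrightarrow> True"
| "in_lang \<Lambda> (Neg p) \<longleftrightarrow> in_lang \<Lambda> p"
| "in_lang \<Lambda> (Conj p q) \<longleftrightarrow> in_lang \<Lambda> p \<and> in_lang \<Lambda> q"
| "in_lang \<Lambda> (Box a p) \<longleftrightarrow> a < \<Lambda> \<and> in_lang \<Lambda> p"

text \<open>Propositional evaluation, where boxed formulas are treated as atoms.\<close>

primrec prop_eval :: "('a ordinal \<Rightarrow> 'a fm \<Rightarrow> bool) \<Rightarrow> 'a fm \<Rightarrow> bool" where
  "prop_eval v Bot \<longleftrightarrow> False"
| "prop_eval v (Neg p) \<longleftrightarrow> \<not> prop_eval v p"
| "prop_eval v (Conj p q) \<longleftrightarrow> prop_eval v p \<and> prop_eval v q"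
| "prop_eval v (Box a p) \<longleftrightarrow> v a p"

definition tautology :: "'a fm \<Rightarrow> bool" where
  "tautology p \<longleftrightarrow> (\<forall>v. prop_eval v p)"

inductive GLP :: "'a ordinal \<Rightarrow> 'a fm \<Rightarrow> bool" for \<Lambda> where
  Taut: "in_lang \<Lambda> p \<Longrightarrow> tautology p \<Longrightarrow> GLP \<Lambda> p"
| K: "a < \<Lambda> \<Longrightarrow> in_lang \<Lambda> p \<Longrightarrow> in_lang \<Lambda> q \<Longrightarrow>
    GLP \<Lambda> (Imp (Box a (Imp p q)) (Imp (Box a p) (Box a q)))"
| Loeb: "a < \<Lambda> \<Longrightarrow> in_lang \<Lambda> p \<Longrightarrow>
    GLP \<Lambda> (Imp (Box a (Imp (Box a p) p)) (Box a p))"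
| Mon: "a < b \<Longrightarrow> b < \<Lambda> \<Longrightarrow> in_lang \<Lambda> p \<Longrightarrow>
    GLP \<Lambda> (Imp (Dia b p) (Dia a p))"
| NegIntro: "a < b \<Longrightarrow> b < \<Lambda> \<Longrightarrow> in_lang \<Lambda> p \<Longrightarrow>
    GLP \<Lambda> (Imp (Dia a p) (Box b (Dia a p)))"
| MP: "GLP \<Lambda> (Imp p q) \<Longrightarrow> GLP \<Lambda> p \<Longrightarrow> GLP \<Lambda> q"
| Nec: "GLP \<Lambda> p \<Longrightarrow> a < \<Lambda> \<Longrightarrow> GLP \<Lambda> (Box a p)"


section \<open>Kripke semantics\<close>

definition ell_seqs :: "'a ordinal \<Rightarrow> 'a ordinal \<Rightarrow> ('a ordinal \<Rightarrow> 'a ordinal) set" where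
  "ell_seqs \<Theta> \<Lambda> = {f \<in> {..<\<Lambda>} \<rightarrow>\<^sub>E {..<\<Theta>}.
     \<forall>z. 0 < z \<and> z < \<Lambda> \<longrightarrow>
       (\<exists>t<z. \<forall>x. t \<le> x \<and> x < z \<longrightarrow> f z \<le> hyperlog (left_minus x z) (f x))}"

definition ell_less :: "'a ordinal \<Rightarrow> ('a ordinal \<Rightarrow> 'a ordinal) \<Rightarrow> ('a ordinal \<Rightarrow> 'a ordinal) \<Rightarrow> bool" where
  "ell_less a f g \<longleftrightarrow> (\<forall>z<a. f z = g z) \<and> f a < g a"

primrec kripke_sat ::
  "'a ordinal \<Rightarrow> 'a ordinal \<Rightarrow> ('a ordinal \<Rightarrow> 'a ordinal) \<Rightarrow> 'a fm \<Rightarrow> bool" where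
  "kripke_sat \<Theta> \<Lambda> g Bot \<longleftrightarrow> False"
| "kripke_sat \<Theta> \<Lambda> g (Neg p) \<longleftrightarrow> \<not> kripke_sat \<Theta> \<Lambda> g p"
| "kripke_sat \<Theta> \<Lambda> g (Conj p q) \<longleftrightarrow> kripke_sat \<Theta> \<Lambda> g p \<and> kripke_sat \<Theta> \<Lambda> g q"
| "kripke_sat \<Theta> \<Lambda> g (Box a p) \<longleftrightarrow>
     \<not> (\<exists>f\<in>ell_seqs \<Theta> \<Lambda>. ell_less a f g \<and> \<not> kripke_sat \<Theta> \<Lambda> f p)"

lemma kripke_sat_Dia:
  "kripke_sat \<Theta> \<Lambda> g (Dia a p) \<longleftrightarrow> (\<exists>f\<in>ell_seqs \<Theta> \<Lambda>. ell_less a f g \<and> kripke_sat \<Theta> \<Lambda> f p)"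
  by (simp add: Dia_def)


section \<open>Topological semantics\<close>

text \<open>The subbasis contains the whole space \<open>{..<\<Theta>}\<close>: take \<open>x = 0\<close> and \<open>b = \<Theta>\<close> in the second family.\<close>

definition icard_topology :: "'a ordinal \<Rightarrow> 'a ordinal \<Rightarrow> 'a ordinal topology" where
  "icard_topology \<Theta> l = topology_generated_by
     ({{z. z < \<Theta> \<and> a < hyperlog x z \<and> hyperlog x z \<le> b} | x a b. x < l \<and> a < b \<and> b \<le> \<Theta>} \<union>
      {{z. z < \<Theta> \<and> hyperlog x z \<le> b} | x b. x \<le> l \<and> b \<le> \<Theta>})"

primrec top_sat :: "'a ordinal \<Rightarrow> 'a fm \<Rightarrow> 'a ordinal \<Rightarrow> bool" where
  "top_sat \<Theta> Bot x \<longleftrightarrow> False"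
| "top_sat \<Theta> (Neg p) x \<longleftrightarrow> \<not> top_sat \<Theta> p x"
| "top_sat \<Theta> (Conj p q) x \<longleftrightarrow> top_sat \<Theta> p x \<and> top_sat \<Theta> q x"
| "top_sat \<Theta> (Box a p) x \<longleftrightarrow>
     x \<notin> icard_topology \<Theta> a derived_set_of {y. y < \<Theta> \<and> \<not> top_sat \<Theta> p y}"


section \<open>Basic ordinal arithmetic\<close>

text \<open>The initial segment of the ordinals below \<open>a\<close> has order type \<open>a\<close>.\<close>

definition segment :: "'a ordinal \<Rightarrow> 'a ordinal rel" where
  "segment a = {(x, y). x \<le> y \<and> y < a}"

definition all_ords :: "'a ordinal rel" where
  "all_ords = {(x, y). x \<le> y}"

lemma Field_segment: "Field (segment a) = {..<a}"
  by (auto simp: Field_def segment_def)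

lemma Field_all_ords: "Field all_ords = UNIV"
  by (auto simp: Field_def all_ords_def)

lemma Well_order_segment: "Well_order (segment a)"
  unfolding well_order_on_def linear_order_on_def partial_order_on_def preorder_on_def Field_segment
proof (intro conjI)
  show "wf (segment a - Id)"
    by (rule wf_subset[OF wf]) (auto simp: segment_def)
qed (auto simp: segment_def refl_on_def trans_def antisym_def total_on_def)

lemma Well_order_all_ords: "Well_order (all_ords :: 'a ordinal rel)"
  unfolding well_order_on_def linear_order_on_def partial_order_on_def preorder_on_def
proof (intro conjI)
  show "wf (all_ords - Id :: 'a ordinal rel)"
    by (rule wf_subset[OF wf]) (auto simp: all_ords_def)
qed (auto simp: all_ords_def refl_on_def trans_def antisym_def total_on_def Field_def)

lemma Restr_segment: "b < a \<Longrightarrow> Restr (segment a) (underS (segment a) b) = segment b"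
  by (auto simp: segment_def underS_def)

lemma Restr_all_ords: "Restr all_ords (underS all_ords b) = segment b"
  by (auto simp: segment_def all_ords_def underS_def)

lemma ordIso_segment:
  "(r, r) \<in> ordIso \<Longrightarrow> (r, segment (abs_ordinal r)) \<in> ordIso"
proof (induction r rule: wf_induct_rule[OF wf_ordLess])
  case (1 r)
  have r: "Well_order r"
    using \<open>(r, r) \<in> ordIso\<close> by (auto simp: ordIso_def)
  have "(r, segment (abs_ordinal r)) \<in> ordLeq"
    unfolding ordLeq_iff_ordLess_Restr[OF r Well_order_segment]
  proof
    fix a assume a: "a \<in> Field r"
    define s where "s = Restr r (underS r a)"
    have sr: "(s, r) \<in> ordLess"
      unfolding s_def using underS_Restr_ordLess[OF r] a by blast
    have s: "(s, s) \<in> ordIso"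
      unfolding s_def by (rule ordIso_reflexive[OF Well_order_Restr[OF r]])
    have less: "abs_ordinal s < abs_ordinal r"
      using sr s \<open>(r, r) \<in> ordIso\<close> by (simp add: less_ordinal.abs_eq)
    have "(segment (abs_ordinal s), segment (abs_ordinal r)) \<in> ordLess"
      using underS_Restr_ordLess[OF Well_order_segment, of "abs_ordinal r" "abs_ordinal s"] less
      by (auto simp: Restr_segment Field_segment)
    with "1.IH"[OF sr s] show "(Restr r (underS r a), segment (abs_ordinal r)) \<in> ordLess"
      unfolding s_def by (rule ordIso_ordLess_trans)
  qed
  moreover have "(segment (abs_ordinal r), r) \<in> ordLeq"
    unfolding ordLeq_iff_ordLess_Restr[OF Well_order_segment r] Field_segment
  proof
    fix b assume "b \<in> {..<abs_ordinal r}"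
    then show "(Restr (segment (abs_ordinal r)) (underS (segment (abs_ordinal r)) b), r) \<in> ordLess"
    proof (induction b rule: ordinal.abs_induct)
      case (1 s)
      with \<open>(r, r) \<in> ordIso\<close> have sr: "(s, r) \<in> ordLess" by (simp add: less_ordinal.abs_eq)
      show ?case
        using 1 Restr_segment[of "abs_ordinal s" "abs_ordinal r"]
          ordIso_ordLess_trans[OF ordIso_symmetric[OF "1.IH"[OF sr]] sr] by simp
    qed
  qed
  ultimately show ?case by (simp add: ordIso_iff_ordLeq)
qed

lemma card_segment: "(card_of {..<a}, card_of (UNIV :: 'a set)) \<in> ordLeq" for a :: "'a ordinal"
proof (induction a rule: ordinal.abs_induct)
  case (1 r)
  from ordIso_segment[OF this] obtain h where "iso r (segment (abs_ordinal r)) h"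
    by (auto simp: ordIso_def)
  then have "bij_betw h (Field r) {..<abs_ordinal r}"
    by (simp add: iso_def Field_segment)
  then have "(card_of (Field r), card_of {..<abs_ordinal r}) \<in> ordIso"
    by (rule card_of_ordIsoI)
  from ordIso_ordLeq_trans[OF ordIso_symmetric[OF this] card_of_mono1[OF subset_UNIV]]
  show ?case .
qed

lemma strictly_bounded:
  fixes f :: "'a::infinite \<Rightarrow> 'a ordinal"
  shows "\<exists>b. \<forall>i. f i < b"
proof (rule ccontr)
  assume "\<not> ?thesis"
  then have "\<forall>b. \<exists>i. b \<le> f i" by (meson not_less)
  then have "UNIV = (\<Union>i\<in>UNIV. {..<f i}) \<union> range f"
    by (auto simp: le_less) blast
  moreover have "(card_of ((\<Union>i\<in>UNIV. {..<f i}) \<union> range f), card_of (UNIV :: 'a set)) \<in> ordLeq"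
    by (intro card_of_Un_ordLeq_infinite_Field card_of_UNION_ordLeq_infinite ballI card_segment
        card_of_image infinite_UNIV ordLeq_reflexive card_of_Well_order card_of_Card_order)
      (simp_all only: Field_card_of infinite_UNIV not_False_eq_True)
  ultimately have "(card_of (UNIV :: 'a ordinal set), card_of (UNIV :: 'a set)) \<in> ordLeq"
    by simp
  then obtain h :: "'a ordinal \<Rightarrow> 'a" where h: "inj h"
    by (auto simp flip: card_of_ordLeq)
  define R where "R = dir_image all_ords h"
  have iso: "(all_ords :: 'a ordinal rel, R) \<in> ordIso"
    unfolding R_def using dir_image_ordIso[OF Well_order_all_ords inj_on_subset[OF h subset_UNIV]] .
  then have "(R, R) \<in> ordIso"
    by (meson ordIso_symmetric ordIso_transitive)
  from ordIso_segment[OF this] have "(R, segment (abs_ordinal R)) \<in> ordIso" .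
  moreover have "(segment (abs_ordinal R), all_ords :: 'a ordinal rel) \<in> ordLess"
    using underS_Restr_ordLess[OF Well_order_all_ords, of "abs_ordinal R"]
    by (simp add: Restr_all_ords Field_all_ords)
  ultimately show False
    using iso by (meson ordIso_ordLess_trans ordLess_ordIso_trans ordLess_irreflexive)
qed

lemma bdd_above_image_lessThan [simp]:
  fixes f :: "'a::infinite ordinal \<Rightarrow> 'a ordinal"
  shows "bdd_above (f ` {..<a})"
proof -
  obtain h :: "'a ordinal \<Rightarrow> 'a" where h: "inj_on h {..<a}"
    using card_segment[of a] by (auto simp flip: card_of_ordLeq)
  obtain b where b: "\<forall>i. f (inv_into {..<a} h i) < b"
    using strictly_bounded[of "\<lambda>i. f (inv_into {..<a} h i)"] by blast
  have "f x \<le> b" if "x < a" for x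
    using b[rule_format, of "h x"] that h by (simp add: less_imp_le)
  then show ?thesis by (auto simp: bdd_above_def)
qed

lemma ex_greater: "\<exists>b. a < b" for a :: "'a::infinite ordinal"
  using strictly_bounded[of "\<lambda>_. a"] by blast

lemma less_osuc [simp]: "a < osuc a" for a :: "'a::infinite ordinal"
  unfolding osuc_def using ex_greater by (rule LeastI_ex)

lemma osuc_le_iff: "osuc a \<le> b \<longleftrightarrow> a < b" for a :: "'a::infinite ordinal"
  using less_osuc[of a] by (auto simp: osuc_def intro: Least_le)

lemma less_osuc_iff: "a < osuc b \<longleftrightarrow> a \<le> b" for a :: "'a::infinite ordinal"
  using osuc_le_iff[of b a] by auto

lemma osuc_inject [simp]: "osuc a = osuc b \<longleftrightarrow> a = b" for a :: "'a::infinite ordinal"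
  by (metis less_osuc less_osuc_iff order.antisym)

lemma ord_zero_le [simp]: "0 \<le> a" for a :: "'a ordinal"
  unfolding zero_ordinal_def by (rule Least_le) simp

lemma ord_not_less_zero [simp]: "\<not> a < 0" for a :: "'a ordinal"
  by (simp add: not_less)

lemma ord_le_zero_iff [simp]: "a \<le> 0 \<longleftrightarrow> a = 0" for a :: "'a ordinal"
  by (simp add: order.eq_iff)

lemma zero_less_iff: "0 < a \<longleftrightarrow> a \<noteq> 0" for a :: "'a ordinal"
  by (metis ord_zero_le le_less less_irrefl)

lemma lessThan_eq_empty_iff [simp]: "{..<a} = {} \<longleftrightarrow> a = 0" for a :: "'a ordinal"
  using zero_less_iff[of a] by auto

lemma osuc_neq_zero [simp]: "osuc a \<noteq> 0" for a :: "'a::infinite ordinal"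
  by (metis less_osuc ord_not_less_zero)

lemma not_limit_osuc [simp]: "\<not> limit_ord (osuc a)" for a :: "'a::infinite ordinal"
  by (auto simp: limit_ord_def intro: exI[of _ a])

lemma not_limit_zero [simp]: "\<not> limit_ord 0"
  by (simp add: limit_ord_def)

lemma ord_cases [case_names zero suc limit]:
  fixes a :: "'a::infinite ordinal"
  obtains "a = 0" | b where "a = osuc b" | "limit_ord a"
  unfolding limit_ord_def by (metis osuc_le_iff order.strict_iff_order)

lemma ord_induct [case_names zero suc limit]:
  fixes a :: "'a::infinite ordinal"
  assumes "P 0" and "\<And>b. P b \<Longrightarrow> P (osuc b)"
    and "\<And>b. limit_ord b \<Longrightarrow> (\<And>c. c < b \<Longrightarrow> P c) \<Longrightarrow> P b"
  shows "P a"
proof (induction a rule: less_induct)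
  case (less a)
  then show ?case
    using assms by (cases a rule: ord_cases) auto
qed

lemma ord_rec_zero [simp]: "ord_rec z s 0 = z"
  by (simp add: ord_rec.simps)

lemma ord_rec_suc [simp]: "ord_rec z s (osuc a) = s (ord_rec z s a)" for a :: "'a::infinite ordinal"
proof -
  have "(SOME b. b < osuc a \<and> osuc a = osuc b) = a"
    by (rule some_equality) auto
  moreover have "\<exists>b<osuc a. osuc a = osuc b"
    by (rule exI[of _ a]) simp
  ultimately show ?thesis
    by (subst ord_rec.simps) (simp only: if_False if_True osuc_neq_zero)
qed

lemma ord_rec_limit: "limit_ord a \<Longrightarrow> ord_rec z s a = (SUP b\<in>{..<a}. ord_rec z s b)"
  by (subst ord_rec.simps) (auto simp: limit_ord_def)

lemma SUP_less_upper: "b < a \<Longrightarrow> f b \<le> (SUP b\<in>{..<a}. f b)"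
  for f :: "'a::infinite ordinal \<Rightarrow> 'a ordinal"
  by (rule cSUP_upper) auto

lemma SUP_less_least: "a \<noteq> 0 \<Longrightarrow> (\<And>b. b < a \<Longrightarrow> f b \<le> c) \<Longrightarrow> (SUP b\<in>{..<a}. f b) \<le> c"
  for f :: "'a::infinite ordinal \<Rightarrow> 'a ordinal"
  by (rule cSUP_least) auto

lemma less_SUP_less_iff: "a \<noteq> 0 \<Longrightarrow> c < (SUP b\<in>{..<a}. f b) \<longleftrightarrow> (\<exists>b<a. c < f b)"
  for f :: "'a::infinite ordinal \<Rightarrow> 'a ordinal"
  by (subst less_cSUP_iff) auto

text \<open>Normal (strictly increasing continuous) functions.\<close>

definition normal :: "('a ordinal \<Rightarrow> 'a ordinal) \<Rightarrow> bool" where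
  "normal f \<longleftrightarrow> strict_mono f \<and> (\<forall>a. limit_ord a \<longrightarrow> f a = (SUP b\<in>{..<a}. f b))"

lemma normalI:
  fixes f :: "'a::infinite ordinal \<Rightarrow> 'a ordinal"
  assumes suc: "\<And>a. f a < f (osuc a)" and lim: "\<And>a. limit_ord a \<Longrightarrow> f a = (SUP b\<in>{..<a}. f b)"
  shows "normal f"
proof -
  have "\<forall>a<b. f a < f b" for b
  proof (induction b rule: ord_induct)
    case (suc b)
    then show ?case
      using assms(1) by (metis less_osuc_iff le_less less_trans)
  next
    case (limit b)
    show ?case
    proof (intro allI impI)
      fix a assume "a < b"
      then have "osuc a < b" using limit by (simp add: limit_ord_def)
      then have "f (osuc a) \<le> f b"
        unfolding lim[OF \<open>limit_ord b\<close>] by (rule SUP_less_upper)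
      then show "f a < f b" using suc[of a] by simp
    qed
  qed simp
  then show ?thesis unfolding normal_def strict_mono_def using lim by blast
qed

lemma normal_less_iff: "normal f \<Longrightarrow> f a < f b \<longleftrightarrow> a < b"
  unfolding normal_def by (simp add: strict_mono_less)

lemma normal_le_iff: "normal f \<Longrightarrow> f a \<le> f b \<longleftrightarrow> a \<le> b"
  unfolding normal_def by (simp add: strict_mono_less_eq)

lemma normal_eq_iff: "normal f \<Longrightarrow> f a = f b \<longleftrightarrow> a = b"
  unfolding normal_def by (simp add: strict_mono_eq)

lemma normal_limit: "normal f \<Longrightarrow> limit_ord a \<Longrightarrow> f a = (SUP b\<in>{..<a}. f b)"
  by (simp add: normal_def)

lemma normal_ge: "normal f \<Longrightarrow> a \<le> f a" for a :: "'a ordinal"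
proof (induction a rule: less_induct)
  case (less a)
  show ?case
  proof (rule ccontr)
    assume "\<not> a \<le> f a"
    then show False
      using less.IH[of "f a"] less.prems normal_less_iff[of f "f a" a] by (simp add: not_le)
  qed
qed

lemma normal_interval:
  fixes f :: "'a::infinite ordinal \<Rightarrow> 'a ordinal"
  assumes f: "normal f" and "f 0 \<le> x"
  obtains a where "f a \<le> x" "x < f (osuc a)"
proof -
  define c where "c = (LEAST c. x < f c)"
  have "x < f (osuc x)"
    by (rule less_le_trans[OF less_osuc normal_ge[OF f]])
  then have c: "x < f c" and least: "\<And>b. b < c \<Longrightarrow> f b \<le> x"
    unfolding c_def by (metis LeastI, metis not_less_Least not_less)
  show thesis
  proof (cases c rule: ord_cases)
    case zero
    then show ?thesis using c assms by simp
  next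
    case (suc b)
    then show ?thesis using c least[of b] that[of b] by simp
  next
    case limit
    then have "f c \<le> x"
      unfolding normal_limit[OF f limit] using least by (intro SUP_less_least) auto
    then show ?thesis using c by simp
  qed
qed

lemma normal_comp:
  fixes f g :: "'a::infinite ordinal \<Rightarrow> 'a ordinal"
  assumes f: "normal f" and g: "normal g"
  shows "normal (\<lambda>x. f (g x))"
proof (rule normalI)
  show "f (g a) < f (g (osuc a))" for a
    using f g by (simp add: normal_less_iff)
  fix a :: "'a ordinal" assume a: "limit_ord a"
  then have a0: "a \<noteq> 0" by auto
  have lim: "limit_ord (g a)"
    unfolding limit_ord_def
  proof (intro conjI allI impI)
    show "g a \<noteq> 0" using normal_ge[OF g, of a] a0 by auto
    fix b assume "b < g a"
    then obtain c where "c < a" "b < g c"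
      unfolding normal_limit[OF g a] by (auto simp: less_SUP_less_iff a0)
    then show "osuc b < g a"
      using normal_less_iff[OF g, of c a] by (meson le_less_trans osuc_le_iff)
  qed
  show "f (g a) = (SUP b\<in>{..<a}. f (g b))"
  proof (rule antisym)
    have g0: "g a \<noteq> 0" using lim by auto
    show "f (g a) \<le> (SUP b\<in>{..<a}. f (g b))"
      unfolding normal_limit[OF f lim]
    proof (rule SUP_less_least[OF g0])
      fix b assume "b < g a"
      then obtain c where c: "c < a" "b < g c"
        unfolding normal_limit[OF g a] by (auto simp: less_SUP_less_iff a0)
      then have "f b \<le> f (g c)" using f by (simp add: normal_le_iff)
      also have "\<dots> \<le> (SUP b\<in>{..<a}. f (g b))" by (rule SUP_less_upper[OF c(1)])
      finally show "f b \<le> (SUP b\<in>{..<a}. f (g b))" .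
    qed
    show "(SUP b\<in>{..<a}. f (g b)) \<le> f (g a)"
      using f g by (intro SUP_less_least a0) (simp add: normal_le_iff)
  qed
qed

lemma plus_zero_right [simp]: "a + 0 = a" for a :: "'a ordinal"
  by (simp add: plus_ordinal_def)

lemma plus_osuc: "a + osuc b = osuc (a + b)" for a :: "'a::infinite ordinal"
  by (simp add: plus_ordinal_def)

lemma plus_limit: "limit_ord b \<Longrightarrow> a + b = (SUP c\<in>{..<b}. a + c)"
  by (simp add: plus_ordinal_def ord_rec_limit)

lemma plus_one: "a + 1 = osuc a" for a :: "'a::infinite ordinal"
  by (simp add: one_ordinal_def plus_osuc)

lemma normal_plus: "normal ((+) a)" for a :: "'a::infinite ordinal"
  by (rule normalI) (simp_all add: plus_osuc plus_limit)

lemmas plus_less_cancel [simp] = normal_less_iff[OF normal_plus]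
lemmas plus_le_cancel [simp] = normal_le_iff[OF normal_plus]
lemmas plus_eq_cancel [simp] = normal_eq_iff[OF normal_plus]

lemma le_plus_left [simp]: "a \<le> a + b" for a :: "'a::infinite ordinal"
  using plus_le_cancel[of a 0 b] by simp

lemma le_plus_right [simp]: "b \<le> a + b" for a :: "'a::infinite ordinal"
  by (rule normal_ge[OF normal_plus])

lemma less_plus_left [simp]: "a < a + b \<longleftrightarrow> b \<noteq> 0" for a :: "'a::infinite ordinal"
  using plus_less_cancel[of a 0 b] by (simp add: zero_less_iff)

lemma plus_assoc: "(a + b) + c = a + (b + c)" for a :: "'a::infinite ordinal"
proof (induction c rule: ord_induct)
  case (limit c)
  have "(a + b) + c = (SUP d\<in>{..<c}. a + (b + d))"
    using limit by (simp add: plus_limit[OF limit(1)] cong: SUP_cong_simp)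
  also have "\<dots> = a + (b + c)"
    using normal_limit[OF normal_comp[OF normal_plus normal_plus] limit(1)] by metis
  finally show ?case .
qed (simp_all add: plus_osuc)

lemma plus_zero_left [simp]: "0 + a = a" for a :: "'a::infinite ordinal"
proof (induction a rule: ord_induct)
  case (limit a)
  show ?case
  proof (rule antisym)
    have "a \<noteq> 0" using limit by auto
    show "0 + a \<le> a"
      unfolding plus_limit[OF limit(1)] using limit \<open>a \<noteq> 0\<close> by (intro SUP_less_least) (auto intro: less_imp_le)
  qed simp
qed (simp_all add: plus_osuc)

lemma plus_eq_zero_iff [simp]: "a + b = 0 \<longleftrightarrow> a = 0 \<and> b = 0" for a :: "'a::infinite ordinal"
  by (metis le_plus_left le_plus_right ord_le_zero_iff plus_zero_right)

lemma ex_plus: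
  fixes a :: "'a::infinite ordinal"
  assumes "a \<le> b"
  obtains c where "a + c = b"
proof -
  obtain c where "a + c \<le> b" "b < a + osuc c"
    using normal_interval[OF normal_plus, of a b] assms by auto
  then have "a + c = b" by (simp add: plus_osuc less_osuc_iff)
  then show thesis by (rule that)
qed

lemma left_minus_plus [simp]: "left_minus a (a + c) = c" for a :: "'a::infinite ordinal"
  by (simp add: left_minus_def)

lemma plus_left_minus: "a \<le> b \<Longrightarrow> a + left_minus a b = b" for a :: "'a::infinite ordinal"
  by (metis ex_plus left_minus_plus)

lemma plus_mono_left: "a \<le> b \<Longrightarrow> a + c \<le> b + c" for a :: "'a::infinite ordinal"
proof (induction c rule: ord_induct)
  case (suc c)
  then show ?case by (simp add: plus_osuc osuc_le_iff less_osuc_iff)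
next
  case (limit c)
  then have "c \<noteq> 0" by auto
  show ?case
    unfolding plus_limit[OF limit(1), of a]
  proof (rule SUP_less_least[OF \<open>c \<noteq> 0\<close>])
    fix d assume d: "d < c"
    with limit have "a + d \<le> b + d" by simp
    also have "\<dots> \<le> b + c" using d by simp
    finally show "a + d \<le> b + c" .
  qed
qed simp

lemma one_neq_zero [simp]: "(1 :: 'a::infinite ordinal) \<noteq> 0"
  by (simp add: one_ordinal_def)

lemma less_one_iff [simp]: "a < 1 \<longleftrightarrow> a = 0" for a :: "'a::infinite ordinal"
  by (simp add: one_ordinal_def less_osuc_iff)

lemma one_le_iff: "1 \<le> a \<longleftrightarrow> a \<noteq> 0" for a :: "'a::infinite ordinal"
  by (simp add: one_ordinal_def osuc_le_iff zero_less_iff)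

lemma ex_limit: "\<exists>a :: 'a::infinite ordinal. limit_ord a"
proof -
  obtain f :: "nat \<Rightarrow> 'a" where f: "inj f"
    using arb_countable_map[of "{}"] by auto
  obtain b where b: "\<And>i. (osuc ^^ inv f i) (0 :: 'a ordinal) < b"
    using strictly_bounded[of "\<lambda>i. (osuc ^^ inv f i) 0"] by blast
  have bn: "(osuc ^^ n) 0 < b" for n
    using b[of "f n"] f by simp
  define l where "l = (LEAST b. \<forall>n. (osuc ^^ n) (0 :: 'a ordinal) < b)"
  have l: "(osuc ^^ n) 0 < l" for n
    unfolding l_def using LeastI[of "\<lambda>b. \<forall>n. (osuc ^^ n) 0 < b" b] bn by blast
  have "limit_ord l"
    unfolding limit_ord_def
  proof (intro conjI allI impI)
    show "l \<noteq> 0" using l[of 0] by auto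
    fix c assume "c < l"
    then obtain n where "c \<le> (osuc ^^ n) 0"
      using not_less_Least[of c "\<lambda>b. \<forall>n. (osuc ^^ n) (0 :: 'a ordinal) < b"]
      unfolding l_def by (auto simp: not_less)
    then have "osuc c \<le> (osuc ^^ Suc n) 0" by (simp add: osuc_le_iff less_osuc_iff)
    also have "\<dots> < l" by (rule l)
    finally show "osuc c < l" .
  qed
  then show ?thesis ..
qed

lemma limit_omega [simp]: "limit_ord (omega :: 'a::infinite ordinal)"
  unfolding omega_def using ex_limit by (rule LeastI_ex)

lemma less_omega_cases:
  fixes n :: "'a::infinite ordinal"
  assumes "n < omega"
  obtains "n = 0" | m where "n = osuc m" "m < omega"
proof (cases n rule: ord_cases)
  case limit
  then have "omega \<le> n" unfolding omega_def by (rule Least_le)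
  then show ?thesis using assms by simp
next
  case (suc m)
  then show ?thesis using assms that less_osuc[of m] less_trans by blast
qed (use that in blast)

lemma less_omega_induct [consumes 1, case_names zero suc]:
  fixes n :: "'a::infinite ordinal"
  assumes "n < omega" "P 0" "\<And>n. n < omega \<Longrightarrow> P n \<Longrightarrow> P (osuc n)"
  shows "P n"
  using assms(1)
proof (induction n rule: less_induct)
  case (less n)
  from less.prems show ?case
    by (cases n rule: less_omega_cases) (use less.IH assms(2,3) in auto)
qed

lemma osuc_less_omega: "n < omega \<Longrightarrow> osuc n < omega" for n :: "'a::infinite ordinal"
  using limit_omega by (auto simp: limit_ord_def)

lemma omega_neq_zero [simp]: "(omega :: 'a::infinite ordinal) \<noteq> 0"
  using limit_omega not_limit_zero by metis

lemma one_plus_finite: "n < omega \<Longrightarrow> 1 + n = osuc n" for n :: "'a::infinite ordinal"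
  by (induction n rule: less_omega_induct) (simp_all add: plus_osuc flip: one_ordinal_def)

lemma plus_less_omega: "m < omega \<Longrightarrow> n < omega \<Longrightarrow> n + m < omega" for n :: "'a::infinite ordinal"
  by (induction m rule: less_omega_induct) (auto simp: plus_osuc osuc_less_omega)

lemma finite_plus_omega: "n < omega \<Longrightarrow> n + omega = omega" for n :: "'a::infinite ordinal"
proof (rule antisym)
  assume n: "n < omega"
  show "n + omega \<le> omega"
    unfolding plus_limit[OF limit_omega]
    by (rule SUP_less_least) (auto intro: less_imp_le plus_less_omega n)
qed simp

lemma times_zero [simp]: "a * 0 = 0" for a :: "'a ordinal"
  by (simp add: times_ordinal_def)

lemma times_osuc: "a * osuc b = a * b + a" for a :: "'a::infinite ordinal"
  by (simp add: times_ordinal_def)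

lemma times_limit: "limit_ord b \<Longrightarrow> a * b = (SUP c\<in>{..<b}. a * c)"
  by (simp add: times_ordinal_def ord_rec_limit)

lemma times_one [simp]: "a * 1 = a" for a :: "'a::infinite ordinal"
  by (simp add: one_ordinal_def times_osuc)

lemma normal_times: "a \<noteq> 0 \<Longrightarrow> normal ((*) a)" for a :: "'a::infinite ordinal"
  by (rule normalI) (simp_all add: times_osuc times_limit)

lemma times_plus: "a \<noteq> 0 \<Longrightarrow> a * (b + c) = a * b + a * c" for a :: "'a::infinite ordinal"
proof (induction c rule: ord_induct)
  case (limit c)
  have "a * (b + c) = (SUP d\<in>{..<c}. a * (b + d))"
    using normal_limit[OF normal_comp[OF normal_times normal_plus] limit(1)] limit(3) by metis
  also have "\<dots> = (SUP d\<in>{..<c}. a * b + a * d)"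
    using limit by (simp cong: SUP_cong_simp)
  also have "\<dots> = a * b + a * c"
    using normal_limit[OF normal_comp[OF normal_plus normal_times] limit(1)] limit(3) by metis
  finally show ?case .
qed (simp_all add: plus_osuc times_osuc plus_assoc)

lemma omega_pow_zero [simp]: "omega_pow 0 = 1"
  by (simp add: omega_pow_def)

lemma omega_pow_osuc: "omega_pow (osuc a) = omega_pow a * omega" for a :: "'a::infinite ordinal"
  by (simp add: omega_pow_def)

lemma omega_pow_limit: "limit_ord a \<Longrightarrow> omega_pow a = (SUP b\<in>{..<a}. omega_pow b)"
  by (simp add: omega_pow_def ord_rec_limit)

lemma omega_pow_neq_zero [simp]: "omega_pow a \<noteq> 0" for a :: "'a::infinite ordinal"
proof (induction a rule: ord_induct)
  case (suc a)
  then show ?case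
    using normal_ge[OF normal_times[OF suc], of omega] by (auto simp: omega_pow_osuc)
next
  case (limit a)
  have "0 < a" using limit by (auto simp: zero_less_iff)
  from SUP_less_upper[OF this, of omega_pow] show ?case
    unfolding omega_pow_limit[OF limit(1)] by (auto simp: one_le_iff)
qed simp

lemma normal_omega_pow: "normal (omega_pow :: 'a::infinite ordinal \<Rightarrow> _)"
proof (rule normalI)
  fix a :: "'a ordinal"
  have "omega_pow a * 1 < omega_pow a * omega"
    using osuc_less_omega[of "0 :: 'a ordinal"]
    by (subst normal_less_iff[OF normal_times]) (auto simp: one_ordinal_def zero_less_iff)
  then show "omega_pow a < omega_pow (osuc a)" by (simp add: omega_pow_osuc)
qed (rule omega_pow_limit)

lemmas omega_pow_less_iff [simp] = normal_less_iff[OF normal_omega_pow]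
lemmas omega_pow_le_iff [simp] = normal_le_iff[OF normal_omega_pow]
lemmas omega_pow_eq_iff [simp] = normal_eq_iff[OF normal_omega_pow]

lemma omega_pow_absorb: "x < omega_pow r \<Longrightarrow> x + omega_pow r = omega_pow r"
  for x :: "'a::infinite ordinal"
proof (induction r arbitrary: x rule: ord_induct)
  case (suc r)
  let ?w = "omega_pow r"
  from suc.prems obtain n where n: "n < omega" "x < ?w * n"
    by (auto simp: omega_pow_osuc times_limit[OF limit_omega] less_SUP_less_iff)
  have "x + ?w * omega \<le> ?w * n + ?w * omega"
    using n by (intro plus_mono_left) simp
  also have "\<dots> = ?w * omega"
    using n by (simp add: finite_plus_omega flip: times_plus)
  finally show ?case by (auto simp: omega_pow_osuc intro: antisym)
next
  case (limit r)
  have "r \<noteq> 0" using limit by auto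
  obtain s where s: "s < r" "x < omega_pow s"
    using limit.prems \<open>r \<noteq> 0\<close> by (auto simp: omega_pow_limit[OF limit(1)] less_SUP_less_iff)
  have lim: "limit_ord (omega_pow r)"
    unfolding limit_ord_def
  proof (intro conjI allI impI)
    fix b assume "b < omega_pow r"
    then obtain t where t: "t < r" "b < omega_pow t"
      using \<open>r \<noteq> 0\<close> by (auto simp: omega_pow_limit[OF limit(1)] less_SUP_less_iff)
    have "osuc b \<le> omega_pow t" using t by (simp add: osuc_le_iff)
    also have "\<dots> < omega_pow r" using t by simp
    finally show "osuc b < omega_pow r" .
  qed simp
  have "x + omega_pow r \<le> omega_pow r"
    unfolding plus_limit[OF lim]
  proof (rule SUP_less_least)
    fix y assume "y < omega_pow r"
    then obtain t where t: "t < r" "y < omega_pow t"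
      using \<open>r \<noteq> 0\<close> by (auto simp: omega_pow_limit[OF limit(1)] less_SUP_less_iff)
    define u where "u = max s t"
    have u: "u < r" "x < omega_pow u" "y < omega_pow u"
      using s t omega_pow_le_iff[of s u] omega_pow_le_iff[of t u]
      by (auto simp: u_def simp del: omega_pow_le_iff intro: less_le_trans) 
    have "x + y \<le> x + omega_pow u" using u by simp
    also have "\<dots> = omega_pow u" using limit.IH u by simp
    also have "\<dots> \<le> omega_pow r" using u by simp
    finally show "x + y \<le> omega_pow r" .
  qed simp
  then show ?case by (rule antisym) simp
qed simp

lemma omega_pow_indecomposable:
  "x < omega_pow r \<Longrightarrow> y < omega_pow r \<Longrightarrow> x + y < omega_pow r" for x :: "'a::infinite ordinal"
  by (metis omega_pow_absorb plus_less_cancel)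

lemma omega_pow_add: "r < s \<Longrightarrow> omega_pow r + omega_pow s = omega_pow s" for r :: "'a::infinite ordinal"
  by (rule omega_pow_absorb) simp

lemma first_term:
  fixes a :: "'a::infinite ordinal"
  assumes "a \<noteq> 0"
  obtains r b where "a = omega_pow r + b" "b < a"
proof -
  obtain r where r: "omega_pow r \<le> a" "a < omega_pow (osuc r)"
    using normal_interval[OF normal_omega_pow, of a] assms by (auto simp: one_le_iff)
  obtain b where b: "omega_pow r + b = a" using ex_plus[OF r(1)] .
  have "b < a"
  proof (rule ccontr)
    assume "\<not> b < a"
    then have "b = a" using b le_plus_right[of b "omega_pow r"] by simp
    have "omega_pow r * n \<le> a" if "n < omega" for n
      using that
    proof (induction n rule: less_omega_induct)
      case (suc n)
      have "omega_pow r * osuc n = omega_pow r + omega_pow r * n"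
        using suc by (simp add: times_plus flip: one_plus_finite)
      also have "\<dots> \<le> omega_pow r + a" using suc by simp
      finally show ?case using b \<open>b = a\<close> by simp
    qed simp
    then have "omega_pow r * omega \<le> a"
      unfolding times_limit[OF limit_omega] by (intro SUP_less_least) simp_all
    then show False using r by (simp add: omega_pow_osuc)
  qed
  then show thesis using that[of r b] b by simp
qed

lemma first_term_unique:
  fixes b c :: "'a::infinite ordinal"
  assumes "omega_pow r + b = omega_pow s + c" "b < omega_pow r + b" "c < omega_pow s + c"
  shows "r = s" "b = c"
proof -
  have *: "\<not> r < s" if eq: "omega_pow r + b = omega_pow s + c" and lt: "b < omega_pow r + b"
    for r s b c :: "'a ordinal"
  proof
    assume "r < s"
    have "omega_pow r + (omega_pow r + b) = omega_pow r + b"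
      unfolding eq using omega_pow_add[OF \<open>r < s\<close>] by (simp flip: plus_assoc)
    then show False using lt by simp
  qed
  show "r = s"
    using *[OF assms(1,2)] *[OF assms(1)[symmetric] assms(3)] by simp
  then show "b = c" using assms by simp
qed

lemma last_term:
  fixes a :: "'a::infinite ordinal"
  assumes "a \<noteq> 0"
  obtains b r where "a = b + omega_pow r"
proof -
  have "\<exists>b r. a = b + omega_pow r"
    using assms
  proof (induction a rule: less_induct)
    case (less a)
    obtain s c where c: "a = omega_pow s + c" "c < a"
      using first_term[OF less.prems] .
    show ?case
    proof (cases "c = 0")
      case True
      then show ?thesis using c plus_zero_left plus_zero_right by metis
    next
      case False
      then show ?thesis using less.IH[OF c(2)] c(1) plus_assoc by metis
    qed
  qed
  then show thesis using that by blast
qed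

lemma last_term_unique:
  fixes b c :: "'a::infinite ordinal"
  assumes "b + omega_pow r = c + omega_pow s"
  shows "r = s"
proof -
  have "\<not> r < s" if eq: "b + omega_pow r = c + omega_pow s" for b r c s :: "'a ordinal"
  proof
    assume "r < s"
    show False
    proof (cases "b \<le> c")
      case True
      then obtain y where "b + y = c" by (rule ex_plus)
      then have "omega_pow r = y + omega_pow s"
        using eq by (metis plus_assoc plus_eq_cancel)
      then show False
        using \<open>r < s\<close> le_plus_right[of "omega_pow s" y] omega_pow_less_iff[of r s] by (simp add: not_less[symmetric])
    next
      case False
      then obtain y where y: "c + y = b" by (meson ex_plus le_less not_le)
      have "y < omega_pow s"
        using eq less_plus_left[of b "omega_pow r"] y by (metis omega_pow_neq_zero plus_less_cancel)
      moreover have "y + omega_pow r = omega_pow s"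
        using eq y by (metis plus_assoc plus_eq_cancel)
      ultimately show False
        using omega_pow_indecomposable[of y s "omega_pow r"] \<open>r < s\<close> by simp
    qed
  qed
  then show ?thesis using assms by (metis not_less_iff_gr_or_eq)
qed

section \<open>Existence and uniqueness of the hyperexponentials\<close>

lemma is_hyperexpD:
  assumes "is_hyperexp E"
  shows "E 0 x = x" "E a 0 = 0" "E 1 x = left_minus 1 (omega_pow x)"
    "a < omega_pow r + a \<Longrightarrow> E (omega_pow r + a) x = E (omega_pow r) (E a x)"
    "0 < r \<Longrightarrow> E (omega_pow r) (x + 1) = (SUP b\<in>{..<omega_pow r}. E b (E (omega_pow r) x + 1))"
    "0 < r \<Longrightarrow> limit_ord x \<Longrightarrow> E (omega_pow r) x = (SUP y\<in>{..<x}. E (omega_pow r) y)"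
  using assms unfolding is_hyperexp_def by blast+

lemma is_hyperexp_unique:
  fixes E E' :: "'a::infinite ordinal \<Rightarrow> 'a ordinal \<Rightarrow> 'a ordinal"
  assumes E: "is_hyperexp E" and E': "is_hyperexp E'"
  shows "E = E'"
proof -
  have "\<forall>x. E a x = E' a x" for a
  proof (induction a rule: less_induct)
    case (less a)
    show ?case
    proof (cases "a = 0")
      case True
      then show ?thesis by (simp add: is_hyperexpD(1)[OF E] is_hyperexpD(1)[OF E'])
    next
      case False
      then obtain r b where a: "a = omega_pow r + b" "b < a" by (rule first_term)
      consider "b \<noteq> 0" | "b = 0" "r = 0" | "b = 0" "0 < r" by (metis zero_less_iff)
      then show ?thesis
      proof cases
        case 1
        then have "omega_pow r < a" using a by simp
        then show ?thesis
          using less.IH[of b] less.IH[of "omega_pow r"] a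
          by (simp add: is_hyperexpD(4)[OF E] is_hyperexpD(4)[OF E'])
      next
        case 2
        then show ?thesis
          using a by (simp add: is_hyperexpD(3)[OF E] is_hyperexpD(3)[OF E'])
      next
        case 3
        then have a: "a = omega_pow r" using a by simp
        have "E a x = E' a x" for x
        proof (induction x rule: ord_induct)
          case zero
          then show ?case by (simp add: is_hyperexpD(2)[OF E] is_hyperexpD(2)[OF E'])
        next
          case (suc x)
          then show ?case
            using is_hyperexpD(5)[OF E \<open>0 < r\<close>, of x] is_hyperexpD(5)[OF E' \<open>0 < r\<close>, of x] less.IH
            by (simp add: plus_one flip: a)
        next
          case (limit x)
          then show ?case
            using is_hyperexpD(6)[OF E \<open>0 < r\<close>, of x] is_hyperexpD(6)[OF E' \<open>0 < r\<close>, of x]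
            by (simp flip: a)
        qed
        then show ?thesis by simp
      qed
    qed
  qed
  then show ?thesis by blast
qed

definition first_term_of :: "'a ordinal \<Rightarrow> 'a ordinal \<times> 'a ordinal \<Rightarrow> bool" where
  "first_term_of a p \<longleftrightarrow> a = omega_pow (fst p) + snd p \<and> snd p < a \<and> omega_pow (fst p) < a"

function hyperexp_fun :: "'a ordinal \<Rightarrow> 'a ordinal \<Rightarrow> 'a ordinal" where
  "hyperexp_fun a =
    (if a = 0 then (\<lambda>x. x)
     else if a = 1 then (\<lambda>x. left_minus 1 (omega_pow x))
     else if \<exists>r. a = omega_pow r then ord_rec 0 (\<lambda>x. SUP b\<in>{..<a}. hyperexp_fun b (osuc x))
     else if \<exists>p. first_term_of a p
       then (\<lambda>x. hyperexp_fun (omega_pow (fst (SOME p. first_term_of a p)))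
         (hyperexp_fun (snd (SOME p. first_term_of a p)) x))
     else undefined)"
  by auto
termination
proof (relation "{(b, a). b < a}")
  show "wf {(b, a :: 'a ordinal). b < a}" by (rule wf)
next
  fix a :: "'a ordinal"
  assume "\<exists>p. first_term_of a p"
  from someI_ex[OF this]
  show "(snd (SOME p. first_term_of a p), a) \<in> {(b, a). b < a}"
    "(omega_pow (fst (SOME p. first_term_of a p)), a) \<in> {(b, a). b < a}"
    by (simp_all add: first_term_of_def)
qed auto

declare hyperexp_fun.simps [simp del]

lemma is_hyperexp_fun: "is_hyperexp (hyperexp_fun :: 'a::infinite ordinal \<Rightarrow> _)"
proof -
  let ?E = "hyperexp_fun :: 'a ordinal \<Rightarrow> 'a ordinal \<Rightarrow> 'a ordinal"
  have E0: "?E 0 x = x" for x by (subst hyperexp_fun.simps) simp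
  have E1: "?E 1 x = left_minus 1 (omega_pow x)" for x by (subst hyperexp_fun.simps) simp
  have E1_zero: "?E 1 0 = 0"
    using left_minus_plus[of 1 "0 :: 'a ordinal"] by (simp add: E1)
  have Ew: "?E (omega_pow r) = ord_rec 0 (\<lambda>x. SUP b\<in>{..<omega_pow r}. ?E b (osuc x))" if "0 < r" for r
    using that omega_pow_eq_iff[of r 0] by (subst hyperexp_fun.simps) auto
  have Ec: "?E (omega_pow r + b) x = ?E (omega_pow r) (?E b x)" if lt: "b < omega_pow r + b" for r b x
  proof (cases "b = 0")
    case True
    then show ?thesis by (simp add: E0)
  next
    case False
    let ?P = "first_term_of (omega_pow r + b)"
    have P: "?P (r, b)" using False lt by (simp add: first_term_of_def)
    have not_pow: "omega_pow r + b \<noteq> omega_pow s" for s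
    proof
      assume eq: "omega_pow r + b = omega_pow s"
      then have "omega_pow r + b = omega_pow s + 0" by simp
      from first_term_unique[OF this lt] show False using False by (simp add: zero_less_iff)
    qed
    have "(SOME p. ?P p) = (r, b)"
    proof (rule some_equality)
      show "?P (r, b)" by (rule P)
      fix p assume "?P p"
      then show "p = (r, b)"
        using first_term_unique[OF _ lt, of "fst p" "snd p"]
        by (cases p) (auto simp: first_term_of_def)
    qed
    moreover have "\<exists>p. ?P p" using P by blast
    moreover have "omega_pow r + b \<noteq> 1" using not_pow[of 0] by simp
    ultimately show ?thesis
      using not_pow False by (subst hyperexp_fun.simps) simp
  qed
  have Ez: "?E a 0 = 0" for a
  proof (induction a rule: less_induct)
    case (less a)
    show ?case
    proof (cases "a = 0")
      case False
      then obtain r b where a: "a = omega_pow r + b" "b < a" by (rule first_term)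
      consider "b \<noteq> 0" | "b = 0" "r = 0" | "b = 0" "0 < r" by (metis zero_less_iff)
      then show ?thesis
      proof cases
        case 1
        then show ?thesis using a less.IH[of b] less.IH[of "omega_pow r"] by (simp add: Ec)
      qed (use a in \<open>simp_all add: E1_zero Ew\<close>)
    qed (simp add: E0)
  qed
  show ?thesis
    unfolding is_hyperexp_def
    by (intro conjI allI impI) (simp_all add: E0 Ez E1 Ec Ew plus_one ord_rec_limit)
qed

theorem ex1_hyperexp:
  "\<exists>!E :: 'a::infinite ordinal \<Rightarrow> 'a ordinal \<Rightarrow> 'a ordinal. is_hyperexp E"
proof (rule ex1I)
  show "is_hyperexp (hyperexp_fun :: 'a ordinal \<Rightarrow> 'a ordinal \<Rightarrow> 'a ordinal)"
    by (rule is_hyperexp_fun)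
  show "E = hyperexp_fun" if "is_hyperexp E" for E :: "'a ordinal \<Rightarrow> 'a ordinal \<Rightarrow> 'a ordinal"
    using that is_hyperexp_fun by (rule is_hyperexp_unique)
qed

lemma is_hyperexp_hyperexp: "is_hyperexp (hyperexp :: 'a::infinite ordinal \<Rightarrow> 'a ordinal \<Rightarrow> 'a ordinal)"
  unfolding hyperexp_def by (rule theI'[OF ex1_hyperexp])

lemmas hyperexp_zero [simp] = is_hyperexpD(1)[OF is_hyperexp_hyperexp]
lemmas hyperexp_zero_right [simp] = is_hyperexpD(2)[OF is_hyperexp_hyperexp]
lemmas hyperexp_one = is_hyperexpD(3)[OF is_hyperexp_hyperexp]
lemmas hyperexp_first_term = is_hyperexpD(4)[OF is_hyperexp_hyperexp]
lemmas hyperexp_succ = is_hyperexpD(5)[OF is_hyperexp_hyperexp]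
lemmas hyperexp_limit = is_hyperexpD(6)[OF is_hyperexp_hyperexp]

section \<open>Existence and uniqueness of the hyperlogarithms\<close>

lemma one_plus_hyperexp_one: "1 + hyperexp 1 x = omega_pow x" for x :: "'a::infinite ordinal"
  by (simp add: hyperexp_one plus_left_minus one_le_iff)

lemma omega_le_omega_pow: "x \<noteq> 0 \<Longrightarrow> omega \<le> omega_pow x" for x :: "'a::infinite ordinal"
proof -
  assume "x \<noteq> 0"
  have "omega \<le> 1 * (omega :: 'a ordinal)"
    by (rule normal_ge[OF normal_times]) simp
  also have "\<dots> = omega_pow 1"
    using omega_pow_osuc[of "0 :: 'a ordinal"] by (simp add: one_ordinal_def)
  also have "\<dots> \<le> omega_pow x"
    using \<open>x \<noteq> 0\<close> by (simp add: one_le_iff)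
  finally show ?thesis .
qed

lemma one_plus_omega_le: "omega \<le> x \<Longrightarrow> 1 + x = x" for x :: "'a::infinite ordinal"
proof -
  assume "omega \<le> x"
  then obtain y where y: "omega + y = x" by (rule ex_plus)
  have "(1 :: 'a ordinal) < omega"
    using osuc_less_omega[of "0 :: 'a ordinal"] by (simp add: one_ordinal_def zero_less_iff)
  then show ?thesis
    unfolding y[symmetric] by (simp add: finite_plus_omega flip: plus_assoc)
qed

lemma hyperexp_one_eq: "x \<noteq> 0 \<Longrightarrow> hyperexp 1 x = omega_pow x" for x :: "'a::infinite ordinal"
  using one_plus_omega_le[OF omega_le_omega_pow] one_plus_hyperexp_one[of x] by (metis plus_eq_cancel)

lemma normal_id: "normal (\<lambda>x :: 'a::infinite ordinal. x)"
proof (rule normalI)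
  fix a :: "'a ordinal"
  assume a: "limit_ord a"
  then have "a \<noteq> 0" by auto
  show "a = (SUP b\<in>{..<a}. b)"
  proof (rule antisym)
    show "a \<le> (SUP b\<in>{..<a}. b)"
    proof (rule ccontr)
      assume "\<not> ?thesis"
      then have "osuc (SUP b\<in>{..<a}. b) < a" using a by (simp add: limit_ord_def)
      from SUP_less_upper[OF this, of "\<lambda>b. b"] show False
        using less_osuc[of "SUP b\<in>{..<a}. b"] by (simp add: not_less[symmetric])
    qed
    show "(SUP b\<in>{..<a}. b) \<le> a"
      using \<open>a \<noteq> 0\<close> by (rule SUP_less_least) simp
  qed
qed simp

lemma normal_hyperexp_one: "normal (hyperexp 1 :: 'a::infinite ordinal \<Rightarrow> 'a ordinal)"
proof (rule normalI)
  fix a :: "'a ordinal"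
  have "1 + hyperexp 1 a < 1 + hyperexp 1 (osuc a)"
    unfolding one_plus_hyperexp_one by simp
  then show "hyperexp 1 a < hyperexp 1 (osuc a)" by simp
next
  fix a :: "'a ordinal"
  assume a: "limit_ord a"
  then have "a \<noteq> 0" by auto
  show "hyperexp 1 a = (SUP b\<in>{..<a}. hyperexp 1 b)"
  proof (rule antisym)
    show "hyperexp 1 a \<le> (SUP b\<in>{..<a}. hyperexp 1 b)"
      unfolding hyperexp_one_eq[OF \<open>a \<noteq> 0\<close>] omega_pow_limit[OF a]
    proof (rule SUP_less_least[OF \<open>a \<noteq> 0\<close>])
      fix b assume "b < a"
      then have *: "osuc b < a" using a by (simp add: limit_ord_def)
      have "omega_pow b \<le> hyperexp 1 (osuc b)"
        by (simp add: hyperexp_one_eq less_imp_le)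
      also have "\<dots> \<le> (SUP b\<in>{..<a}. hyperexp 1 b)" by (rule SUP_less_upper[OF *])
      finally show "omega_pow b \<le> (SUP b\<in>{..<a}. hyperexp 1 b)" .
    qed
    show "(SUP b\<in>{..<a}. hyperexp 1 b) \<le> hyperexp 1 a"
    proof (rule SUP_less_least[OF \<open>a \<noteq> 0\<close>])
      fix b assume "b < a"
      then have "1 + hyperexp 1 b \<le> 1 + hyperexp 1 a"
        unfolding one_plus_hyperexp_one by simp
      then show "hyperexp 1 b \<le> hyperexp 1 a" by simp
    qed
  qed
qed

lemma normal_hyperexp: "normal (hyperexp a :: 'a::infinite ordinal \<Rightarrow> 'a ordinal)"
proof (induction a rule: less_induct)
  case (less a)
  show ?case
  proof (cases "a = 0")
    case True
    then have "hyperexp a = (\<lambda>x. x)" by auto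
    then show ?thesis by (simp add: normal_id)
  next
    case False
    then obtain r b where a: "a = omega_pow r + b" "b < a" by (rule first_term)
    consider "b \<noteq> 0" | "b = 0" "r = 0" | "b = 0" "0 < r" by (metis zero_less_iff)
    then show ?thesis
    proof cases
      case 1
      then have "hyperexp a = (\<lambda>x. hyperexp (omega_pow r) (hyperexp b x))"
        using a by (auto simp: hyperexp_first_term)
      then show ?thesis
        using normal_comp[OF less.IH less.IH, of "omega_pow r" b] 1 a by simp
    next
      case 2
      then show ?thesis using a normal_hyperexp_one by simp
    next
      case 3
      then have a: "a = omega_pow r" using a by simp
      show ?thesis
      proof (rule normalI)
        fix x
        have "hyperexp a x < hyperexp 0 (hyperexp a x + 1)" by (simp add: plus_one)
        also have "\<dots> \<le> hyperexp a (osuc x)"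
          unfolding a plus_one[symmetric] hyperexp_succ[OF \<open>0 < r\<close>]
          by (rule SUP_less_upper) (simp add: zero_less_iff)
        finally show "hyperexp a x < hyperexp a (osuc x)" .
      qed (simp add: a hyperexp_limit[OF \<open>0 < r\<close>])
    qed
  qed
qed

lemma hyperexp_absorb_aux:
  assumes IH: "\<And>t x. t < r \<Longrightarrow> s < t \<Longrightarrow>
      hyperexp (omega_pow s) (hyperexp (omega_pow t) x) = hyperexp (omega_pow t) (x :: 'a::infinite ordinal)"
    and "s < r" "b < omega_pow r"
  shows "\<exists>c<omega_pow r. \<forall>x. hyperexp (omega_pow s) (hyperexp b x) = hyperexp c x"
proof (cases "b < omega_pow s + b")
  case True
  moreover have "omega_pow s + b < omega_pow r"
    using assms by (intro omega_pow_indecomposable) simp_all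
  ultimately show ?thesis by (metis hyperexp_first_term)
next
  case False
  then have eq: "omega_pow s + b = b" by (simp add: not_less antisym)
  then have "b \<noteq> 0" by auto
  then obtain t d where d: "b = omega_pow t + d" "d < b" by (rule first_term)
  have "s < t"
  proof (rule ccontr)
    assume "\<not> s < t"
    then obtain y where y: "omega_pow t + y = omega_pow s"
      by (meson ex_plus not_less omega_pow_le_iff)
    have "y + b = d"
      using eq y d(1) by (metis plus_assoc plus_eq_cancel)
    then show False using d(2) le_plus_right[of b y] by simp
  qed
  have "omega_pow t < omega_pow r"
    using d(1) assms(3) le_plus_left[of "omega_pow t" d] by (metis le_less_trans)
  then have "t < r" by simp
  have "hyperexp (omega_pow s) (hyperexp b x) = hyperexp b x" for x
    using IH[OF \<open>t < r\<close> \<open>s < t\<close>] d by (simp add: hyperexp_first_term)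
  then show ?thesis using assms(3) by blast
qed

lemma hyperexp_absorb:
  "s < r \<Longrightarrow> hyperexp (omega_pow s) (hyperexp (omega_pow r) x) = hyperexp (omega_pow r) x"
  for x :: "'a::infinite ordinal"
proof (induction r arbitrary: s x rule: less_induct)
  case (less r)
  have "0 < r" using less.prems by (meson le_less_trans ord_zero_le)
  show ?case
  proof (induction x rule: ord_induct)
    case (suc x)
    let ?w = "omega_pow r" and ?y = "hyperexp (omega_pow r) x + 1"
    have eq: "hyperexp ?w (osuc x) = (SUP b\<in>{..<?w}. hyperexp b ?y)"
      using hyperexp_succ[OF \<open>0 < r\<close>, of x] by (simp add: plus_one)
    have bound: "hyperexp (omega_pow s) (hyperexp b ?y) \<le> hyperexp ?w (osuc x)" if "b < ?w" for b
    proof -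
      obtain c where c: "c < ?w" "\<forall>x. hyperexp (omega_pow s) (hyperexp b x) = hyperexp c x"
        using hyperexp_absorb_aux[OF less.IH less.prems \<open>b < ?w\<close>] by blast
      then show ?thesis
        unfolding eq using SUP_less_upper[OF c(1), of "\<lambda>c. hyperexp c ?y"] by simp
    qed
    show ?case
    proof (rule antisym)
      show "hyperexp ?w (osuc x) \<le> hyperexp (omega_pow s) (hyperexp ?w (osuc x))"
        by (rule normal_ge[OF normal_hyperexp])
      show "hyperexp (omega_pow s) (hyperexp ?w (osuc x)) \<le> hyperexp ?w (osuc x)"
      proof -
        define z where "z = hyperexp ?w (osuc x)"
        define f where "f = hyperexp (omega_pow s)"
        have f: "normal f" unfolding f_def by (rule normal_hyperexp)
        have bound': "f (hyperexp b ?y) \<le> z" if "b < ?w" for b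
          using bound[OF that] by (simp add: f_def z_def)
        have "f z \<le> z"
      proof (cases z rule: ord_cases)
        case zero
        then show ?thesis by (simp add: f_def)
      next
        case (suc u)
        then have "u < z" by simp
        then obtain b where b: "b < ?w" "u < hyperexp b ?y"
          unfolding z_def eq by (auto simp: less_SUP_less_iff)
        then have "z \<le> hyperexp b ?y" using suc by (simp add: osuc_le_iff)
        then have "f z \<le> f (hyperexp b ?y)" by (simp add: normal_le_iff[OF f])
        then show ?thesis using bound'[OF b(1)] by simp
      next
        case limit
        then have "z \<noteq> 0" by auto
        show ?thesis
          unfolding normal_limit[OF f limit]
        proof (rule SUP_less_least[OF \<open>z \<noteq> 0\<close>])
          fix u assume "u < z"
          then obtain b where b: "b < ?w" "u < hyperexp b ?y"
            unfolding z_def eq by (auto simp: less_SUP_less_iff)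
          then have "f u \<le> f (hyperexp b ?y)" by (simp add: normal_le_iff[OF f])
          then show "f u \<le> z" using bound'[OF b(1)] by simp
        qed
      qed
      then show ?thesis by (simp add: z_def f_def)
    qed
    qed
  next
    case (limit x)
    have "hyperexp (omega_pow s) (hyperexp (omega_pow r) x) =
        (SUP y\<in>{..<x}. hyperexp (omega_pow s) (hyperexp (omega_pow r) y))"
      by (rule normal_limit[OF normal_comp[OF normal_hyperexp normal_hyperexp] limit(1)])
    also have "\<dots> = (SUP y\<in>{..<x}. hyperexp (omega_pow r) y)"
      using limit by (intro SUP_cong) auto
    finally show ?case
      using normal_limit[OF normal_hyperexp limit(1)] by metis
  qed simp
qed

lemma hyperexp_fixed:
  assumes fixed: "\<And>s. s < r \<Longrightarrow> hyperexp (omega_pow s) x = (x :: 'a::infinite ordinal)" and "0 < r"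
  shows "x \<in> range (hyperexp (omega_pow r))"
proof -
  let ?w = "omega_pow r"
  have fixed': "hyperexp b x = x" if "b < ?w" for b
    using that
  proof (induction b rule: less_induct)
    case (less b)
    show ?case
    proof (cases "b = 0")
      case False
      then obtain t d where d: "b = omega_pow t + d" "d < b" by (rule first_term)
      have "omega_pow t < ?w"
        using d(1) less.prems le_plus_left[of "omega_pow t" d] by (metis le_less_trans)
      then show ?thesis
        using d less.IH[of d] less.prems fixed[of t] by (simp add: hyperexp_first_term)
    qed simp
  qed
  obtain y where y: "hyperexp ?w y \<le> x" "x < hyperexp ?w (osuc y)"
    by (rule normal_interval[OF normal_hyperexp, of ?w x]) simp_all
  have "\<not> hyperexp ?w y < x"
  proof
    assume "hyperexp ?w y < x"
    then have le: "hyperexp ?w y + 1 \<le> x" by (simp add: plus_one osuc_le_iff)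
    have "hyperexp ?w (y + 1) \<le> x"
      unfolding hyperexp_succ[OF \<open>0 < r\<close>]
    proof (rule SUP_less_least)
      fix b assume "b < ?w"
      then show "hyperexp b (hyperexp ?w y + 1) \<le> x"
        using le normal_le_iff[OF normal_hyperexp, of b _ x] fixed' by metis
    qed simp
    then show False using y by (simp add: plus_one)
  qed
  then have "x = hyperexp ?w y" using y by simp
  then show ?thesis by simp
qed

lemma hyperexp_omega_pow_form:
  assumes "x \<noteq> (0 :: 'a::infinite ordinal)"
  obtains c where "hyperexp (omega_pow d) x = omega_pow c" "c \<noteq> 0"
proof -
  let ?y = "hyperexp (omega_pow d) x"
  have "?y \<in> range (hyperexp (omega_pow 0))"
    using hyperexp_absorb[of 0 d x] by (cases "d = 0") (auto simp: zero_less_iff intro: rangeI, metis rangeI)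
  then obtain c where c: "?y = hyperexp 1 c" by auto
  moreover have "?y \<noteq> 0"
    using normal_ge[OF normal_hyperexp, of x "omega_pow d"] assms by auto
  ultimately have "c \<noteq> 0" by auto
  then show thesis using that c by (simp add: hyperexp_one_eq)
qed

lemma is_hyperlogD:
  assumes "is_hyperlog L"
  shows "L 0 x = x" "L a 0 = 0" "0 < a \<Longrightarrow> 0 < y \<Longrightarrow> L a (x + y) = L a y" "0 < a \<Longrightarrow> L a 1 = 0"
    "a < omega_pow r + a \<Longrightarrow> L (omega_pow r + a) x = L a (L (omega_pow r) x)"
    "L (omega_pow r) (hyperexp (omega_pow d) x) =
        (if d < r then L (omega_pow r) x else if d = r then x else hyperexp (omega_pow d) x)"
  using assms unfolding is_hyperlog_def by blast+

lemma hyperlog_step: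
  fixes x :: "'a::infinite ordinal"
  assumes "x = omega_pow c" "c \<noteq> 0" "x \<notin> range (hyperexp (omega_pow r))"
  obtains s y where "s < r" "x = hyperexp (omega_pow s) y" "y < x"
proof -
  define d where "d = (LEAST d. x \<notin> range (hyperexp (omega_pow d)))"
  have d: "x \<notin> range (hyperexp (omega_pow d))" "d \<le> r"
    unfolding d_def using assms(3)
    by (rule LeastI[of "\<lambda>d. x \<notin> range (hyperexp (omega_pow d))"],
        rule Least_le[of "\<lambda>d. x \<notin> range (hyperexp (omega_pow d))"])
  have less_d: "x \<in> range (hyperexp (omega_pow s))" if "s < d" for s
    using not_less_Least[of s "\<lambda>d. x \<notin> range (hyperexp (omega_pow d))"] that
    unfolding d_def by blast
  have "x = hyperexp 1 c" using assms by (simp add: hyperexp_one_eq)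
  then have "d \<noteq> 0" using d by auto
  then obtain s where s: "s < d" "hyperexp (omega_pow s) x \<noteq> x"
    using hyperexp_fixed[of d x] d by (auto simp: zero_less_iff)
  obtain y where y: "x = hyperexp (omega_pow s) y" using less_d[OF s(1)] by auto
  have "y \<le> x" unfolding y by (rule normal_ge[OF normal_hyperexp])
  moreover have "y \<noteq> x" using s y by auto
  ultimately have "y < x" by simp
  then show thesis using that[of s y] s(1) d(2) y by simp
qed

lemma is_hyperlog_unique:
  fixes L L' :: "'a::infinite ordinal \<Rightarrow> 'a ordinal \<Rightarrow> 'a ordinal"
  assumes L: "is_hyperlog L" and L': "is_hyperlog L'"
  shows "L = L'"
proof -
  have pow: "L (omega_pow r) x = L' (omega_pow r) x" for r x
  proof (induction x rule: less_induct)
    case (less x)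
    have pos: "0 < omega_pow r" by (simp add: zero_less_iff)
    show ?case
    proof (cases "x = 0")
      case True
      then show ?thesis by (simp add: is_hyperlogD(2)[OF L] is_hyperlogD(2)[OF L'])
    next
      case False
      then obtain b c where x: "x = b + omega_pow c" by (rule last_term)
      have red: "M (omega_pow r) x = M (omega_pow r) (omega_pow c)" if "is_hyperlog M" for M
        unfolding x using is_hyperlogD(3)[OF that pos, of "omega_pow c"] by (simp add: zero_less_iff)
      consider "omega_pow c < x" | "x = omega_pow c"
        using x le_plus_right[of "omega_pow c" b] by (auto simp: le_less)
      then show ?thesis
      proof cases
        case 1
        then show ?thesis using less.IH red[OF L] red[OF L'] by simp
      next
        case xc: 2
        consider "c = 0" | "x \<in> range (hyperexp (omega_pow r))" | "c \<noteq> 0" "x \<notin> range (hyperexp (omega_pow r))"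
          by blast
        then show ?thesis
        proof cases
          case 1
          then show ?thesis
            using xc is_hyperlogD(4)[OF L pos] is_hyperlogD(4)[OF L' pos] by simp
        next
          case 2
          then show ?thesis
            by (auto simp: is_hyperlogD(6)[OF L] is_hyperlogD(6)[OF L'])
        next
          case 3
          then obtain s y where s: "s < r" "x = hyperexp (omega_pow s) y" "y < x"
            using hyperlog_step[OF xc] by blast
          have step: "M (omega_pow r) x = M (omega_pow r) y" if "is_hyperlog M" for M
            unfolding s(2) using is_hyperlogD(6)[OF that] s(1) by simp
          then show ?thesis using less.IH[OF s(3)] step[OF L] step[OF L'] by simp
        qed
      qed
    qed
  qed
  have "\<forall>x. L a x = L' a x" for a
  proof (induction a rule: less_induct)
    case (less a)
    show ?case
    proof (cases "a = 0")
      case True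
      then show ?thesis by (simp add: is_hyperlogD(1)[OF L] is_hyperlogD(1)[OF L'])
    next
      case False
      then obtain r b where a: "a = omega_pow r + b" "b < a" by (rule first_term)
      then show ?thesis
        using less.IH[of b] pow by (simp add: is_hyperlogD(5)[OF L] is_hyperlogD(5)[OF L'])
    qed
  qed
  then show ?thesis by blast
qed

text \<open>\<open>hyperlog_pow r\<close> is the hyperlogarithm with exponent \<open>\<omega>\<^sup>r\<close>.\<close>

definition hyperlog_red :: "'a ordinal \<Rightarrow> 'a ordinal \<Rightarrow> 'a ordinal \<Rightarrow> bool" where
  "hyperlog_red r x y \<longleftrightarrow> y < x \<and>
     ((\<exists>b c. x = b + omega_pow c \<and> y = omega_pow c) \<or> (\<exists>s<r. x = hyperexp (omega_pow s) y))"

function hyperlog_pow :: "'a ordinal \<Rightarrow> 'a ordinal \<Rightarrow> 'a ordinal" where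
  "hyperlog_pow r x =
    (if x = 0 \<or> x = 1 then 0
     else if x \<in> range (hyperexp (omega_pow r)) then inv (hyperexp (omega_pow r)) x
     else if \<exists>y. hyperlog_red r x y then hyperlog_pow r (SOME y. hyperlog_red r x y)
     else 0)"
  by auto
termination
proof (relation "inv_image {(y, x). y < x} snd")
  show "wf (inv_image {(y, x :: 'a ordinal). y < x} (snd :: 'a ordinal \<times> 'a ordinal \<Rightarrow> 'a ordinal))"
    by (rule wf_inv_image[OF wf])
next
  fix r x :: "'a ordinal"
  assume "\<exists>y. hyperlog_red r x y"
  from someI_ex[OF this]
  show "((r, SOME y. hyperlog_red r x y), (r, x)) \<in> inv_image {(y, x). y < x} snd"
    by (simp add: hyperlog_red_def)
qed

declare hyperlog_pow.simps [simp del]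

lemma hyperlog_pow_zero [simp]: "hyperlog_pow r 0 = 0"
  by (subst hyperlog_pow.simps) simp

lemma hyperlog_pow_one [simp]: "hyperlog_pow r 1 = 0"
  by (subst hyperlog_pow.simps) simp

lemma hyperexp_neq_one [simp]: "hyperexp (omega_pow d) x \<noteq> 1" for x :: "'a::infinite ordinal"
proof (cases "x = 0")
  case False
  then obtain c where "hyperexp (omega_pow d) x = omega_pow c" "c \<noteq> 0"
    by (rule hyperexp_omega_pow_form)
  then show ?thesis using omega_pow_eq_iff[of c 0] by simp
qed (simp add: one_neq_zero[symmetric])

lemma hyperlog_pow_hyperexp [simp]: "hyperlog_pow r (hyperexp (omega_pow r) x) = x"
  for x :: "'a::infinite ordinal"
proof (cases "hyperexp (omega_pow r) x = 0")
  case True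
  then have "x = 0" using normal_ge[OF normal_hyperexp, of x "omega_pow r"] by simp
  then show ?thesis by simp
next
  case False
  have "inj (hyperexp (omega_pow r) :: 'a ordinal \<Rightarrow> 'a ordinal)"
    by (rule injI) (simp add: normal_eq_iff[OF normal_hyperexp])
  then show ?thesis using False by (subst hyperlog_pow.simps) simp
qed

lemma sum_omega_pow_eq:
  fixes b :: "'a::infinite ordinal"
  assumes "omega_pow c = b + omega_pow d"
  shows "c = d"
  using last_term_unique[of 0 c b d] assms by simp

lemma hyperlog_red_unique:
  fixes x :: "'a::infinite ordinal"
  assumes "hyperlog_red r x y" "hyperlog_red r x z"
  shows "y = z"
proof -
  have form: "\<exists>c. hyperexp (omega_pow s) y = omega_pow c" if "y < hyperexp (omega_pow s) y" for s y :: "'a ordinal"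
  proof -
    have "y \<noteq> 0" using that by auto
    then show ?thesis by (metis hyperexp_omega_pow_form)
  qed
  have exp: "\<not> s < t" if "hyperexp (omega_pow s) y = hyperexp (omega_pow t) z" "y < hyperexp (omega_pow s) y"
    for s t y z :: "'a ordinal"
  proof
    assume "s < t"
    then have "hyperexp (omega_pow s) (hyperexp (omega_pow s) y) = hyperexp (omega_pow s) y"
      using hyperexp_absorb that(1) by metis
    then show False using that(2) by (simp add: normal_eq_iff[OF normal_hyperexp])
  qed
  have mixed: False if "omega_pow c < x" "x = b + omega_pow c" "x = hyperexp (omega_pow s) y" "y < x" for b c s y
    using form[of y s] that sum_omega_pow_eq by (metis less_irrefl)
  show ?thesis
    using assms unfolding hyperlog_red_def
    by (elim conjE disjE exE)
      (metis last_term_unique, metis mixed, metis mixed, metis exp less_linear normal_eq_iff normal_hyperexp)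
qed

lemma hyperlog_pow_red:
  fixes x :: "'a::infinite ordinal"
  assumes red: "hyperlog_red r x y"
  shows "hyperlog_pow r x = hyperlog_pow r y"
proof -
  have some: "(SOME y. hyperlog_red r x y) = y"
    using red hyperlog_red_unique by (intro some_equality) blast+
  have "y < x" using red by (simp add: hyperlog_red_def)
  then have "x \<noteq> 0" by auto
  consider "x = 1" | "x \<noteq> 1" "x \<notin> range (hyperexp (omega_pow r))" | z where "x = hyperexp (omega_pow r) z"
    by blast
  then show ?thesis
  proof cases
    case 1
    then show ?thesis using \<open>y < x\<close> by simp
  next
    case 2
    then show ?thesis
      using \<open>x \<noteq> 0\<close> red by (subst hyperlog_pow.simps) (auto simp: some)
  next
    case 3
    then have "z \<noteq> 0" using \<open>x \<noteq> 0\<close> by auto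
    then obtain e where e: "x = omega_pow e" using hyperexp_omega_pow_form 3 by metis
    have False
      using red unfolding hyperlog_red_def
    proof (elim conjE disjE exE)
      fix b c assume "x = b + omega_pow c" "y = omega_pow c"
      then show False using e sum_omega_pow_eq \<open>y < x\<close> by (metis less_irrefl)
    next
      fix s assume s: "s < r" "x = hyperexp (omega_pow s) y"
      then have "hyperexp (omega_pow s) x = hyperexp (omega_pow s) y"
        using 3 hyperexp_absorb by metis
      then show False using \<open>y < x\<close> by (simp add: normal_eq_iff[OF normal_hyperexp])
    qed
    then show ?thesis ..
  qed
qed

lemma hyperlog_pow_less:
  fixes x :: "'a::infinite ordinal"
  assumes "d < r"
  shows "hyperlog_pow r (hyperexp (omega_pow d) x) = hyperlog_pow r x"
proof (cases "hyperexp (omega_pow d) x = x")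
  case False
  then have "x < hyperexp (omega_pow d) x"
    using normal_ge[OF normal_hyperexp, of x "omega_pow d"] by simp
  then show ?thesis
    using assms by (intro hyperlog_pow_red) (auto simp: hyperlog_red_def)
qed simp

lemma hyperlog_pow_greater:
  fixes x :: "'a::infinite ordinal"
  assumes "r < d"
  shows "hyperlog_pow r (hyperexp (omega_pow d) x) = hyperexp (omega_pow d) x"
  using hyperlog_pow_hyperexp[of r "hyperexp (omega_pow d) x"] hyperexp_absorb[OF assms, of x] by simp

lemma hyperlog_pow_plus:
  fixes x :: "'a::infinite ordinal"
  assumes "0 < y"
  shows "hyperlog_pow r (x + y) = hyperlog_pow r y"
proof -
  have last: "hyperlog_pow r (b + omega_pow c) = hyperlog_pow r (omega_pow c)" for b c :: "'a ordinal"
  proof (cases "omega_pow c = b + omega_pow c")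
    case False
    then have "omega_pow c < b + omega_pow c" by (simp add: le_less[symmetric] less_le)
    then show ?thesis by (intro hyperlog_pow_red) (auto simp: hyperlog_red_def)
  qed simp
  from assms obtain b c where "y = b + omega_pow c" by (auto simp: zero_less_iff elim: last_term)
  then show ?thesis using last[of b c] last[of "x + b" c] by (simp add: plus_assoc)
qed

definition first_split :: "'a ordinal \<Rightarrow> 'a ordinal \<times> 'a ordinal \<Rightarrow> bool" where
  "first_split a p \<longleftrightarrow> a = omega_pow (fst p) + snd p \<and> snd p < a"

function hyperlog_fun :: "'a ordinal \<Rightarrow> 'a ordinal \<Rightarrow> 'a ordinal" where
  "hyperlog_fun a x =
    (if \<exists>p. first_split a p
     then hyperlog_fun (snd (SOME p. first_split a p)) (hyperlog_pow (fst (SOME p. first_split a p)) x)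
     else x)"
  by auto
termination
proof (relation "inv_image {(b, a). b < a} fst")
  show "wf (inv_image {(b, a :: 'a ordinal). b < a} (fst :: 'a ordinal \<times> 'a ordinal \<Rightarrow> 'a ordinal))"
    by (rule wf_inv_image[OF wf])
next
  fix a x :: "'a ordinal"
  assume "\<exists>p. first_split a p"
  from someI_ex[OF this]
  show "((snd (SOME p. first_split a p), hyperlog_pow (fst (SOME p. first_split a p)) x), (a, x))
      \<in> inv_image {(b, a). b < a} fst"
    by (simp add: first_split_def)
qed

declare hyperlog_fun.simps [simp del]

lemma is_hyperlog_fun: "is_hyperlog (hyperlog_fun :: 'a::infinite ordinal \<Rightarrow> 'a ordinal \<Rightarrow> 'a ordinal)"
proof -
  let ?L = "hyperlog_fun :: 'a ordinal \<Rightarrow> 'a ordinal \<Rightarrow> 'a ordinal"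
  have L0: "?L 0 x = x" for x
    by (subst hyperlog_fun.simps) (simp add: first_split_def)
  have Ls: "?L (omega_pow r + b) x = ?L b (hyperlog_pow r x)" if lt: "b < omega_pow r + b" for r b x
  proof -
    have P: "first_split (omega_pow r + b) (r, b)" using lt by (simp add: first_split_def)
    have "(SOME p. first_split (omega_pow r + b) p) = (r, b)"
    proof (rule some_equality)
      show "first_split (omega_pow r + b) (r, b)" by (rule P)
      fix p assume "first_split (omega_pow r + b) p"
      then show "p = (r, b)"
        using first_term_unique[OF _ lt, of "fst p" "snd p"]
        by (cases p) (auto simp: first_split_def)
    qed
    then show ?thesis using P by (subst hyperlog_fun.simps) auto
  qed
  have Lw: "?L (omega_pow r) x = hyperlog_pow r x" for r x
    using Ls[of 0 r x] by (simp add: L0 zero_less_iff)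
  have Lz: "?L a 0 = 0" for a
  proof (induction a rule: less_induct)
    case (less a)
    show ?case
    proof (cases "a = 0")
      case False
      then obtain r b where "a = omega_pow r + b" "b < a" by (rule first_term)
      then show ?thesis using less.IH[of b] by (simp add: Ls)
    qed (simp add: L0)
  qed
  have Lp: "?L a (x + y) = ?L a y" "?L a 1 = 0" if "0 < a" "0 < y" for a x y
  proof -
    have "a \<noteq> 0" using that by auto
    then obtain r b where "a = omega_pow r + b" "b < a" by (rule first_term)
    then show "?L a (x + y) = ?L a y" "?L a 1 = 0"
      using that by (simp_all add: Ls hyperlog_pow_plus Lz)
  qed
  have L1: "?L a 1 = 0" if "0 < a" for a
    using Lp(2)[OF that that] .
  have L6: "?L (omega_pow r) (hyperexp (omega_pow d) x) =
     (if d < r then ?L (omega_pow r) x else if d = r then x else hyperexp (omega_pow d) x)" for r d x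
    by (auto simp: Lw hyperlog_pow_less hyperlog_pow_greater not_less le_less)
  show ?thesis
    unfolding is_hyperlog_def
    by (intro conjI allI impI) (rule L0 Lz Lp(1) L1 L6 | assumption | simp add: Ls Lw)+
qed

theorem ex1_hyperlog:
  "\<exists>!L :: 'a::infinite ordinal \<Rightarrow> 'a ordinal \<Rightarrow> 'a ordinal. is_hyperlog L"
proof (rule ex1I)
  show "is_hyperlog (hyperlog_fun :: 'a ordinal \<Rightarrow> 'a ordinal \<Rightarrow> 'a ordinal)"
    by (rule is_hyperlog_fun)
  show "L = hyperlog_fun" if "is_hyperlog L" for L :: "'a ordinal \<Rightarrow> 'a ordinal \<Rightarrow> 'a ordinal"
    using that is_hyperlog_fun by (rule is_hyperlog_unique)
qed

lemma is_hyperlog_hyperlog: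
  "is_hyperlog (hyperlog :: 'a::infinite ordinal \<Rightarrow> 'a ordinal \<Rightarrow> 'a ordinal)"
  unfolding hyperlog_def by (rule theI'[OF ex1_hyperlog])

lemmas hyperlog_zero [simp] = is_hyperlogD(1)[OF is_hyperlog_hyperlog]
lemmas hyperlog_zero_right [simp] = is_hyperlogD(2)[OF is_hyperlog_hyperlog]
lemmas hyperlog_plus = is_hyperlogD(3)[OF is_hyperlog_hyperlog]
lemmas hyperlog_one_right = is_hyperlogD(4)[OF is_hyperlog_hyperlog]
lemmas hyperlog_first_term = is_hyperlogD(5)[OF is_hyperlog_hyperlog]
lemmas hyperlog_hyperexp = is_hyperlogD(6)[OF is_hyperlog_hyperlog]

lemma hyperlog_omega_one: "hyperlog 1 (z + omega_pow r) = r" for r :: "'a::infinite ordinal"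
proof (cases "r = 0")
  case False
  then show ?thesis
    using hyperlog_plus[of 1 "omega_pow r" z] hyperlog_hyperexp[of 0 0 r]
    by (simp add: zero_less_iff hyperexp_one_eq)
qed (simp add: hyperlog_plus hyperlog_one_right zero_less_iff)

section \<open>The derived-set clause for diamonds\<close>

lemma topspace_icard_topology [simp]:
  fixes \<Theta> :: "'a::infinite ordinal"
  shows "topspace (icard_topology \<Theta> a) = {..<\<Theta>}"
proof
  show "topspace (icard_topology \<Theta> a) \<subseteq> {..<\<Theta>}"
    by (auto simp: icard_topology_def topology_generated_by_topspace)
  show "{..<\<Theta>} \<subseteq> topspace (icard_topology \<Theta> a)"
    unfolding icard_topology_def topology_generated_by_topspace
    by (intro subsetI UnionI[of "{z. z < \<Theta> \<and> hyperlog 0 z \<le> \<Theta>}"] UnI2 CollectI exI[of _ 0] exI[of _ \<Theta>]) (auto simp: ord_zero_le)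
qed

lemma top_sat_Dia:
  fixes \<Theta> :: "'a::infinite ordinal"
  shows "x < \<Theta> \<Longrightarrow> top_sat \<Theta> (Dia a p) x \<longleftrightarrow>
    (\<forall>U. openin (icard_topology \<Theta> a) U \<and> x \<in> U \<longrightarrow> (\<exists>y\<in>U. y \<noteq> x \<and> top_sat \<Theta> p y))"
proof -
  assume x: "x < \<Theta>"
  have sub: "y < \<Theta>" if "openin (icard_topology \<Theta> a) U" "y \<in> U" for U y
    using openin_subset[OF that(1)] that(2) by auto
  have "top_sat \<Theta> (Dia a p) x \<longleftrightarrow> (\<forall>U. x \<in> U \<and> openin (icard_topology \<Theta> a) U \<longrightarrow>
      (\<exists>y. y \<noteq> x \<and> (y < \<Theta> \<and> top_sat \<Theta> p y) \<and> y \<in> U))"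
    using x by (simp add: Dia_def derived_set_of_def) meson
  then show ?thesis using sub by metis
qed

end

theory Submission
  imports Defs
begin

text \<open>
  In either structure a closed formula defines a Boolean combination of cones
  \<open>{g. \<forall>\<xi><\<Lambda>. \<ell>\<^sup>\<xi> a \<le> g \<xi>}\<close>; a point \<open>x\<close> of the space is identified with the \<open>\<ell>\<close>-sequence
  \<open>\<xi> \<mapsto> \<ell>\<^sup>\<xi> x\<close>. Cones are closed under finite intersections, so such a set is a finite union of
  pieces: cones from which finitely many cones are removed. The diamond of a piece, whether taken
  along \<open><\<^sub>b\<close> or as a derived set, is governed by the least element of its cone, and is a piece
  again. Hence truth at \<open>x\<close> in the space coincides with truth at \<open>\<xi> \<mapsto> \<ell>\<^sup>\<xi> x\<close> in the frame, and only the
  frame has to be considered. There the sole axiom that is not valid for arbitrary sets is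
  monotonicity, and it holds for pieces because their cones are generated by exact sequences
  \<open>\<xi> \<mapsto> \<ell>\<^sup>\<xi> a\<close>.
\<close>

section \<open>Hyperlogarithms\<close>

lemma omega_pow_gt_zero [simp]: "0 < omega_pow r" for r :: "'a::infinite ordinal"
  by (simp add: zero_less_iff)

text \<open>The cases follow the clauses that compute \<open>hyperlog (omega_pow r)\<close>. A power
  of \<omega> other than 1 outside the range of \<open>hyperexp (omega_pow r)\<close> has a smaller
  reduct by \<open>hyperlog_step\<close>.\<close>

lemma hyperlog_pow_induct [case_names zero one exp plus step]:
  fixes x :: "'a::infinite ordinal"
  assumes zero: "P 0" and one: "P 1"
    and exp: "\<And>y. P (hyperexp (omega_pow r) y)"
    and plus: "\<And>z c. P (omega_pow c) \<Longrightarrow> P (z + omega_pow c)"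
    and step: "\<And>s y. s < r \<Longrightarrow> P y \<Longrightarrow> P (hyperexp (omega_pow s) y)"
  shows "P x"
proof (induction x rule: less_induct)
  case (less x)
  show ?case
  proof (cases "x = 0")
    case False
    then obtain z c where x: "x = z + omega_pow c" by (rule last_term)
    show ?thesis
    proof (cases "omega_pow c < x")
      case True
      then show ?thesis using less plus x by blast
    next
      case False
      then have xc: "x = omega_pow c" using x le_plus_right[of "omega_pow c" z] by (metis le_less)
      consider "c = 0" | "x \<in> range (hyperexp (omega_pow r))" | "c \<noteq> 0" "x \<notin> range (hyperexp (omega_pow r))"
        by blast
      then show ?thesis
      proof cases
        case 3
        then obtain s y where "s < r" "x = hyperexp (omega_pow s) y" "y < x"
          using hyperlog_step[OF xc] by blast
        then show ?thesis using step less.IH by blast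
      qed (use xc one exp in auto)
    qed
  qed (simp add: zero)
qed

text \<open>Apart from sending 1 to 0, \<open>hyperlog (omega_pow r)\<close> only drops leading
  summands and strips hyperexponentials with exponents at most \<open>omega_pow r\<close>;
  \<open>hyperlog (omega_pow s)\<close> is insensitive to all of this.\<close>

lemma hyperlog_pow_absorb:
  fixes x :: "'a::infinite ordinal"
  assumes "r < s"
  shows "hyperlog (omega_pow s) (hyperlog (omega_pow r) x) = hyperlog (omega_pow s) x"
proof (induction x rule: hyperlog_pow_induct[where r = r])
  case (step t y)
  then show ?case using less_trans[OF step(1) assms] by (simp add: hyperlog_hyperexp)
qed (simp_all add: assms hyperlog_one_right hyperlog_hyperexp hyperlog_plus)

text \<open>Were the leading exponent of \<open>d\<close> at most \<open>r\<close>, left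
  cancellation would give \<open>y + d = d'\<close>, although \<open>d' < d\<close>.\<close>

lemma plus_absorb_first_term:
  fixes d :: "'a::infinite ordinal"
  assumes "omega_pow r + d = d"
  obtains s d' where "d = omega_pow s + d'" "d' < d" "r < s"
proof -
  have "d \<noteq> 0" using assms by auto
  then obtain s d' where d: "d = omega_pow s + d'" "d' < d" by (rule first_term)
  have "r < s"
  proof (rule ccontr)
    assume "\<not> r < s"
    then obtain y where y: "omega_pow s + y = omega_pow r"
      by (meson ex_plus not_less omega_pow_le_iff)
    have "y + d = d'"
      using assms y d(1) by (metis plus_assoc plus_eq_cancel)
    then show False using d(2) le_plus_right[of d y] by simp
  qed
  then show thesis using that d by blast
qed

text \<open>The defining clause is silent when \<open>d\<close> absorbs \<open>omega_pow r\<close>;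
  then the leading exponent of \<open>d\<close> exceeds \<open>r\<close>, and
  \<open>hyperlog_pow_absorb\<close> makes the inner logarithm irrelevant.\<close>

lemma hyperlog_pow_plus_exponent:
  "hyperlog (omega_pow r + d) x = hyperlog d (hyperlog (omega_pow r) x)" for x :: "'a::infinite ordinal"
proof (cases "omega_pow r + d = d")
  case True
  then obtain s d' where "d = omega_pow s + d'" "d' < d" "r < s" by (rule plus_absorb_first_term)
  then show ?thesis
    using True by (metis hyperlog_first_term hyperlog_pow_absorb)
next
  case False
  then show ?thesis by (metis hyperlog_first_term le_plus_right le_less)
qed

text \<open>Leading terms of \<open>a\<close> are peeled off one by one. The law is what makes tails
  of the sequences \<open>\<lambda>a. hyperlog a x\<close> sequences of the same kind.\<close>

lemma hyperlog_plus_exponent: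
  "hyperlog (a + b) x = hyperlog b (hyperlog a x)" for x :: "'a::infinite ordinal"
proof (induction a arbitrary: x rule: less_induct)
  case (less a)
  show ?case
  proof (cases "a = 0")
    case False
    then obtain r c where a: "a = omega_pow r + c" "c < a" by (rule first_term)
    have "hyperlog (a + b) x = hyperlog (c + b) (hyperlog (omega_pow r) x)"
      unfolding a(1) plus_assoc by (rule hyperlog_pow_plus_exponent)
    also have "\<dots> = hyperlog b (hyperlog a x)"
      unfolding a(1) hyperlog_pow_plus_exponent by (rule less.IH[OF a(2)])
    finally show ?thesis .
  qed simp
qed

text \<open>Equality holds on the range of \<open>hyperexp (omega_pow r)\<close>, and a reduct is
  never larger than the ordinal it comes from.\<close>

lemma hyperexp_hyperlog_le:
  "hyperexp (omega_pow r) (hyperlog (omega_pow r) x) \<le> x" for x :: "'a::infinite ordinal"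
proof (induction x rule: hyperlog_pow_induct[where r = r])
  case (plus z c)
  then show ?case by (simp add: hyperlog_plus order.trans[OF _ le_plus_right])
next
  case (step s y)
  then show ?case
    using order.trans[OF _ normal_ge[OF normal_hyperexp]] by (simp add: hyperlog_hyperexp)
qed (simp_all add: hyperlog_one_right hyperlog_hyperexp)

lemma hyperexp_le_if_le_hyperlog:
  fixes x :: "'a::infinite ordinal"
  assumes "y \<le> hyperlog (omega_pow r) x"
  shows "hyperexp (omega_pow r) y \<le> x"
  using assms hyperexp_hyperlog_le[of r x] normal_le_iff[OF normal_hyperexp] order.trans by blast

lemma hyperlog_le [simp]: "hyperlog a x \<le> x" for x :: "'a::infinite ordinal"
proof (induction a arbitrary: x rule: less_induct)
  case (less a)
  have pow: "hyperlog (omega_pow r) x \<le> x" for r and x :: "'a ordinal"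
    using hyperexp_hyperlog_le normal_ge[OF normal_hyperexp] order.trans by blast
  show ?case
  proof (cases "a = 0")
    case False
    then obtain r c where a: "a = omega_pow r + c" "c < a" by (rule first_term)
    then show ?thesis
      using less.IH[OF a(2)] pow order.trans by (fastforce simp: hyperlog_plus_exponent)
  qed simp
qed

lemma hyperlog_antimono: "a \<le> b \<Longrightarrow> hyperlog b x \<le> hyperlog a x" for x :: "'a::infinite ordinal"
  by (metis ex_plus hyperlog_le hyperlog_plus_exponent)

lemma hyperlog_less_omega_pow:
  fixes x :: "'a::infinite ordinal"
  assumes "a < omega_pow r"
  shows "hyperlog a (hyperexp (omega_pow r) x) = hyperexp (omega_pow r) x"
  using assms
proof (induction a rule: less_induct)
  case (less a)
  show ?case
  proof (cases "a = 0")
    case False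
    then obtain s c where a: "a = omega_pow s + c" "c < a" by (rule first_term)
    then have "s < r" using less.prems by (metis le_plus_left le_less_trans omega_pow_less_iff)
    then show ?thesis
      using a less.IH[OF a(2)] less_trans[OF a(2) less.prems]
      by (auto simp: hyperlog_plus_exponent hyperlog_hyperexp)
  qed simp
qed

text \<open>Converse of \<open>hyperlog_less_omega_pow\<close>: the hyperexponentials with exponents
  \<open>omega_pow s\<close>, \<open>s < r\<close>, also fix \<open>x\<close>, so
  \<open>hyperexp_fixed\<close> applies.\<close>

lemma hyperlog_fixed:
  fixes x :: "'a::infinite ordinal"
  assumes "r \<noteq> 0" and fixed: "\<And>a. a < omega_pow r \<Longrightarrow> hyperlog a x = x"
  shows "x \<in> range (hyperexp (omega_pow r))"
proof (rule hyperexp_fixed)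
  fix s assume "s < r"
  then have "hyperexp (omega_pow s) x \<le> x" by (intro hyperexp_le_if_le_hyperlog) (simp add: fixed)
  then show "hyperexp (omega_pow s) x = x" by (metis antisym normal_ge normal_hyperexp)
qed (simp add: assms zero_less_iff)

text \<open>The values \<open>hyperlog a x\<close> weakly decrease in \<open>a\<close>, so below
  \<open>omega_pow r\<close> they stabilise. The final value is fixed by all these logarithms
  because \<open>omega_pow r\<close> is closed under addition.\<close>

lemma hyperlog_eventually_range:
  fixes x :: "'a::infinite ordinal"
  assumes "r \<noteq> 0"
  obtains a where "a < omega_pow r"
    "\<And>c. a \<le> c \<Longrightarrow> c < omega_pow r \<Longrightarrow> hyperlog c x \<in> range (hyperexp (omega_pow r))"
proof -
  define m where "m = (LEAST y. \<exists>a<omega_pow r. y = hyperlog a x)"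
  have "\<exists>a<omega_pow r. m = hyperlog a x"
    unfolding m_def by (rule LeastI_ex) (use omega_pow_gt_zero in blast)
  then obtain a where a: "a < omega_pow r" "m = hyperlog a x" by blast
  have min: "m \<le> hyperlog c x" if "c < omega_pow r" for c
    unfolding m_def by (rule Least_le) (use that in blast)
  have m: "hyperlog c x = m" if "a \<le> c" "c < omega_pow r" for c
    using hyperlog_antimono[OF that(1), of x] min[OF that(2)] a by simp
  have "m \<in> range (hyperexp (omega_pow r))"
  proof (rule hyperlog_fixed[OF assms])
    fix c assume "c < omega_pow r"
    then show "hyperlog c m = m"
      using m[of "a + c"] a omega_pow_indecomposable[OF a(1)] by (simp add: hyperlog_plus_exponent)
  qed
  then show thesis using that a m by metis
qed

lemma omega_pow_limitD:
  fixes r :: "'a::infinite ordinal"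
  assumes "r \<noteq> 0" "a < omega_pow r"
  shows "osuc a < omega_pow r"
  using omega_pow_indecomposable[OF assms(2), of 1] assms(1) omega_pow_less_iff[of 0 r]
  by (simp add: plus_one zero_less_iff)

text \<open>The split used in inductions on coordinates. By absorption, \<open>c\<close> can advance
  inside the last term of \<open>b\<close> without changing \<open>r\<close>; for
  \<open>r \<noteq> 0\<close> it is moved beyond \<open>a\<close>, to where both logarithms have
  stabilised.\<close>

lemma last_term_range:
  fixes b x y :: "'a::infinite ordinal"
  assumes "a < b"
  obtains c r where "b = c + omega_pow r" "c < b" "a \<le> c"
    "r \<noteq> 0 \<Longrightarrow> a < c \<and> hyperlog c x \<in> range (hyperexp (omega_pow r)) \<and>
       hyperlog c y \<in> range (hyperexp (omega_pow r))"
proof -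
  have "b \<noteq> 0" using assms by auto
  then obtain d r where b: "b = d + omega_pow r" by (rule last_term)
  show thesis
  proof (cases "r = 0")
    case True
    then show ?thesis using that[of d r] b assms by (simp add: plus_one less_osuc_iff)
  next
    case False
    obtain u where u: "u < omega_pow r"
      "\<And>c. u \<le> c \<Longrightarrow> c < omega_pow r \<Longrightarrow> hyperlog c (hyperlog d x) \<in> range (hyperexp (omega_pow r))"
      using hyperlog_eventually_range[OF False] by blast
    obtain v where v: "v < omega_pow r"
      "\<And>c. v \<le> c \<Longrightarrow> c < omega_pow r \<Longrightarrow> hyperlog c (hyperlog d y) \<in> range (hyperexp (omega_pow r))"
      using hyperlog_eventually_range[OF False] by blast
    obtain w where w: "w < omega_pow r" "a \<le> d + w"
    proof (cases "a \<le> d")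
      case True
      then show ?thesis using that[of 0] by simp
    next
      case False
      then obtain w where "d + w = a" by (meson ex_plus linear)
      then show ?thesis using that[of w] assms b by auto
    qed
    define c where "c = osuc (max u (max v w))"
    have c: "c < omega_pow r" "u < c" "v < c" "w < c"
      unfolding c_def using u(1) v(1) w(1) omega_pow_limitD[OF False]
      by (simp_all add: less_osuc_iff le_max_iff_disj)
    have "a < d + c" using w(2) c(4) by (meson le_less_trans plus_less_cancel)
    then show ?thesis
      using that[of "d + c" r] c u(2)[of c] v(2)[of c] b
      by (simp add: plus_assoc omega_pow_absorb hyperlog_plus_exponent)
  qed
qed

section \<open>The logarithm \<open>hyperlog 1\<close> as the exponent of the last Cantor
  term\<close>

lemma omega_pow_hyperlog_one:
  fixes x :: "'a::infinite ordinal"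
  assumes "x \<noteq> 0"
  obtains z where "x = z + omega_pow (hyperlog 1 x)"
  using assms by (metis hyperlog_omega_one last_term)

text \<open>Either \<open>a\<close> stays within the part of \<open>x\<close> before its last term,
  or it exceeds that part by a remainder \<open>y\<close>, which the last term absorbs.\<close>

lemma plus_omega_pow_le:
  fixes x :: "'a::infinite ordinal"
  assumes "a < x" "c \<le> hyperlog 1 x"
  shows "a + omega_pow c \<le> x"
proof -
  have "x \<noteq> 0" using assms by auto
  then obtain z where z: "x = z + omega_pow (hyperlog 1 x)" by (rule omega_pow_hyperlog_one)
  show ?thesis
  proof (cases "a \<le> z")
    case True
    then have "a + omega_pow c \<le> z + omega_pow c" by (rule plus_mono_left)
    also have "\<dots> \<le> z + omega_pow (hyperlog 1 x)" by (simp add: assms)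
    also have "\<dots> = x" by (rule z[symmetric])
    finally show ?thesis .
  next
    case False
    then obtain y where y: "z + y = a" by (meson ex_plus linear)
    then have "y < omega_pow (hyperlog 1 x)" using assms(1) z by (metis plus_less_cancel)
    then have "y + omega_pow c \<le> omega_pow (hyperlog 1 x)"
      using omega_pow_absorb assms(2) plus_le_cancel omega_pow_le_iff by metis
    then have "a + omega_pow c \<le> z + omega_pow (hyperlog 1 x)" by (simp add: plus_assoc flip: y)
    then show ?thesis using z by simp
  qed
qed

text \<open>Equality is excluded because \<open>a + omega_pow c\<close> has logarithm exactly
  \<open>c\<close>.\<close>

lemma plus_omega_pow_less:
  fixes x :: "'a::infinite ordinal"
  assumes "a < x" "c < hyperlog 1 x"
  shows "a + omega_pow c < x"
  using plus_omega_pow_le[of a x c] assms hyperlog_omega_one[of a c] by (auto simp: le_less)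

text \<open>The least ordinal from \<open>a\<close> on with logarithm at least \<open>c\<close>
  cannot overshoot: otherwise \<open>a + omega_pow c\<close> would be a smaller one.\<close>

lemma least_hyperlog_one:
  fixes a c :: "'a::infinite ordinal"
  assumes "hyperlog 1 a < c"
  obtains d where "a < d" "hyperlog 1 d = c" "\<And>x. a \<le> x \<Longrightarrow> c \<le> hyperlog 1 x \<Longrightarrow> d \<le> x"
proof -
  define d where "d = (LEAST d. a \<le> d \<and> c \<le> hyperlog 1 d)"
  have d: "a \<le> d \<and> c \<le> hyperlog 1 d"
    unfolding d_def by (rule LeastI[of _ "a + omega_pow c"]) (simp add: hyperlog_omega_one)
  have least: "d \<le> x" if "a \<le> x" "c \<le> hyperlog 1 x" for x
    unfolding d_def using that by (intro Least_le) simp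
  have "a < d" using d assms by (auto simp: le_less)
  have "\<not> c < hyperlog 1 d"
  proof
    assume "c < hyperlog 1 d"
    from plus_omega_pow_less[OF \<open>a < d\<close> this] show False
      using least[of "a + omega_pow c"] by (simp add: hyperlog_omega_one)
  qed
  then show thesis using that[of d] d \<open>a < d\<close> least by auto
qed


section \<open>Definable sets of \<open>\<ell>\<close>-sequences\<close>

text \<open>Free of \<Theta> and of extensionality, unlike \<open>ell_seqs\<close>, so that it
  covers \<open>\<lambda>a. hyperlog a x\<close> and shifted sequences.\<close>

definition ell_seq :: "'a ordinal \<Rightarrow> ('a ordinal \<Rightarrow> 'a ordinal) \<Rightarrow> bool" where
  "ell_seq \<Lambda> g \<longleftrightarrow> (\<forall>z. 0 < z \<and> z < \<Lambda> \<longrightarrow>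
     (\<exists>t<z. \<forall>x. t \<le> x \<and> x < z \<longrightarrow> g z \<le> hyperlog (left_minus x z) (g x)))"

lemma ell_seqE:
  fixes z :: "'a::infinite ordinal"
  assumes "ell_seq \<Lambda> g" "z < \<Lambda>" "z \<noteq> 0"
  obtains t where "t < z" "\<And>x d. t \<le> x \<Longrightarrow> d \<noteq> 0 \<Longrightarrow> x + d = z \<Longrightarrow> g z \<le> hyperlog d (g x)"
proof -
  obtain t where t: "t < z" "\<And>x. t \<le> x \<and> x < z \<longrightarrow> g z \<le> hyperlog (left_minus x z) (g x)"
    using assms unfolding ell_seq_def zero_less_iff by blast
  have "g z \<le> hyperlog d (g x)" if "t \<le> x" "d \<noteq> 0" "x + d = z" for x d
    using t(2)[of x] that by auto
  then show thesis using that t(1) by blast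
qed

lemma ell_seqI:
  fixes \<Lambda> :: "'a::infinite ordinal"
  assumes "\<And>z. z \<noteq> 0 \<Longrightarrow> z < \<Lambda> \<Longrightarrow>
    \<exists>t<z. \<forall>x d. t \<le> x \<longrightarrow> d \<noteq> 0 \<longrightarrow> x + d = z \<longrightarrow> g z \<le> hyperlog d (g x)"
  shows "ell_seq \<Lambda> g"
  unfolding ell_seq_def
proof (intro allI impI)
  fix z assume z: "0 < z \<and> z < \<Lambda>"
  then obtain t where t: "t < z" "\<And>x d. t \<le> x \<Longrightarrow> d \<noteq> 0 \<Longrightarrow> x + d = z \<Longrightarrow> g z \<le> hyperlog d (g x)"
    using assms[of z] by (metis less_irrefl)
  have "g z \<le> hyperlog (left_minus x z) (g x)" if "t \<le> x" "x < z" for x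
  proof -
    have eq: "x + left_minus x z = z" using that by (simp add: plus_left_minus)
    then have "left_minus x z \<noteq> 0" using that by auto
    then show ?thesis using t(2) that eq by blast
  qed
  then show "\<exists>t<z. \<forall>x. t \<le> x \<and> x < z \<longrightarrow> g z \<le> hyperlog (left_minus x z) (g x)"
    using t(1) by blast
qed

lemma ell_seq_cong:
  fixes \<Lambda> :: "'a::infinite ordinal"
  assumes "ell_seq \<Lambda> g" "\<And>x. x < \<Lambda> \<Longrightarrow> f x = g x"
  shows "ell_seq \<Lambda> f"
proof (rule ell_seqI)
  fix z :: "'a ordinal"
  assume z: "z \<noteq> 0" "z < \<Lambda>"
  then obtain t where t: "t < z" "\<And>x d. t \<le> x \<Longrightarrow> d \<noteq> 0 \<Longrightarrow> x + d = z \<Longrightarrow> g z \<le> hyperlog d (g x)"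
    using ell_seqE[OF assms(1)] by blast
  have "f z \<le> hyperlog d (f x)" if "t \<le> x" "d \<noteq> 0" "x + d = z" for x d
  proof -
    have "x < z" using that by auto
    then show ?thesis using t(2)[OF that] assms(2) z(2) less_trans by metis
  qed
  then show "\<exists>t<z. \<forall>x d. t \<le> x \<longrightarrow> d \<noteq> 0 \<longrightarrow> x + d = z \<longrightarrow> f z \<le> hyperlog d (f x)"
    using t(1) by blast
qed

lemma ell_seq_hyperlog: "ell_seq \<Lambda> (\<lambda>a. hyperlog a x)" for x :: "'a::infinite ordinal"
  by (rule ell_seqI, rule exI[of _ 0]) (auto simp: zero_less_iff simp flip: hyperlog_plus_exponent)

lemma ell_seq_shift:
  fixes b :: "'a::infinite ordinal"
  assumes "ell_seq (b + \<Lambda>) g"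
  shows "ell_seq \<Lambda> (\<lambda>x. g (b + x))"
proof (rule ell_seqI)
  fix z :: "'a ordinal"
  assume z: "z \<noteq> 0" "z < \<Lambda>"
  then obtain t where t: "t < b + z"
    "\<And>x d. t \<le> x \<Longrightarrow> d \<noteq> 0 \<Longrightarrow> x + d = b + z \<Longrightarrow> g (b + z) \<le> hyperlog d (g x)"
    using ell_seqE[OF assms, of "b + z"] by auto
  obtain u where u: "u < z" "t \<le> b + u"
  proof (cases "t \<le> b")
    case True
    then show ?thesis using that[of 0] z by (simp add: zero_less_iff)
  next
    case False
    then obtain u where "b + u = t" by (meson ex_plus linear)
    then show ?thesis using that[of u] t(1) by auto
  qed
  show "\<exists>t<z. \<forall>x d. t \<le> x \<longrightarrow> d \<noteq> 0 \<longrightarrow> x + d = z \<longrightarrow> g (b + z) \<le> hyperlog d (g (b + x))"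
  proof (intro exI conjI allI impI)
    show "u < z" by (rule u)
    fix x d assume *: "u \<le> x" "d \<noteq> 0" "x + d = z"
    then have "t \<le> b + x" using u(2) by (meson order.trans plus_le_cancel)
    then show "g (b + z) \<le> hyperlog d (g (b + x))"
      using t(2)[of "b + x" d] * by (simp add: plus_assoc)
  qed
qed

text \<open>The definition compares \<open>z\<close> only with coordinates close below it; one
  comparison leads down to \<open>max t x\<close>, and induction does the rest.\<close>

lemma ell_seq_antimono:
  fixes z :: "'a::infinite ordinal"
  assumes "ell_seq \<Lambda> g" "z < \<Lambda>" "x \<le> z"
  shows "g z \<le> g x"
  using assms(2,3)
proof (induction z rule: less_induct)
  case (less z)
  show ?case
  proof (cases "x = z")
    case False
    then have "x < z" using less.prems by simp
    then have "z \<noteq> 0" by auto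
    then obtain t where t: "t < z" "\<And>x d. t \<le> x \<Longrightarrow> d \<noteq> 0 \<Longrightarrow> x + d = z \<Longrightarrow> g z \<le> hyperlog d (g x)"
      using ell_seqE[OF assms(1) less.prems(1)] by blast
    define y where "y = max t x"
    have y: "y < z" "t \<le> y" "x \<le> y" using t(1) \<open>x < z\<close> by (simp_all add: y_def)
    obtain d where d: "y + d = z" by (rule ex_plus[of y z]) (use y in auto)
    have "d \<noteq> 0" using d y by auto
    then have "g z \<le> g y" using t(2)[OF y(2) _ d] hyperlog_le order.trans by blast
    also have "g y \<le> g x" using less y by (meson less_trans)
    finally show ?thesis .
  qed simp
qed

section \<open>Cones of \<ell>-sequences and their intersections\<close>

definition above :: "'a ordinal \<Rightarrow> 'a ordinal \<Rightarrow> ('a ordinal \<Rightarrow> 'a ordinal) \<Rightarrow> bool" where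
  "above \<Lambda> a g \<longleftrightarrow> (\<forall>x<\<Lambda>. hyperlog x a \<le> g x)"

lemma above_zero_left [simp]: "above 0 a g" for a :: "'a::infinite ordinal"
  by (simp add: above_def)

lemma above_zero [simp]: "above \<Lambda> 0 g" for \<Lambda> :: "'a::infinite ordinal"
  by (simp add: above_def)

lemma less_plus_cases:
  fixes b :: "'a::infinite ordinal"
  assumes "x < b + c"
  obtains "x < b" | y where "x = b + y" "y < c"
  by (metis assms ex_plus not_less plus_less_cancel)

lemma above_plus:
  fixes b :: "'a::infinite ordinal"
  shows "above (b + c) a g \<longleftrightarrow> above b a g \<and> above c (hyperlog b a) (\<lambda>x. g (b + x))"
proof (intro iffI conjI)
  assume *: "above (b + c) a g"
  show "above b a g" using * less_le_trans[OF _ le_plus_left] unfolding above_def by blast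
  show "above c (hyperlog b a) (\<lambda>x. g (b + x))"
    using * by (simp add: above_def flip: hyperlog_plus_exponent)
next
  assume "above b a g \<and> above c (hyperlog b a) (\<lambda>x. g (b + x))"
  then show "above (b + c) a g"
    unfolding above_def by (auto simp: hyperlog_plus_exponent elim!: less_plus_cases)
qed

lemma above_at_zero:
  fixes c :: "'a::infinite ordinal"
  assumes "above c a g" "c \<noteq> 0"
  shows "a \<le> g 0"
  using assms by (metis above_def hyperlog_zero zero_less_iff)

text \<open>Hyperlogarithms with positive exponent vanish at successors, so only coordinate 0 is
  constrained. This turns strict bounds into cones.\<close>

lemma above_osuc:
  fixes c :: "'a::infinite ordinal"
  assumes "c \<noteq> 0"
  shows "above c (osuc a) g \<longleftrightarrow> a < g 0"
proof
  show "above c (osuc a) g \<Longrightarrow> a < g 0"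
    using above_at_zero[of c "osuc a" g] assms by (simp add: osuc_le_iff)
  assume a: "a < g 0"
  have "hyperlog x (osuc a) = 0" if "x \<noteq> 0" for x
    using that hyperlog_plus[of x 1 a] hyperlog_one_right[of x]
    by (simp add: plus_one zero_less_iff one_neq_zero)
  then show "above c (osuc a) g"
    unfolding above_def using a by (metis hyperlog_zero ord_zero_le osuc_le_iff)
qed

text \<open>
  Raising the conditions of a cone from coordinate \<open>b\<close> on yields a cone again. Writing
  \<open>b = e + \<omega>\<^sup>r\<close> with \<open>e\<close> large, this reduces by induction to \<open>b = \<omega>\<^sup>r\<close>, where for \<open>r > 0\<close> the
  function \<open>\<xi> \<mapsto> \<ell>\<^sup>\<xi> a\<close> is constant below \<open>\<omega>\<^sup>r\<close> with a value in the
  range of \<open>hyperexp (omega_pow r)\<close>.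
\<close>

lemma above_adjust_succ:
  fixes a :: "'a::infinite ordinal"
  assumes "hyperlog 1 a < c" "\<Lambda> \<noteq> 0"
  obtains d where "a < d" "\<And>g. ell_seq (1 + \<Lambda>) g \<Longrightarrow>
    above (1 + \<Lambda>) d g \<longleftrightarrow> above 1 a g \<and> above \<Lambda> c (\<lambda>x. g (1 + x))"
proof -
  obtain d where d: "a < d" "hyperlog 1 d = c"
    "\<And>x. a \<le> x \<Longrightarrow> c \<le> hyperlog 1 x \<Longrightarrow> d \<le> x"
    using least_hyperlog_one[OF assms(1)] by blast
  have "above (1 + \<Lambda>) d g \<longleftrightarrow> above 1 a g \<and> above \<Lambda> c (\<lambda>x. g (1 + x))"
    if g: "ell_seq (1 + \<Lambda>) g" for g
  proof -
    have "d \<le> g 0" if "a \<le> g 0" and ab: "above \<Lambda> c (\<lambda>x. g (1 + x))"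
    proof (rule d(3)[OF that(1)])
      have "c \<le> g 1" using above_at_zero[OF ab assms(2)] by simp
      \<comment> \<open>The threshold below 1 can only be 0, so the condition at 1 applies to
        coordinate 0.\<close>
      also have "g 1 \<le> hyperlog 1 (g 0)"
        using ell_seqE[OF g, of 1] assms(2)
        by (metis less_one_iff less_plus_left one_neq_zero ord_zero_le plus_zero_left)
      finally show "c \<le> hyperlog 1 (g 0)" .
    qed
    then show ?thesis
      using d(1) by (auto simp: above_plus d(2)) (auto simp: above_def)
  qed
  then show thesis using that d(1) by blast
qed

lemma above_adjust_omega_pow:
  fixes a :: "'a::infinite ordinal"
  assumes "hyperlog (omega_pow r) a < c" "a \<in> range (hyperexp (omega_pow r))" "\<Lambda> \<noteq> 0"
  obtains d where "a < d" "\<And>g. ell_seq (omega_pow r + \<Lambda>) g \<Longrightarrow>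
    above (omega_pow r + \<Lambda>) d g \<longleftrightarrow> above (omega_pow r) a g \<and> above \<Lambda> c (\<lambda>x. g (omega_pow r + x))"
proof -
  \<comment> \<open>The exact sequence of this \<open>d\<close> is constantly \<open>d\<close> below
    \<open>omega_pow r\<close> and continues from there as that of \<open>c\<close>.\<close>
  define d where "d = hyperexp (omega_pow r) c"
  obtain a' where a': "a = hyperexp (omega_pow r) a'" using assms(2) by auto
  then have ad: "a < d"
    using assms(1) normal_less_iff[OF normal_hyperexp, of "omega_pow r" a' c]
    by (simp add: d_def hyperlog_hyperexp)
  have "above (omega_pow r + \<Lambda>) d g \<longleftrightarrow>
      above (omega_pow r) a g \<and> above \<Lambda> c (\<lambda>x. g (omega_pow r + x))" (is "_ \<longleftrightarrow> ?R")
    if g: "ell_seq (omega_pow r + \<Lambda>) g" for g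
  proof
    assume "above (omega_pow r + \<Lambda>) d g"
    then show ?R
      using ad unfolding above_plus
      by (auto simp: above_def d_def a' hyperlog_less_omega_pow hyperlog_hyperexp)
  next
    assume R: ?R
    then have "c \<le> g (omega_pow r)"
      using above_at_zero[of \<Lambda> c "\<lambda>x. g (omega_pow r + x)"] assms(3) by simp
    moreover obtain t where t: "t < omega_pow r"
      "\<And>x d. t \<le> x \<Longrightarrow> d \<noteq> 0 \<Longrightarrow> x + d = omega_pow r \<Longrightarrow> g (omega_pow r) \<le> hyperlog d (g x)"
      using ell_seqE[OF g, of "omega_pow r"] assms(3) by auto
    \<comment> \<open>As \<open>x + omega_pow r = omega_pow r\<close>, the bound \<open>c\<close> at
      \<open>omega_pow r\<close> passes to every \<open>x\<close> from \<open>t\<close> on; earlier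
      coordinates follow by antitonicity.\<close>
    ultimately have tail: "d \<le> g x" if "t \<le> x" "x < omega_pow r" for x
      unfolding d_def using that omega_pow_absorb[of x r]
      by (intro hyperexp_le_if_le_hyperlog) (meson omega_pow_neq_zero order.trans)
    have "d \<le> g x" if "x < omega_pow r" for x
    proof (cases "t \<le> x")
      case False
      have "t < omega_pow r + \<Lambda>" by (rule less_le_trans[OF t(1)]) simp
      then show ?thesis
        using ell_seq_antimono[OF g, of t x] tail[of t] t(1) False by (metis linear order.refl order.trans)
    qed (use tail that in blast)
    then show "above (omega_pow r + \<Lambda>) d g"
      using R by (simp add: above_plus d_def hyperlog_hyperexp)
        (simp add: above_def hyperlog_less_omega_pow)
  qed
  then show thesis using that ad by blast
qed

lemma above_adjust:
  fixes a :: "'a::infinite ordinal"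
  assumes "hyperlog b a < c" "\<Lambda> \<noteq> 0"
  obtains d where "\<And>g. ell_seq (b + \<Lambda>) g \<Longrightarrow>
    above (b + \<Lambda>) d g \<longleftrightarrow> above b a g \<and> above \<Lambda> c (\<lambda>x. g (b + x))"
proof -
  have "\<exists>d. \<forall>g. ell_seq (b + \<Lambda>) g \<longrightarrow>
      above (b + \<Lambda>) d g = (above b a g \<and> above \<Lambda> c (\<lambda>x. g (b + x)))"
    using assms
  proof (induction b arbitrary: c \<Lambda> rule: less_induct)
    case (less b)
    show ?case
    proof (cases "b = 0")
      case False
      then obtain e r where e: "b = e + omega_pow r" "e < b"
        "r \<noteq> 0 \<Longrightarrow> hyperlog e a \<in> range (hyperexp (omega_pow r))"
        using last_term_range[of 0 b a] by (metis zero_less_iff)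
      have less_c: "hyperlog (omega_pow r) (hyperlog e a) < c"
        using less.prems by (simp add: e(1) hyperlog_plus_exponent)
      obtain d where d: "hyperlog e a < d" "\<And>g. ell_seq (omega_pow r + \<Lambda>) g \<Longrightarrow>
         above (omega_pow r + \<Lambda>) d g \<longleftrightarrow>
           above (omega_pow r) (hyperlog e a) g \<and> above \<Lambda> c (\<lambda>x. g (omega_pow r + x))"
      proof (cases "r = 0")
        case True
        then show ?thesis using above_adjust_succ[of "hyperlog e a" c \<Lambda>] less_c less.prems that by auto
      next
        case False
        then show ?thesis using above_adjust_omega_pow[OF less_c e(3) less.prems(2)] that by blast
      qed
      \<comment> \<open>The strict bound \<open>hyperlog e a < d\<close> is what allows the
        induction hypothesis to raise the tail from \<open>e\<close> on.\<close>
      obtain d' where d': "\<And>g. ell_seq (e + (omega_pow r + \<Lambda>)) g \<Longrightarrow>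
         above (e + (omega_pow r + \<Lambda>)) d' g =
           (above e a g \<and> above (omega_pow r + \<Lambda>) d (\<lambda>x. g (e + x)))"
        using less.IH[OF e(2) d(1), of "omega_pow r + \<Lambda>"] by auto
      show ?thesis
        using d' d(2)[OF ell_seq_shift] by (auto simp: e(1) plus_assoc above_plus)
    qed auto
  qed
  then show thesis using that by blast
qed

text \<open>Let \<open>a \<le> b\<close>, and let \<open>e\<close> be the first coordinate where the
  sequence of \<open>a\<close> exceeds that of \<open>b\<close>. Before \<open>e\<close> the cone of
  \<open>b\<close> suffices; from \<open>e\<close> on the tails are intersected by induction on the
  larger ordinal, since \<open>hyperlog e a \<le> a < b\<close>, and \<open>above_adjust\<close>
  attaches the result.\<close>

lemma above_Int:
  fixes a :: "'a::infinite ordinal"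
  obtains c where "\<And>g. ell_seq \<Lambda> g \<Longrightarrow> above \<Lambda> c g \<longleftrightarrow> above \<Lambda> a g \<and> above \<Lambda> b g"
proof -
  have "\<exists>c. \<forall>g. ell_seq \<Lambda> g \<longrightarrow> above \<Lambda> c g = (above \<Lambda> a g \<and> above \<Lambda> b g)"
    if "a \<le> b" for a b :: "'a ordinal"
    using that
  proof (induction b arbitrary: a \<Lambda> rule: less_induct)
    case (less b)
    show ?case
    proof (cases "\<forall>x<\<Lambda>. hyperlog x a \<le> hyperlog x b")
      case True
      then show ?thesis by (intro exI[of _ b]) (auto simp: above_def intro: order.trans)
    next
      case False
      define e where "e = (LEAST x. x < \<Lambda> \<and> hyperlog x b < hyperlog x a)"
      have e: "e < \<Lambda>" "hyperlog e b < hyperlog e a"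
        using LeastI_ex[of "\<lambda>x. x < \<Lambda> \<and> hyperlog x b < hyperlog x a"] False
        by (auto simp: e_def not_le)
      have below: "hyperlog x a \<le> hyperlog x b" if "x < e" for x
        using not_less_Least[of x "\<lambda>x. x < \<Lambda> \<and> hyperlog x b < hyperlog x a"] that e(1)
        by (auto simp: e_def not_less dest: less_trans)
      have "a < b" using less.prems e(2) by (auto simp: le_less)
      obtain \<Lambda>' where L: "\<Lambda> = e + \<Lambda>'" using ex_plus[of e \<Lambda>] e(1) by (metis less_imp_le)
      with e(1) have "\<Lambda>' \<noteq> 0" by auto
      have "hyperlog e a < b" using \<open>a < b\<close> hyperlog_le le_less_trans by blast
      from less.IH[OF this less_imp_le[OF e(2)]]
      obtain c where c: "\<And>g. ell_seq \<Lambda>' g \<Longrightarrow>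
          above \<Lambda>' c g \<longleftrightarrow> above \<Lambda>' (hyperlog e b) g \<and> above \<Lambda>' (hyperlog e a) g"
        by blast
      \<comment> \<open>The exact sequence of \<open>c\<close> lies in its own cone, hence in both
        intersected cones.\<close>
      have "above \<Lambda>' (hyperlog e a) (\<lambda>x. hyperlog x c)"
        using c[OF ell_seq_hyperlog, of c] by (simp add: above_def)
      then have "hyperlog e a \<le> c"
        using above_at_zero[OF _ \<open>\<Lambda>' \<noteq> 0\<close>] by force
      with e(2) have "hyperlog e b < c" by simp
      from above_adjust[OF this \<open>\<Lambda>' \<noteq> 0\<close>] obtain d where d: "\<And>g. ell_seq \<Lambda> g \<Longrightarrow>
          above \<Lambda> d g \<longleftrightarrow> above e b g \<and> above \<Lambda>' c (\<lambda>x. g (e + x))"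
        unfolding L by blast
      have "above e b g \<Longrightarrow> above e a g" for g
        using below by (auto simp: above_def intro: order.trans)
      then show ?thesis
        using d c[OF ell_seq_shift] by (intro exI[of _ d]) (auto simp: L above_plus)
    qed
  qed
  from this[of a b] this[of b a] show thesis
    using that linear[of a b] by blast
qed


section \<open>Boolean closure of the definable sets\<close>

definition piece :: "'a ordinal \<Rightarrow> 'a ordinal \<times> 'a ordinal set \<Rightarrow> ('a ordinal \<Rightarrow> 'a ordinal) \<Rightarrow> bool" where
  "piece \<Lambda> q g \<longleftrightarrow> above \<Lambda> (fst q) g \<and> (\<forall>c\<in>snd q. \<not> above \<Lambda> c g)"

text \<open>Since \<Theta> does not occur, one description serves the frame as well as the exact
  sequences of the points of the space.\<close>

definition definable :: "'a ordinal \<Rightarrow> (('a ordinal \<Rightarrow> 'a ordinal) \<Rightarrow> bool) \<Rightarrow> bool" where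
  "definable \<Lambda> P \<longleftrightarrow> (\<exists>D. finite D \<and> (\<forall>q\<in>D. finite (snd q)) \<and>
     (\<forall>g. ell_seq \<Lambda> g \<longrightarrow> P g \<longleftrightarrow> (\<exists>q\<in>D. piece \<Lambda> q g)))"

lemma definableI:
  assumes "finite D" "\<And>q. q \<in> D \<Longrightarrow> finite (snd q)"
    "\<And>g. ell_seq \<Lambda> g \<Longrightarrow> P g \<longleftrightarrow> (\<exists>q\<in>D. piece \<Lambda> q g)"
  shows "definable \<Lambda> P"
  using assms unfolding definable_def by blast

lemma definableE:
  assumes "definable \<Lambda> P"
  obtains D where "finite D" "\<And>q. q \<in> D \<Longrightarrow> finite (snd q)"
    "\<And>g. ell_seq \<Lambda> g \<Longrightarrow> P g \<longleftrightarrow> (\<exists>q\<in>D. piece \<Lambda> q g)"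
  using assms unfolding definable_def by blast

lemma definable_cong:
  "definable \<Lambda> P \<Longrightarrow> (\<And>g. ell_seq \<Lambda> g \<Longrightarrow> P g \<longleftrightarrow> Q g) \<Longrightarrow> definable \<Lambda> Q"
  unfolding definable_def by blast

lemma definable_piece: "finite (snd q) \<Longrightarrow> definable \<Lambda> (piece \<Lambda> q)"
  by (rule definableI[of "{q}"]) auto

lemma definable_above: "definable \<Lambda> (above \<Lambda> a)"
  using definable_piece[of "(a, {})" \<Lambda>] by (simp add: piece_def[abs_def])

lemma definable_not_above: "definable \<Lambda> (\<lambda>g. \<not> above \<Lambda> a g)" for a :: "'a::infinite ordinal"
  using definable_piece[of "(0, {a})" \<Lambda>] by (simp add: piece_def[abs_def])

lemma definable_False: "definable \<Lambda> (\<lambda>g. False)"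
  by (rule definableI[of "{}"]) auto

lemma definable_True: "definable \<Lambda> (\<lambda>g. True)" for \<Lambda> :: "'a::infinite ordinal"
  using definable_above[of \<Lambda> 0] by (rule definable_cong) simp

lemma definable_disj:
  assumes "definable \<Lambda> P" "definable \<Lambda> Q"
  shows "definable \<Lambda> (\<lambda>g. P g \<or> Q g)"
proof -
  obtain D where D: "finite D" "\<And>q. q \<in> D \<Longrightarrow> finite (snd q)"
    "\<And>g. ell_seq \<Lambda> g \<Longrightarrow> P g \<longleftrightarrow> (\<exists>q\<in>D. piece \<Lambda> q g)"
    using definableE[OF assms(1)] by blast
  obtain E where E: "finite E" "\<And>q. q \<in> E \<Longrightarrow> finite (snd q)"
    "\<And>g. ell_seq \<Lambda> g \<Longrightarrow> Q g \<longleftrightarrow> (\<exists>q\<in>E. piece \<Lambda> q g)"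
    using definableE[OF assms(2)] by blast
  show ?thesis by (rule definableI[of "D \<union> E"]) (use D E in auto)
qed

text \<open>Two pieces intersect in a piece: \<open>above_Int\<close> merges the cones, and the
  removed cones are united.\<close>

lemma definable_conj:
  fixes \<Lambda> :: "'a::infinite ordinal"
  assumes "definable \<Lambda> P" "definable \<Lambda> Q"
  shows "definable \<Lambda> (\<lambda>g. P g \<and> Q g)"
proof -
  obtain D where D: "finite D" "\<And>q. q \<in> D \<Longrightarrow> finite (snd q)"
    "\<And>g. ell_seq \<Lambda> g \<Longrightarrow> P g \<longleftrightarrow> (\<exists>q\<in>D. piece \<Lambda> q g)"
    using definableE[OF assms(1)] by blast
  obtain E where E: "finite E" "\<And>q. q \<in> E \<Longrightarrow> finite (snd q)"
    "\<And>g. ell_seq \<Lambda> g \<Longrightarrow> Q g \<longleftrightarrow> (\<exists>q\<in>E. piece \<Lambda> q g)"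
    using definableE[OF assms(2)] by blast
  have "\<exists>c. \<forall>g. ell_seq \<Lambda> g \<longrightarrow> above \<Lambda> c g = (above \<Lambda> a g \<and> above \<Lambda> b g)" for a b :: "'a ordinal"
    using above_Int by blast
  then obtain j where j: "\<And>a b g. ell_seq \<Lambda> g \<Longrightarrow> above \<Lambda> (j a b) g \<longleftrightarrow> above \<Lambda> a g \<and> above \<Lambda> b g"
    by metis
  define F where "F = (\<lambda>(p, q). (j (fst p) (fst q), snd p \<union> snd q)) ` (D \<times> E)"
  show ?thesis
  proof (rule definableI[of F])
    show "P g \<and> Q g \<longleftrightarrow> (\<exists>q\<in>F. piece \<Lambda> q g)" if g: "ell_seq \<Lambda> g" for g
      unfolding D(3)[OF g] E(3)[OF g] by (auto simp: F_def piece_def j[OF g])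
  qed (use D E in \<open>auto simp: F_def\<close>)
qed

lemma definable_Bex:
  assumes "finite S" "\<And>s. s \<in> S \<Longrightarrow> definable \<Lambda> (P s)"
  shows "definable \<Lambda> (\<lambda>g. \<exists>s\<in>S. P s g)"
  using assms by (induction S) (simp_all add: definable_False definable_disj)

lemma definable_Ball:
  fixes \<Lambda> :: "'a::infinite ordinal"
  assumes "finite S" "\<And>s. s \<in> S \<Longrightarrow> definable \<Lambda> (P s)"
  shows "definable \<Lambda> (\<lambda>g. \<forall>s\<in>S. P s g)"
  using assms by (induction S) (simp_all add: definable_True definable_conj)

text \<open>Missing a piece means missing its cone or hitting a removed one, a finite disjunction of
  definable conditions.\<close>

lemma definable_not:
  fixes \<Lambda> :: "'a::infinite ordinal"
  assumes "definable \<Lambda> P"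
  shows "definable \<Lambda> (\<lambda>g. \<not> P g)"
proof -
  obtain D where D: "finite D" "\<And>q. q \<in> D \<Longrightarrow> finite (snd q)"
    "\<And>g. ell_seq \<Lambda> g \<Longrightarrow> P g \<longleftrightarrow> (\<exists>q\<in>D. piece \<Lambda> q g)"
    using definableE[OF assms] by blast
  have "definable \<Lambda> (\<lambda>g. \<forall>q\<in>D. \<not> above \<Lambda> (fst q) g \<or> (\<exists>c\<in>snd q. above \<Lambda> c g))"
    using D(1,2) by (intro definable_Ball definable_disj definable_not_above definable_Bex definable_above)
  then show ?thesis by (rule definable_cong) (use D(3) in \<open>auto simp: piece_def\<close>)
qed

text \<open>
  If some \<open>f <\<^sub>b g\<close> lies in the piece \<open>(a, B)\<close>, then so does the pointwise least candidate, which agrees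
  with \<open>g\<close> below \<open>b\<close> and with \<open>\<xi> \<mapsto> \<ell>\<^sup>\<xi> a\<close> from \<open>b\<close> on; \<open>dia_piece\<close> says that this candidate
  is below \<open>g\<close> and in the piece.
\<close>

definition dia_piece ::
  "'a ordinal \<Rightarrow> 'a ordinal \<Rightarrow> 'a ordinal \<times> 'a ordinal set \<Rightarrow> ('a ordinal \<Rightarrow> 'a ordinal) \<Rightarrow> bool" where
  "dia_piece \<Lambda> b q g \<longleftrightarrow> above b (fst q) g \<and> hyperlog b (fst q) < g b \<and>
     (\<forall>c\<in>snd q. \<not> (above b c g \<and> (\<forall>x. b \<le> x \<and> x < \<Lambda> \<longrightarrow> hyperlog x c \<le> hyperlog x (fst q))))"

text \<open>From coordinate \<open>b\<close> on, \<open>u < g b\<close> is the cone of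
  \<open>osuc u\<close>, which exceeds \<open>hyperlog b c\<close> as \<open>above_adjust\<close>
  requires.\<close>

lemma above_adjust_osuc:
  fixes b :: "'a::infinite ordinal"
  assumes "b < \<Lambda>" "hyperlog b c \<le> u"
  obtains d where "\<And>g. ell_seq \<Lambda> g \<Longrightarrow> above \<Lambda> d g \<longleftrightarrow> above b c g \<and> u < g b"
proof -
  obtain \<Lambda>' where L: "\<Lambda> = b + \<Lambda>'" using ex_plus[of b \<Lambda>] assms(1) by (metis less_imp_le)
  with assms have "\<Lambda>' \<noteq> 0" by auto
  have "hyperlog b c < osuc u" using assms(2) by (simp add: less_osuc_iff)
  from above_adjust[OF this \<open>\<Lambda>' \<noteq> 0\<close>] show thesis
    using that \<open>\<Lambda>' \<noteq> 0\<close> by (auto simp: L above_osuc)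
qed

text \<open>Only removed cones in \<open>C\<close> constrain \<open>g\<close>. Adding
  \<open>hyperlog b a < g b\<close> to each turns it into a cone \<open>d c\<close> and changes
  nothing, since \<open>d a\<close> demands this already.\<close>

lemma definable_dia_piece:
  fixes b :: "'a::infinite ordinal"
  assumes "b < \<Lambda>" "finite (snd q)"
  shows "definable \<Lambda> (dia_piece \<Lambda> b q)"
proof -
  obtain a B where q: "q = (a, B)" by (cases q)
  define C where "C = {c \<in> B. \<forall>x. b \<le> x \<and> x < \<Lambda> \<longrightarrow> hyperlog x c \<le> hyperlog x a}"
  have C: "hyperlog b c \<le> hyperlog b a" if "c \<in> insert a C" for c
    using that assms(1) by (auto simp: C_def)
  have "\<exists>d. \<forall>g. ell_seq \<Lambda> g \<longrightarrow> above \<Lambda> d g = (above b c g \<and> hyperlog b a < g b)"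
    if "c \<in> insert a C" for c
    using above_adjust_osuc[OF assms(1) C[OF that]] by blast
  then obtain d where d: "\<And>c g. c \<in> insert a C \<Longrightarrow> ell_seq \<Lambda> g \<Longrightarrow>
      above \<Lambda> (d c) g \<longleftrightarrow> above b c g \<and> hyperlog b a < g b"
    by metis
  have "finite (snd (d a, d ` C))" using assms(2) by (simp add: C_def q)
  from definable_piece[OF this, of \<Lambda>] show ?thesis
  proof (rule definable_cong)
    fix g :: "'a ordinal \<Rightarrow> 'a ordinal"
    assume g: "ell_seq \<Lambda> g"
    have "piece \<Lambda> (d a, d ` C) g \<longleftrightarrow> above b a g \<and> hyperlog b a < g b \<and> (\<forall>c\<in>C. \<not> above b c g)"
      using d[OF _ g] by (auto simp: piece_def)
    then show "piece \<Lambda> (d a, d ` C) g \<longleftrightarrow> dia_piece \<Lambda> b q g"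
      by (auto simp: dia_piece_def q C_def)
  qed
qed

text \<open>
  Otherwise \<open>g a = \<ell>\<^sup>a (fst q)\<close>; then at the first \<open>z > a\<close> where \<open>g\<close> and \<open>\<xi> \<mapsto> \<ell>\<^sup>\<xi> (fst q)\<close> differ, \<open>g\<close>
  would exceed the bound that the definition of \<open>\<ell>\<close>-sequences imposes on it.
\<close>

lemma dia_piece_mono:
  fixes b :: "'a::infinite ordinal"
  assumes g: "ell_seq \<Lambda> g" and "a < b" "b < \<Lambda>" and dia: "dia_piece \<Lambda> b q g"
  shows "dia_piece \<Lambda> a q g"
proof -
  let ?h = "\<lambda>x. hyperlog x (fst q)"
  have le: "?h x \<le> g x" if "x < b" for x
    using dia that by (simp add: dia_piece_def above_def)
  have "?h a \<noteq> g a"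
  proof
    assume eq: "?h a = g a"
    define z where "z = (LEAST z. a < z \<and> ?h z \<noteq> g z)"
    have b: "a < b \<and> ?h b \<noteq> g b" using dia \<open>a < b\<close> by (auto simp: dia_piece_def)
    then have z: "a < z" "?h z \<noteq> g z" "z \<le> b"
      using LeastI[of "\<lambda>z. a < z \<and> ?h z \<noteq> g z" b] Least_le[of "\<lambda>z. a < z \<and> ?h z \<noteq> g z" b]
      by (auto simp: z_def)
    have least: "?h y = g y" if "a \<le> y" "y < z" for y
      using not_less_Least[of y "\<lambda>z. a < z \<and> ?h z \<noteq> g z"] that eq by (auto simp: z_def le_less)
    have "z < \<Lambda>" "z \<noteq> 0" using z assms(3) by auto
    then obtain t where t: "t < z" "\<And>x d. t \<le> x \<Longrightarrow> d \<noteq> 0 \<Longrightarrow> x + d = z \<Longrightarrow> g z \<le> hyperlog d (g x)"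
      using ell_seqE[OF g] by blast
    define y where "y = max t a"
    have y: "y < z" "t \<le> y" "a \<le> y" using t(1) z(1) by (simp_all add: y_def)
    obtain d where d: "y + d = z" by (rule ex_plus[of y z]) (use y in auto)
    have "d \<noteq> 0" using d y by auto
    then have "g z \<le> hyperlog d (?h y)" using t(2)[OF y(2) _ d] least[OF y(3,1)] by simp
    then have "g z \<le> ?h z" by (simp add: d flip: hyperlog_plus_exponent)
    moreover have "?h z \<le> g z"
      using le z(3) dia by (auto simp: le_less dia_piece_def)
    ultimately show False using z(2) by simp
  qed
  moreover have "?h a \<le> g a" by (rule le) (rule \<open>a < b\<close>)
  \<comment> \<open>A removed cone that blocks at \<open>a\<close> also blocks at \<open>b\<close>:
    between the two, \<open>c\<close> is bounded by \<open>?h\<close>, which lies below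
    \<open>g\<close>.\<close>
  moreover have False
    if c: "c \<in> snd q" "above a c g" "\<forall>x. a \<le> x \<and> x < \<Lambda> \<longrightarrow> hyperlog x c \<le> ?h x" for c
  proof -
    have "hyperlog x c \<le> g x" if "x < b" for x
    proof (cases "x < a")
      case False
      then have "hyperlog x c \<le> ?h x" using c(3) that \<open>b < \<Lambda>\<close> by (meson less_trans not_less)
      then show ?thesis using le[OF that] by (rule order.trans)
    qed (use c(2) in \<open>auto simp: above_def\<close>)
    then have "above b c g" by (simp add: above_def)
    moreover have "\<forall>x. b \<le> x \<and> x < \<Lambda> \<longrightarrow> hyperlog x c \<le> ?h x"
      using c(3) \<open>a < b\<close> by (meson less_imp_le order.trans)
    ultimately show False using dia c(1) by (auto simp: dia_piece_def)
  qed
  moreover have "above a (fst q) g" using le \<open>a < b\<close> by (auto simp: above_def intro: less_trans)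
  ultimately show ?thesis unfolding dia_piece_def by (auto simp: less_le)
qed

section \<open>Soundness for the Kripke frame\<close>

lemma ell_seqs_iff: "f \<in> ell_seqs \<Theta> \<Lambda> \<longleftrightarrow> f \<in> {..<\<Lambda>} \<rightarrow>\<^sub>E {..<\<Theta>} \<and> ell_seq \<Lambda> f"
  by (simp add: ell_seqs_def ell_seq_def)

lemma ell_less_piece_iff:
  fixes b :: "'a::infinite ordinal"
  assumes g: "g \<in> ell_seqs \<Theta> \<Lambda>" and b: "b < \<Lambda>"
  shows "(\<exists>f\<in>ell_seqs \<Theta> \<Lambda>. ell_less b f g \<and> piece \<Lambda> q f) \<longleftrightarrow> dia_piece \<Lambda> b q g"
proof
  let ?h = "\<lambda>x. hyperlog x (fst q)"
  assume "\<exists>f\<in>ell_seqs \<Theta> \<Lambda>. ell_less b f g \<and> piece \<Lambda> q f"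
  then obtain f where f: "ell_less b f g" "piece \<Lambda> q f" by blast
  have hf: "?h x \<le> f x" if "x < \<Lambda>" for x using f(2) that by (simp add: piece_def above_def)
  have fg: "f x = g x" if "x < b" for x using f(1) that by (simp add: ell_less_def)
  have "?h b < g b" using hf[OF b] f(1) by (auto simp: ell_less_def intro: le_less_trans)
  moreover have "above b (fst q) g"
    using hf b fg by (auto simp: above_def) (metis less_trans)
  \<comment> \<open>Below \<open>b\<close>, \<open>f\<close> agrees with \<open>g\<close>; from
    \<open>b\<close> on it dominates \<open>?h\<close>.\<close>
  moreover have "above \<Lambda> c f" if "above b c g" "\<forall>x. b \<le> x \<and> x < \<Lambda> \<longrightarrow> hyperlog x c \<le> ?h x" for c
    using that hf fg unfolding above_def by (metis not_less order.trans)
  ultimately show "dia_piece \<Lambda> b q g" using f(2) by (auto simp: dia_piece_def piece_def)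
next
  let ?h = "\<lambda>x. hyperlog x (fst q)"
  assume dia: "dia_piece \<Lambda> b q g"
  have eg: "ell_seq \<Lambda> g" using g by (simp add: ell_seqs_iff)
  have gT: "g x < \<Theta>" if "x < \<Lambda>" for x using g that by (auto simp: ell_seqs_iff)
  \<comment> \<open>The least candidate; \<open>restrict\<close> makes it extensional, as
    \<open>ell_seqs\<close> requires.\<close>
  define f where "f = restrict (\<lambda>x. if x < b then g x else ?h x) {..<\<Lambda>}"
  have f: "f x = (if x < b then g x else ?h x)" if "x < \<Lambda>" for x
    using that by (simp add: f_def)
  have hb: "?h b < g b" using dia by (simp add: dia_piece_def)
  have fb: "f x = g x" if "x < b" for x using f[OF less_trans[OF that b]] that by simp
  have "ell_seq \<Lambda> f"
  proof (rule ell_seqI)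
    fix z assume z: "z \<noteq> 0" "z < \<Lambda>"
    show "\<exists>t<z. \<forall>x d. t \<le> x \<longrightarrow> d \<noteq> 0 \<longrightarrow> x + d = z \<longrightarrow> f z \<le> hyperlog d (f x)"
    proof (cases "z \<le> b")
      case True
      obtain t where t: "t < z"
        "\<And>x d. t \<le> x \<Longrightarrow> d \<noteq> 0 \<Longrightarrow> x + d = z \<Longrightarrow> g z \<le> hyperlog d (g x)"
        using ell_seqE[OF eg z(2,1)] by blast
      \<comment> \<open>At \<open>b\<close> the value only drops, and all earlier values are those
        of \<open>g\<close>.\<close>
      have "f z \<le> g z" using True hb f[OF z(2)] by (auto simp: le_less)
      moreover have "f x = g x" if "x + d = z" "d \<noteq> 0" for x d
        using that True by (intro fb) (metis less_le_trans less_plus_left)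
      ultimately show ?thesis using t by (intro exI[of _ t]) (metis order.trans)
    next
      case False
      have "f z \<le> hyperlog d (f x)" if "b \<le> x" "d \<noteq> 0" "x + d = z" for x d
      proof -
        have "x < \<Lambda>" using that z(2) by (metis le_less_trans le_plus_left)
        then show ?thesis
          using f[OF z(2)] f[of x] False that by (auto simp flip: hyperlog_plus_exponent)
      qed
      then show ?thesis using False by (intro exI[of _ b]) auto
    qed
  qed
  moreover have "f x < \<Theta>" if "x < \<Lambda>" for x
  proof (cases "x < b")
    case False
    then have "?h x \<le> ?h b" by (intro hyperlog_antimono) simp
    then show ?thesis using f[OF that] hb gT[OF b] False by simp
  qed (use f[OF that] gT[OF that] in auto)
  then have "f \<in> {..<\<Lambda>} \<rightarrow>\<^sub>E {..<\<Theta>}" by (auto simp: f_def PiE_iff)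
  ultimately have "f \<in> ell_seqs \<Theta> \<Lambda>" by (simp add: ell_seqs_iff)
  moreover have "ell_less b f g" using fb f[OF b] hb by (simp add: ell_less_def)
  moreover have "piece \<Lambda> q f"
  proof -
    have "above b c g" "\<forall>x. b \<le> x \<and> x < \<Lambda> \<longrightarrow> hyperlog x c \<le> ?h x" if "above \<Lambda> c f" for c
      using that f b unfolding above_def by (metis less_trans, metis not_less)
    moreover have "above \<Lambda> (fst q) f"
      using dia by (auto simp: above_def f dia_piece_def)
    ultimately show ?thesis using dia by (auto simp: piece_def dia_piece_def)
  qed
  ultimately show "\<exists>f\<in>ell_seqs \<Theta> \<Lambda>. ell_less b f g \<and> piece \<Lambda> q f" by blast
qed


section \<open>Tautologies and the axiom of Loeb in the frame\<close>

lemma kripke_sat_tautology: "tautology p \<Longrightarrow> kripke_sat \<Theta> \<Lambda> g p"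
proof -
  have "prop_eval (\<lambda>a q. kripke_sat \<Theta> \<Lambda> g (Box a q)) p \<longleftrightarrow> kripke_sat \<Theta> \<Lambda> g p"
    by (induction p) simp_all
  then show "tautology p \<Longrightarrow> kripke_sat \<Theta> \<Lambda> g p"
    unfolding tautology_def by blast
qed

lemma kripke_sat_Imp [simp]:
  "kripke_sat \<Theta> \<Lambda> g (Imp p q) \<longleftrightarrow> (kripke_sat \<Theta> \<Lambda> g p \<longrightarrow> kripke_sat \<Theta> \<Lambda> g q)"
  by (simp add: Imp_def)

text \<open>\<open>ell_less a\<close> is transitive and lowers the ordinal at coordinate
  \<open>a\<close>, so induction on \<open>f a\<close> applies.\<close>

lemma kripke_sat_Loeb: "kripke_sat \<Theta> \<Lambda> g (Imp (Box a (Imp (Box a p) p)) (Box a p))"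
proof -
  have "kripke_sat \<Theta> \<Lambda> f p"
    if box: "kripke_sat \<Theta> \<Lambda> g (Box a (Imp (Box a p) p))"
      and "f \<in> ell_seqs \<Theta> \<Lambda>" "ell_less a f g" for f
    using that(2,3)
  proof (induction "f a" arbitrary: f rule: less_induct)
    case less
    have "kripke_sat \<Theta> \<Lambda> h p" if "h \<in> ell_seqs \<Theta> \<Lambda>" "ell_less a h f" for h
    proof (rule less.hyps)
      show "h a < f a" using that by (simp add: ell_less_def)
      show "ell_less a h g" using that less.prems(2) by (auto simp: ell_less_def intro: less_trans)
    qed (rule that(1))
    then have "kripke_sat \<Theta> \<Lambda> f (Box a p)" by simp
    moreover have "kripke_sat \<Theta> \<Lambda> f (Imp (Box a p) p)"
      using box less.prems unfolding kripke_sat.simps by blast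
    ultimately show ?case by (simp only: kripke_sat_Imp)
  qed
  then show ?thesis unfolding kripke_sat_Imp kripke_sat.simps(4)[of _ _ _ _ p] by blast
qed

lemma in_lang_Imp [simp]: "in_lang \<Lambda> (Imp p q) \<longleftrightarrow> in_lang \<Lambda> p \<and> in_lang \<Lambda> q"
  by (simp add: Imp_def)

lemma in_lang_Dia [simp]: "in_lang \<Lambda> (Dia a p) \<longleftrightarrow> a < \<Lambda> \<and> in_lang \<Lambda> p"
  by (simp add: Dia_def)

text \<open>Needed because definability is proved only for modal indices below \<Lambda>.\<close>

lemma GLP_in_lang: "GLP \<Lambda> p \<Longrightarrow> in_lang \<Lambda> p"
proof (induction rule: GLP.induct)
  case (Mon a b p)
  have "a < \<Lambda>" using less_trans[OF Mon(1,2)] .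
  moreover have "b < \<Lambda>" "in_lang \<Lambda> p" by fact+
  ultimately show ?case unfolding in_lang_Imp in_lang_Dia by blast
next
  case (NegIntro a b p)
  have "a < \<Lambda>" using less_trans[OF NegIntro(1,2)] .
  moreover have "b < \<Lambda>" "in_lang \<Lambda> p" by fact+
  ultimately show ?case unfolding in_lang_Imp in_lang_Dia in_lang.simps by blast
qed simp_all

section \<open>The Icard topologies\<close>

text \<open>Induction on \<open>b = e + omega_pow r\<close> carries the bound at \<open>b\<close>
  back to \<open>e\<close>. For \<open>r = 0\<close> at most one lower bound at \<open>e\<close> is
  added; for \<open>r > 0\<close> the bound at \<open>b\<close> suffices, as
  \<open>hyperlog e c\<close> is a hyperexponential. Thus near \<open>x\<close> a cone is controlled
  by its condition at \<open>b\<close>.\<close>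

lemma above_neighbourhood:
  fixes x :: "'a::infinite ordinal"
  assumes "above b c (\<lambda>a. hyperlog a x)"
  shows "\<exists>T. finite T \<and> (\<forall>(\<xi>, a)\<in>T. \<xi> < b \<and> a < hyperlog \<xi> x) \<and>
    (\<forall>y. (\<forall>(\<xi>, a)\<in>T. a < hyperlog \<xi> y) \<longrightarrow> hyperlog b c \<le> hyperlog b y \<longrightarrow>
      above b c (\<lambda>a. hyperlog a y))"
  using assms
proof (induction b rule: less_induct)
  case (less b)
  show ?case
  proof (cases "b = 0")
    case True
    then show ?thesis by (intro exI[of _ "{}"]) simp
  next
    case False
    then obtain e r where e: "b = e + omega_pow r" "e < b"
      "r \<noteq> 0 \<Longrightarrow> hyperlog e c \<in> range (hyperexp (omega_pow r))"
      using last_term_range[of 0 b c] by (metis zero_less_iff)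
    have x: "above e c (\<lambda>a. hyperlog a x)"
      using less.prems unfolding e(1) above_plus by blast
    have ex: "hyperlog e c \<le> hyperlog e x"
      using less.prems e(2) unfolding above_def by blast
    from less.IH[OF e(2) x] obtain T where *: "finite T \<and> (\<forall>(\<xi>, a)\<in>T. \<xi> < e \<and> a < hyperlog \<xi> x) \<and>
        (\<forall>y. (\<forall>(\<xi>, a)\<in>T. a < hyperlog \<xi> y) \<longrightarrow> hyperlog e c \<le> hyperlog e y \<longrightarrow>
          above e c (\<lambda>a. hyperlog a y))" ..
    then have T: "finite T" "\<And>\<xi> a. (\<xi>, a) \<in> T \<Longrightarrow> \<xi> < e \<and> a < hyperlog \<xi> x"
      by blast+
    have T_above: "above e c (\<lambda>a. hyperlog a y)"
      if "\<And>\<xi> a. (\<xi>, a) \<in> T \<Longrightarrow> a < hyperlog \<xi> y" "hyperlog e c \<le> hyperlog e y" for y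
      using * that by blast
    have T_less: "\<xi> < b" if "(\<xi>, a) \<in> T" for \<xi> a
      using T(2)[OF that] less_trans[OF _ e(2)] by blast
    have result: ?thesis
      if "finite S" "\<And>\<xi> a. (\<xi>, a) \<in> S \<Longrightarrow> \<xi> < b \<and> a < hyperlog \<xi> x"
        "\<And>y. (\<And>\<xi> a. (\<xi>, a) \<in> S \<Longrightarrow> a < hyperlog \<xi> y) \<Longrightarrow> hyperlog b c \<le> hyperlog b y \<Longrightarrow>
          above b c (\<lambda>a. hyperlog a y)" for S
      using that by (intro exI[of _ S]) blast
    consider "r = 0" "hyperlog e c = 0" | "r = 0" "hyperlog e c \<noteq> 0" | "r \<noteq> 0" by blast
    then show ?thesis
    proof cases
      case 1
      show ?thesis
      proof (rule result[OF T(1)])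
        fix y
        assume "\<And>\<xi> a. (\<xi>, a) \<in> T \<Longrightarrow> a < hyperlog \<xi> y"
        then show "above b c (\<lambda>a. hyperlog a y)"
          using T_above[of y] 1 by (simp add: e(1) above_plus)
      qed (use T(2) T_less in blast)
    next
      case 2
      \<comment> \<open>\<open>z\<close> is \<open>hyperlog e c\<close> without its last term; by
        \<open>plus_omega_pow_le\<close>, any ordinal above \<open>z\<close> with at least the same
        logarithm reaches \<open>hyperlog e c\<close>.\<close>
      obtain z where z: "hyperlog e c = z + omega_pow (hyperlog 1 (hyperlog e c))"
        using omega_pow_hyperlog_one[OF 2(2)] .
      have "z < hyperlog e c" by (subst z) simp
      have "above b c (\<lambda>a. hyperlog a y)"
        if y: "\<And>\<xi> a. (\<xi>, a) \<in> insert (e, z) T \<Longrightarrow> a < hyperlog \<xi> y"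
          and "hyperlog b c \<le> hyperlog b y" for y
      proof -
        have "hyperlog 1 (hyperlog e c) \<le> hyperlog 1 (hyperlog e y)"
          using that(2) 2(1) by (simp add: e(1) hyperlog_plus_exponent)
        then have "hyperlog e c \<le> hyperlog e y"
          using plus_omega_pow_le[of z "hyperlog e y"] y[of e z] by (subst z) simp
        then show ?thesis
          using T_above[of y] y 2(1) by (simp add: e(1) above_plus) (simp add: above_def)
      qed
      moreover have "\<xi> < b \<and> a < hyperlog \<xi> x" if "(\<xi>, a) \<in> insert (e, z) T" for \<xi> a
        using that T(2) T_less e(2) less_le_trans[OF \<open>z < hyperlog e c\<close> ex] by blast
      ultimately show ?thesis using T(1) by (intro result[of "insert (e, z) T"]) blast+
    next
      case 3
      then obtain u where u: "hyperlog e c = hyperexp (omega_pow r) u" using e(3) by blast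
      have "above b c (\<lambda>a. hyperlog a y)"
        if y: "\<And>\<xi> a. (\<xi>, a) \<in> T \<Longrightarrow> a < hyperlog \<xi> y" and "hyperlog b c \<le> hyperlog b y" for y
      proof -
        have "hyperexp (omega_pow r) u \<le> hyperlog (e + v) y" if "v < omega_pow r" for v
        proof (rule hyperexp_le_if_le_hyperlog)
          have "u = hyperlog b c" by (simp add: e(1) hyperlog_plus_exponent u hyperlog_hyperexp)
          also have "\<dots> \<le> hyperlog b y" by fact
          also have "b = (e + v) + omega_pow r" by (simp add: e(1) plus_assoc omega_pow_absorb[OF that])
          finally show "u \<le> hyperlog (omega_pow r) (hyperlog (e + v) y)"
            unfolding hyperlog_plus_exponent[of "e + v"] .
        qed
        then have tail: "above (omega_pow r) (hyperlog e c) (\<lambda>v. hyperlog (e + v) y)"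
          by (simp add: above_def u hyperlog_less_omega_pow)
        then have "hyperlog e c \<le> hyperlog e y" using above_at_zero by force
        then have "above e c (\<lambda>a. hyperlog a y)" using T_above y by blast
        then show ?thesis using tail by (simp add: e(1) above_plus)
      qed
      then show ?thesis using T T_less by (intro result[of T]) blast+
    qed
  qed
qed

text \<open>\<open>y\<close> is built backwards from its value \<open>u\<close> at \<open>b\<close>:
  a value \<open>v\<close> at \<open>e\<close> with \<open>hyperlog (omega_pow r) v = u\<close> is
  chosen between \<open>hyperlog e c\<close> and \<open>hyperlog e x\<close>, and induction
  continues from \<open>e\<close>.\<close>

lemma hyperlog_approximation:
  fixes x :: "'a::infinite ordinal"
  assumes "finite T" "\<And>\<xi> a. (\<xi>, a) \<in> T \<Longrightarrow> \<xi> < b \<and> a < hyperlog \<xi> x"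
    "above b c (\<lambda>a. hyperlog a x)" "hyperlog b c \<le> u" "u < hyperlog b x"
  shows "\<exists>y. hyperlog b y = u \<and> above b c (\<lambda>a. hyperlog a y) \<and> above b y (\<lambda>a. hyperlog a x) \<and>
    (\<forall>(\<xi>, a)\<in>T. a < hyperlog \<xi> y)"
  using assms
proof (induction b arbitrary: u T rule: less_induct)
  case (less b)
  show ?case
  proof (cases "b = 0")
    case True
    then show ?thesis using less.prems(2) by (intro exI[of _ u]) auto
  next
    case False
    \<comment> \<open>The last coordinate mentioned in \<open>T\<close>, or 0; splitting
      \<open>b\<close> at or beyond it leaves no bound of \<open>T\<close> after
      \<open>e\<close>.\<close>
    define m where "m = Max (insert 0 (fst ` T))"
    have "m \<in> insert 0 (fst ` T)"
      unfolding m_def using less.prems(1) by (intro Max_in) auto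
    then have "m < b" using less.prems(2) False by (auto simp: zero_less_iff)
    have m: "\<xi> \<le> m" if "(\<xi>, a) \<in> T" for \<xi> a
      unfolding m_def using less.prems(1) that by (intro Max_ge) force+
    obtain e r where e: "b = e + omega_pow r" "e < b" "m \<le> e"
      "r \<noteq> 0 \<Longrightarrow> m < e \<and> hyperlog e c \<in> range (hyperexp (omega_pow r)) \<and>
         hyperlog e x \<in> range (hyperexp (omega_pow r))"
      using last_term_range[OF \<open>m < b\<close>] by blast
    have x: "above e c (\<lambda>a. hyperlog a x)"
      using less.prems(3) unfolding e(1) above_plus by blast
    have ex: "hyperlog e c \<le> hyperlog e x"
      using less.prems(3) e(2) unfolding above_def by blast
    have u: "hyperlog (omega_pow r) (hyperlog e c) \<le> u" "u < hyperlog (omega_pow r) (hyperlog e x)"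
      using less.prems(4,5) by (simp_all add: e(1) hyperlog_plus_exponent)
    show ?thesis
    proof (cases "r = 0")
      case True
      \<comment> \<open>\<open>A\<close> collects what the value at \<open>e\<close> is made to
        exceed. Adding \<open>omega_pow u\<close> to its maximum gives logarithm \<open>u\<close>
        and stays below \<open>hyperlog e x\<close>, whose logarithm is larger.\<close>
      define A where "A = insert (hyperlog e c) (snd ` {p \<in> T. fst p = e})"
      have A: "finite A" "A \<noteq> {}" using less.prems(1) by (simp_all add: A_def)
      have "hyperlog e c < hyperlog e x" using ex u by (auto simp: le_less)
      then have A_less: "a < hyperlog e x" if "a \<in> A" for a
        using that less.prems(2) by (auto simp: A_def)
      define v where "v = Max A + omega_pow u"
      have "Max A \<in> A" by (rule Max_in[OF A])
      then have "v < hyperlog e x"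
        unfolding v_def using A_less u True by (intro plus_omega_pow_less) auto
      have "Max A < v" by (simp add: v_def)
      then have Av: "a < v" if "a \<in> A" for a
        using Max_ge[OF A(1) that] by simp
      then have "hyperlog e c \<le> v" by (simp add: A_def less_imp_le)
      have "finite {p \<in> T. fst p < e}" using less.prems(1) by simp
      moreover have "\<xi> < e \<and> a < hyperlog \<xi> x" if "(\<xi>, a) \<in> {p \<in> T. fst p < e}" for \<xi> a
        using that less.prems(2)[of \<xi> a] by simp
      ultimately obtain y where *: "hyperlog e y = v \<and> above e c (\<lambda>a. hyperlog a y) \<and>
          above e y (\<lambda>a. hyperlog a x) \<and> (\<forall>(\<xi>, a)\<in>{p \<in> T. fst p < e}. a < hyperlog \<xi> y)"
        using less.IH[OF e(2) _ _ x \<open>hyperlog e c \<le> v\<close> \<open>v < hyperlog e x\<close>, of "{p \<in> T. fst p < e}"]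
        by blast
      then have y: "hyperlog e y = v" "above e c (\<lambda>a. hyperlog a y)" "above e y (\<lambda>a. hyperlog a x)"
        by blast+
      have yT: "a < hyperlog \<xi> y" if "(\<xi>, a) \<in> T" "\<xi> < e" for \<xi> a
        using * that by auto
      have "a < hyperlog \<xi> y" if "(\<xi>, a) \<in> T" for \<xi> a
      proof (cases "\<xi> < e")
        case False
        then have "\<xi> = e" using m[OF that] e(3) by simp
        then have "a \<in> A" using that by (force simp: A_def)
        then show ?thesis using Av \<open>\<xi> = e\<close> y(1) by simp
      qed (use yT that in blast)
      moreover have "hyperlog b y = u"
        by (simp add: e(1) True hyperlog_plus_exponent y(1) v_def hyperlog_omega_one)
      moreover have "above b c (\<lambda>a. hyperlog a y)" "above b y (\<lambda>a. hyperlog a x)"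
        using y \<open>hyperlog e c \<le> v\<close> \<open>v < hyperlog e x\<close>
        by (simp_all add: e(1) True above_plus) (simp_all add: above_def)
      ultimately show ?thesis by blast
    next
      case False
      then obtain c' x' where cx: "hyperlog e c = hyperexp (omega_pow r) c'"
        "hyperlog e x = hyperexp (omega_pow r) x'"
        using e(4) by blast
      define v where "v = hyperexp (omega_pow r) u"
      have cux: "c' \<le> u" "u < x'" using u by (simp_all add: cx hyperlog_hyperexp)
      have v: "hyperlog e c \<le> v" "v < hyperlog e x"
        using cux normal_le_iff[OF normal_hyperexp] normal_less_iff[OF normal_hyperexp]
        unfolding cx v_def by blast+
      have "\<xi> < e \<and> a < hyperlog \<xi> x" if "(\<xi>, a) \<in> T" for \<xi> a
        using m[OF that] e(4) False less.prems(2)[OF that] by auto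
      from less.IH[OF e(2) less.prems(1) this x v]
      obtain y where y: "hyperlog e y = v" "above e c (\<lambda>a. hyperlog a y)" "above e y (\<lambda>a. hyperlog a x)"
        "\<forall>(\<xi>, a)\<in>T. a < hyperlog \<xi> y"
        by blast
      have "hyperlog b y = u"
        by (simp add: e(1) hyperlog_plus_exponent y(1) v_def hyperlog_hyperexp)
      moreover have "above b c (\<lambda>a. hyperlog a y)" "above b y (\<lambda>a. hyperlog a x)"
        using y v(1) less_imp_le[OF v(2)] unfolding e(1) above_plus cx v_def
        by (simp_all add: above_def hyperlog_plus_exponent cx hyperlog_less_omega_pow)
      ultimately show ?thesis using y(4) by blast
    qed
  qed
qed

section \<open>Open sets and neighbourhoods in the Icard topologies\<close>

lemma openin_icard_le:
  assumes "\<xi> \<le> b" "a \<le> \<Theta>"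
  shows "openin (icard_topology \<Theta> b) {y. y < \<Theta> \<and> hyperlog \<xi> y \<le> a}"
  unfolding icard_topology_def openin_topology_generated_by_iff
  by (rule generate_topology_on.Basis) (use assms in blast)

text \<open>Logarithms of points below \<Theta> stay below \<Theta>, so the upper bound of the
  subbasic set is vacuous; for \<open>a\<close> from \<Theta> on the set is empty.\<close>

lemma openin_icard_greater:
  fixes \<Theta> :: "'a::infinite ordinal"
  assumes "\<xi> < b"
  shows "openin (icard_topology \<Theta> b) {y. y < \<Theta> \<and> a < hyperlog \<xi> y}"
proof (cases "a < \<Theta>")
  case True
  have "hyperlog \<xi> y \<le> \<Theta>" if "y < \<Theta>" for y
    using hyperlog_le[of \<xi> y] that by (meson less_imp_le order.trans)
  then have "{y. y < \<Theta> \<and> a < hyperlog \<xi> y} = {y. y < \<Theta> \<and> a < hyperlog \<xi> y \<and> hyperlog \<xi> y \<le> \<Theta>}"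
    by blast
  then show ?thesis
    unfolding icard_topology_def openin_topology_generated_by_iff
    by (intro generate_topology_on.Basis) (use assms True in blast)
next
  case False
  have "\<not> a < hyperlog \<xi> y" if "y < \<Theta>" for y
    using le_less_trans[OF hyperlog_le that, of \<xi>] False by (meson less_trans)
  then have "{y. y < \<Theta> \<and> a < hyperlog \<xi> y} = {}" by blast
  then show ?thesis by (simp only: openin_empty)
qed

lemma openin_icard_finite:
  fixes \<Theta> :: "'a::infinite ordinal"
  assumes "finite T" "\<And>\<xi> a. (\<xi>, a) \<in> T \<Longrightarrow> \<xi> < b"
  shows "openin (icard_topology \<Theta> b) {y. y < \<Theta> \<and> (\<forall>(\<xi>, a)\<in>T. a < hyperlog \<xi> y)}"
  using assms
proof (induction T)
  case empty
  then show ?case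
    using openin_topspace[of "icard_topology \<Theta> b"] by (simp add: lessThan_def)
next
  case (insert p T)
  have "{y. y < \<Theta> \<and> (\<forall>(\<xi>, a)\<in>insert p T. a < hyperlog \<xi> y)} =
      {y. y < \<Theta> \<and> snd p < hyperlog (fst p) y} \<inter> {y. y < \<Theta> \<and> (\<forall>(\<xi>, a)\<in>T. a < hyperlog \<xi> y)}"
    by auto
  then show ?case
    using insert openin_icard_greater[of "fst p" b \<Theta> "snd p"] by (cases p) (auto intro!: openin_Int)
qed

text \<open>Upper bounds persist when no logarithm grows, so only the lower bounds have to be
  recorded; they occur at coordinates below \<open>b\<close>, and finite intersections collect
  them.\<close>

lemma icard_neighbourhood:
  fixes \<Theta> :: "'a::infinite ordinal"
  assumes "openin (icard_topology \<Theta> b) U" "x \<in> U"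
  shows "\<exists>T. finite T \<and> (\<forall>(\<xi>, a)\<in>T. \<xi> < b \<and> a < hyperlog \<xi> x) \<and>
    (\<forall>y<\<Theta>. (\<forall>\<xi>\<le>b. hyperlog \<xi> y \<le> hyperlog \<xi> x) \<longrightarrow> (\<forall>(\<xi>, a)\<in>T. a < hyperlog \<xi> y) \<longrightarrow> y \<in> U)"
    (is "\<exists>T. ?N U T")
  using assms unfolding icard_topology_def openin_topology_generated_by_iff
proof (induction rule: generate_topology_on.induct)
  case (Int U V)
  from Int.prems have "x \<in> U" "x \<in> V" by simp_all
  from Int.IH(1)[OF this(1)] obtain S where "?N U S" ..
  moreover from Int.IH(2)[OF \<open>x \<in> V\<close>] obtain T where "?N V T" ..
  ultimately have "?N (U \<inter> V) (S \<union> T)" by (simp add: ball_Un)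
  then show ?case by (rule exI)
next
  case (UN K)
  from UN.prems obtain U where U: "U \<in> K" "x \<in> U" by blast
  from UN.IH[OF this] obtain T where "?N U T" ..
  then have "?N (\<Union>K) T" using U(1) by (simp add: UnionI) blast
  then show ?case by (rule exI)
next
  case (Basis s)
  from Basis.hyps consider \<xi> a c where "\<xi> < b" "s = {z. z < \<Theta> \<and> a < hyperlog \<xi> z \<and> hyperlog \<xi> z \<le> c}"
    | \<xi> c where "\<xi> \<le> b" "s = {z. z < \<Theta> \<and> hyperlog \<xi> z \<le> c}"
    by blast
  then show ?case
  proof cases
    case 1
    have "y \<in> s" if "y < \<Theta>" "hyperlog \<xi> y \<le> hyperlog \<xi> x" "a < hyperlog \<xi> y" for y
      using 1 Basis(2) that order.trans[OF that(2), of c] by simp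
    then have "?N s {(\<xi>, a)}" using 1 Basis(2) by (simp add: less_imp_le)
    then show ?thesis by (rule exI)
  next
    case 2
    have "y \<in> s" if "y < \<Theta>" "hyperlog \<xi> y \<le> hyperlog \<xi> x" for y
      using 2 Basis(2) that order.trans[OF that(2), of c] by simp
    then have "?N s {}" using 2 by simp
    then show ?thesis by (rule exI)
  qed
qed simp

text \<open>Forwards, suitable neighbourhoods of \<open>x\<close> yield points of the piece that
  force each clause of \<open>dia_piece\<close>. Backwards, \<open>hyperlog_approximation\<close> is
  used with the least admissible value \<open>hyperlog b (fst q)\<close> at
  \<open>b\<close>.\<close>

lemma derived_set_piece_iff:
  fixes \<Theta> :: "'a::infinite ordinal"
  assumes x: "x < \<Theta>" and b: "b < \<Lambda>"
  shows "x \<in> icard_topology \<Theta> b derived_set_of {y. y < \<Theta> \<and> piece \<Lambda> q (\<lambda>a. hyperlog a y)}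
    \<longleftrightarrow> dia_piece \<Lambda> b q (\<lambda>a. hyperlog a x)"
proof
  let ?h = "\<lambda>a. hyperlog a (fst q)"
  assume "x \<in> icard_topology \<Theta> b derived_set_of {y. y < \<Theta> \<and> piece \<Lambda> q (\<lambda>a. hyperlog a y)}"
  then have limit: "\<exists>y\<in>U. y \<noteq> x \<and> y < \<Theta> \<and> piece \<Lambda> q (\<lambda>a. hyperlog a y)"
    if "openin (icard_topology \<Theta> b) U" "x \<in> U" for U
    using that by (auto simp: in_derived_set_of)
  have h_le: "?h a \<le> hyperlog a y" if "piece \<Lambda> q (\<lambda>a. hyperlog a y)" "a < \<Lambda>" for a y
    using that by (simp add: piece_def above_def)
  have hx: "?h a \<le> hyperlog a x" if "a \<le> b" for a
  proof -
    have "hyperlog a x \<le> \<Theta>" using x hyperlog_le[of a x] by (meson less_imp_le order.trans)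
    from limit[OF openin_icard_le[OF that this]] obtain y
      where "piece \<Lambda> q (\<lambda>a. hyperlog a y)" "hyperlog a y \<le> hyperlog a x" using x by auto
    then show ?thesis using h_le[of y a] le_less_trans[OF that b] by (auto intro: order.trans)
  qed
  \<comment> \<open>The neighbourhood bounds \<open>y\<close> by \<open>x\<close> and reduces the
    cone of \<open>c\<close> below \<open>b\<close> to its condition at \<open>b\<close>.\<close>
  have N: "\<exists>y. y \<noteq> x \<and> y \<le> x \<and> piece \<Lambda> q (\<lambda>a. hyperlog a y) \<and>
      (hyperlog b c \<le> hyperlog b y \<longrightarrow> above b c (\<lambda>a. hyperlog a y))"
    if c: "above b c (\<lambda>a. hyperlog a x)" for c
  proof -
    from above_neighbourhood[OF c] obtain T where "finite T \<and>
      (\<forall>(\<xi>, a)\<in>T. \<xi> < b \<and> a < hyperlog \<xi> x) \<and> (\<forall>y. (\<forall>(\<xi>, a)\<in>T. a < hyperlog \<xi> y) \<longrightarrow>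
        hyperlog b c \<le> hyperlog b y \<longrightarrow> above b c (\<lambda>a. hyperlog a y))" ..
    then have T: "finite T" "\<And>\<xi> a. (\<xi>, a) \<in> T \<Longrightarrow> \<xi> < b \<and> a < hyperlog \<xi> x"
      "\<And>y. \<forall>(\<xi>, a)\<in>T. a < hyperlog \<xi> y \<Longrightarrow> hyperlog b c \<le> hyperlog b y \<Longrightarrow>
        above b c (\<lambda>a. hyperlog a y)"
      by blast+
    let ?U = "{y. y < \<Theta> \<and> hyperlog 0 y \<le> x} \<inter> {y. y < \<Theta> \<and> (\<forall>(\<xi>, a)\<in>T. a < hyperlog \<xi> y)}"
    have "openin (icard_topology \<Theta> b) ?U"
    proof (intro openin_Int openin_icard_le openin_icard_finite)
      show "\<xi> < b" if "(\<xi>, a) \<in> T" for \<xi> a using T(2)[OF that] ..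
    qed (use T(1) x in simp_all)
    moreover have "x \<in> ?U" using T(2) x by auto
    ultimately obtain y where y: "y \<in> ?U" "y \<noteq> x" "piece \<Lambda> q (\<lambda>a. hyperlog a y)"
      using limit by blast
    then have "y \<le> x" "\<forall>(\<xi>, a)\<in>T. a < hyperlog \<xi> y" by simp_all
    then show ?thesis using T(3)[of y] y(2,3) by blast
  qed
  \<comment> \<open>If the values at \<open>b\<close> were equal, \<open>N\<close> for the cone of
    \<open>x\<close> itself would force \<open>x \<le> y\<close>, hence
    \<open>y = x\<close>.\<close>
  have neq: "?h b \<noteq> hyperlog b x"
  proof
    assume eq: "?h b = hyperlog b x"
    have "above b x (\<lambda>a. hyperlog a x)" by (simp add: above_def)
    from N[OF this] obtain y where y: "y \<noteq> x" "y \<le> x" "piece \<Lambda> q (\<lambda>a. hyperlog a y)"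
      "hyperlog b x \<le> hyperlog b y \<longrightarrow> above b x (\<lambda>a. hyperlog a y)"
      by blast
    have le: "hyperlog b x \<le> hyperlog b y" using h_le[OF y(3) b] eq by simp
    have "x \<le> y"
    proof (cases "b = 0")
      case False
      have "above b x (\<lambda>a. hyperlog a y)" using le y(4) by blast
      from above_at_zero[OF this False] show ?thesis by simp
    qed (use le in simp)
    then show False using y(1,2) by simp
  qed
  \<comment> \<open>Otherwise the removed cone would contain \<open>y\<close>: from \<open>b\<close>
    on through the piece, below \<open>b\<close> through \<open>N\<close>.\<close>
  have no: False
    if c: "c \<in> snd q" "above b c (\<lambda>a. hyperlog a x)"
      "\<forall>a. b \<le> a \<and> a < \<Lambda> \<longrightarrow> hyperlog a c \<le> ?h a" for c
  proof -
    obtain y where y: "piece \<Lambda> q (\<lambda>a. hyperlog a y)"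
      "hyperlog b c \<le> hyperlog b y \<Longrightarrow> above b c (\<lambda>a. hyperlog a y)"
      using N[OF c(2)] by blast
    have tail: "hyperlog a c \<le> hyperlog a y" if "b \<le> a" "a < \<Lambda>" for a
    proof -
      have "hyperlog a c \<le> ?h a" using c(3) that by blast
      also have "\<dots> \<le> hyperlog a y" by (rule h_le[OF y(1) that(2)])
      finally show ?thesis .
    qed
    then have "above b c (\<lambda>a. hyperlog a y)" using y(2) b by blast
    then have "above \<Lambda> c (\<lambda>a. hyperlog a y)" using tail by (meson above_def not_less)
    then show False using y(1) c(1) by (simp add: piece_def)
  qed
  have "above b (fst q) (\<lambda>a. hyperlog a x)" using hx by (simp add: above_def)
  moreover have "?h b < hyperlog b x" using hx[of b] neq by simp
  ultimately show "dia_piece \<Lambda> b q (\<lambda>a. hyperlog a x)"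
    unfolding dia_piece_def using no by blast
next
  assume dia: "dia_piece \<Lambda> b q (\<lambda>a. hyperlog a x)"
  have "\<exists>y. y \<noteq> x \<and> y \<in> {y. y < \<Theta> \<and> piece \<Lambda> q (\<lambda>a. hyperlog a y)} \<and> y \<in> U"
    if U: "x \<in> U" "openin (icard_topology \<Theta> b) U" for U
  proof -
    from icard_neighbourhood[OF U(2,1)] obtain T where
      "finite T \<and> (\<forall>(\<xi>, a)\<in>T. \<xi> < b \<and> a < hyperlog \<xi> x) \<and> (\<forall>y<\<Theta>.
        (\<forall>\<xi>\<le>b. hyperlog \<xi> y \<le> hyperlog \<xi> x) \<longrightarrow> (\<forall>(\<xi>, a)\<in>T. a < hyperlog \<xi> y) \<longrightarrow> y \<in> U)" ..
    then have T: "finite T" "\<And>\<xi> a. (\<xi>, a) \<in> T \<Longrightarrow> \<xi> < b \<and> a < hyperlog \<xi> x"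
      "\<And>y. y < \<Theta> \<Longrightarrow> \<forall>\<xi>\<le>b. hyperlog \<xi> y \<le> hyperlog \<xi> x \<Longrightarrow>
        \<forall>(\<xi>, a)\<in>T. a < hyperlog \<xi> y \<Longrightarrow> y \<in> U"
      by blast+
    have "above b (fst q) (\<lambda>a. hyperlog a x)" "hyperlog b (fst q) < hyperlog b x"
      using dia by (simp_all add: dia_piece_def)
    from hyperlog_approximation[OF T(1,2) this(1) order.refl this(2)] obtain y where
      "hyperlog b y = hyperlog b (fst q) \<and> above b (fst q) (\<lambda>a. hyperlog a y) \<and>
        above b y (\<lambda>a. hyperlog a x) \<and> (\<forall>(\<xi>, a)\<in>T. a < hyperlog \<xi> y)" ..
    then have y: "hyperlog b y = hyperlog b (fst q)" "above b (fst q) (\<lambda>a. hyperlog a y)"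
      "above b y (\<lambda>a. hyperlog a x)" "\<forall>(\<xi>, a)\<in>T. a < hyperlog \<xi> y"
      by blast+
    have less: "hyperlog b y < hyperlog b x" using dia y(1) by (simp add: dia_piece_def)
    have le: "hyperlog \<xi> y \<le> hyperlog \<xi> x" if "\<xi> \<le> b" for \<xi>
      using y(3) less that by (auto simp: above_def le_less)
    have "y < \<Theta>" using le[of 0] x by simp
    have tail: "hyperlog a y = hyperlog a (fst q)" if ba: "b \<le> a" for a
    proof -
      obtain d where "b + d = a" using ex_plus[OF ba] .
      then show ?thesis using y(1) by (metis hyperlog_plus_exponent)
    qed
    have "above \<Lambda> (fst q) (\<lambda>a. hyperlog a y)"
      using y(2) tail unfolding above_def by (metis not_less order.refl)
    moreover have "\<not> above \<Lambda> c (\<lambda>a. hyperlog a y)" if "c \<in> snd q" for c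
    proof
      assume c: "above \<Lambda> c (\<lambda>a. hyperlog a y)"
      have "hyperlog a c \<le> hyperlog a x" if "a < b" for a
        using c le[of a] that less_trans[OF that b] by (auto simp: above_def intro: order.trans)
      moreover have "hyperlog a c \<le> hyperlog a (fst q)" if "b \<le> a" "a < \<Lambda>" for a
        using c tail[OF that(1)] that(2) by (auto simp: above_def)
      ultimately show False using dia \<open>c \<in> snd q\<close> by (auto simp: dia_piece_def above_def)
    qed
    ultimately have "piece \<Lambda> q (\<lambda>a. hyperlog a y)" by (simp add: piece_def)
    moreover have "y \<in> U" using T(3)[OF \<open>y < \<Theta>\<close> _ y(4)] le by blast
    moreover have "y \<noteq> x" using less by auto
    ultimately show ?thesis using \<open>y < \<Theta>\<close> by (intro exI[of _ y]) simp
  qed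
  then show "x \<in> icard_topology \<Theta> b derived_set_of {y. y < \<Theta> \<and> piece \<Lambda> q (\<lambda>a. hyperlog a y)}"
    using x by (simp add: in_derived_set_of)
qed

lemma derived_set_pieces_iff:
  fixes \<Theta> :: "'a::infinite ordinal"
  assumes "x < \<Theta>" "b < \<Lambda>" "finite D"
  shows "x \<in> icard_topology \<Theta> b derived_set_of {y. y < \<Theta> \<and> (\<exists>q\<in>D. piece \<Lambda> q (\<lambda>a. hyperlog a y))}
    \<longleftrightarrow> (\<exists>q\<in>D. dia_piece \<Lambda> b q (\<lambda>a. hyperlog a x))"
proof -
  have "{y. y < \<Theta> \<and> (\<exists>q\<in>D. piece \<Lambda> q (\<lambda>a. hyperlog a y))} =
      (\<Union>q\<in>D. {y. y < \<Theta> \<and> piece \<Lambda> q (\<lambda>a. hyperlog a y)})"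
    by blast
  then show ?thesis
    using assms by (simp add: derived_set_of_Union derived_set_piece_iff)
qed

section \<open>Soundness\<close>

text \<open>A common \<open>P\<close> makes the two semantics comparable. In the box step its
  negation is a finite union of pieces, and both diamonds send a piece to the same
  \<open>dia_piece\<close>.\<close>

lemma sat_definable:
  fixes \<Theta> :: "'a::infinite ordinal"
  assumes "in_lang \<Lambda> p"
  shows "\<exists>P. definable \<Lambda> P \<and> (\<forall>g\<in>ell_seqs \<Theta> \<Lambda>. kripke_sat \<Theta> \<Lambda> g p \<longleftrightarrow> P g) \<and>
    (\<forall>x<\<Theta>. top_sat \<Theta> p x \<longleftrightarrow> P (\<lambda>a. hyperlog a x))" (is "\<exists>P. ?S p P")
  using assms
proof (induction p)
  case Bot
  show ?case using definable_False[of \<Lambda>] by (intro exI[of _ "\<lambda>_. False"]) simp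
next
  case (Neg p)
  then have "in_lang \<Lambda> p" by simp
  from Neg.IH[OF this] obtain P where "?S p P" ..
  then show ?case by (intro exI[of _ "\<lambda>g. \<not> P g"]) (simp add: definable_not)
next
  case (Conj p q)
  then have "in_lang \<Lambda> p" "in_lang \<Lambda> q" by simp_all
  from Conj.IH(1)[OF this(1)] obtain P where "?S p P" ..
  moreover from Conj.IH(2)[OF \<open>in_lang \<Lambda> q\<close>] obtain Q where "?S q Q" ..
  ultimately show ?case by (intro exI[of _ "\<lambda>g. P g \<and> Q g"]) (simp add: definable_conj)
next
  case (Box b p)
  then have b: "b < \<Lambda>" and "in_lang \<Lambda> p" by simp_all
  from Box.IH[OF this(2)] obtain P where "?S p P" ..
  then have P: "definable \<Lambda> P" "\<And>g. g \<in> ell_seqs \<Theta> \<Lambda> \<Longrightarrow> kripke_sat \<Theta> \<Lambda> g p \<longleftrightarrow> P g"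
    "\<And>x. x < \<Theta> \<Longrightarrow> top_sat \<Theta> p x \<longleftrightarrow> P (\<lambda>a. hyperlog a x)"
    by blast+
  obtain D where D: "finite D" "\<And>q. q \<in> D \<Longrightarrow> finite (snd q)"
    "\<And>g. ell_seq \<Lambda> g \<Longrightarrow> \<not> P g \<longleftrightarrow> (\<exists>q\<in>D. piece \<Lambda> q g)"
    using definableE[OF definable_not[OF P(1)]] by blast
  let ?Q = "\<lambda>g. \<not> (\<exists>q\<in>D. dia_piece \<Lambda> b q g)"
  have "definable \<Lambda> ?Q"
    using D(1,2) b by (intro definable_not definable_Bex definable_dia_piece)
  moreover have "kripke_sat \<Theta> \<Lambda> g (Box b p) \<longleftrightarrow> ?Q g" if g: "g \<in> ell_seqs \<Theta> \<Lambda>" for g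
  proof -
    have "\<not> kripke_sat \<Theta> \<Lambda> f p \<longleftrightarrow> (\<exists>q\<in>D. piece \<Lambda> q f)" if "f \<in> ell_seqs \<Theta> \<Lambda>" for f
      using P(2)[OF that] D(3)[of f] that by (simp add: ell_seqs_iff)
    then have "(\<exists>f\<in>ell_seqs \<Theta> \<Lambda>. ell_less b f g \<and> \<not> kripke_sat \<Theta> \<Lambda> f p) \<longleftrightarrow>
        (\<exists>q\<in>D. \<exists>f\<in>ell_seqs \<Theta> \<Lambda>. ell_less b f g \<and> piece \<Lambda> q f)"
      by blast
    then show ?thesis unfolding ell_less_piece_iff[OF g b] by simp
  qed
  moreover have "top_sat \<Theta> (Box b p) x \<longleftrightarrow> ?Q (\<lambda>a. hyperlog a x)" if "x < \<Theta>" for x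
  proof -
    have "{y. y < \<Theta> \<and> \<not> top_sat \<Theta> p y} =
        {y. y < \<Theta> \<and> (\<exists>q\<in>D. piece \<Lambda> q (\<lambda>a. hyperlog a y))}"
      using P(3) D(3)[OF ell_seq_hyperlog] by blast
    then show ?thesis using derived_set_pieces_iff[OF that b D(1)] by simp
  qed
  ultimately have "?S (Box b p) ?Q" by blast
  then show ?case by (rule exI[of _ ?Q])
qed

text \<open>The diamond of a definable set is the union of the diamonds of its pieces, so
  \<open>dia_piece_mono\<close> is applied to a single piece.\<close>

lemma kripke_sat_Mon:
  fixes \<Theta> :: "'a::infinite ordinal"
  assumes "a < b" "b < \<Lambda>" "in_lang \<Lambda> p" and g: "g \<in> ell_seqs \<Theta> \<Lambda>"
    and "kripke_sat \<Theta> \<Lambda> g (Dia b p)"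
  shows "kripke_sat \<Theta> \<Lambda> g (Dia a p)"
proof -
  from sat_definable[OF assms(3)] obtain P where "definable \<Lambda> P \<and>
      (\<forall>g\<in>ell_seqs \<Theta> \<Lambda>. kripke_sat \<Theta> \<Lambda> g p \<longleftrightarrow> P g) \<and>
      (\<forall>x<\<Theta>. top_sat \<Theta> p x \<longleftrightarrow> P (\<lambda>a. hyperlog a x))" ..
  then have P: "definable \<Lambda> P" "\<And>g. g \<in> ell_seqs \<Theta> \<Lambda> \<Longrightarrow> kripke_sat \<Theta> \<Lambda> g p \<longleftrightarrow> P g"
    by simp_all
  from P(1) obtain D where "finite D \<and> (\<forall>q\<in>D. finite (snd q)) \<and>
      (\<forall>g. ell_seq \<Lambda> g \<longrightarrow> P g \<longleftrightarrow> (\<exists>q\<in>D. piece \<Lambda> q g))"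
    unfolding definable_def ..
  then have D: "\<And>g. ell_seq \<Lambda> g \<Longrightarrow> P g \<longleftrightarrow> (\<exists>q\<in>D. piece \<Lambda> q g)"
    by simp
  have sat: "kripke_sat \<Theta> \<Lambda> f p \<longleftrightarrow> (\<exists>q\<in>D. piece \<Lambda> q f)" if "f \<in> ell_seqs \<Theta> \<Lambda>" for f
    using P(2)[OF that] D[of f] that by (simp add: ell_seqs_iff)
  have dia: "kripke_sat \<Theta> \<Lambda> g (Dia c p) \<longleftrightarrow> (\<exists>q\<in>D. dia_piece \<Lambda> c q g)" if "c < \<Lambda>" for c
    unfolding kripke_sat_Dia ell_less_piece_iff[OF g that, symmetric] using sat by blast
  obtain q where "q \<in> D" "dia_piece \<Lambda> b q g"
    using assms(5) unfolding dia[OF assms(2)] by blast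
  moreover have "ell_seq \<Lambda> g" using g by (simp add: ell_seqs_iff)
  ultimately have "\<exists>q\<in>D. dia_piece \<Lambda> a q g" using dia_piece_mono[OF _ assms(1,2)] by blast
  then show ?thesis unfolding dia[OF less_trans[OF assms(1,2)]] .
qed

lemma kripke_sound:
  fixes \<Theta> :: "'a::infinite ordinal"
  assumes "GLP \<Lambda> p" "g \<in> ell_seqs \<Theta> \<Lambda>"
  shows "kripke_sat \<Theta> \<Lambda> g p"
  using assms
proof (induction arbitrary: g rule: GLP.induct)
  case (Taut p)
  then show ?case by (simp add: kripke_sat_tautology)
next
  case (Loeb a p)
  show ?case by (rule kripke_sat_Loeb)
next
  case (Mon a b p)
  then show ?case using kripke_sat_Mon[of a b \<Lambda> p g \<Theta>] by simp
next
  case (NegIntro a b p)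
  \<comment> \<open>\<open>g\<close> and \<open>h\<close> agree up to and including coordinate
    \<open>a\<close>, since \<open>a < b\<close>.\<close>
  have "ell_less a f h" if "ell_less a f g" "ell_less b h g" for f h
    using that NegIntro(1) by (auto simp: ell_less_def)
  then show ?case
    unfolding kripke_sat_Imp kripke_sat.simps(4)[of _ _ _ b] kripke_sat_Dia by blast
next
  case (MP p q)
  then show ?case by simp
qed simp_all

lemma top_sat_iff_kripke_sat:
  fixes \<Theta> :: "'a::infinite ordinal"
  assumes "in_lang \<Lambda> p" "x < \<Theta>"
  shows "restrict (\<lambda>a. hyperlog a x) {..<\<Lambda>} \<in> ell_seqs \<Theta> \<Lambda>"
    and "top_sat \<Theta> p x \<longleftrightarrow> kripke_sat \<Theta> \<Lambda> (restrict (\<lambda>a. hyperlog a x) {..<\<Lambda>}) p"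
proof -
  let ?h = "\<lambda>a. hyperlog a x" and ?r = "restrict (\<lambda>a. hyperlog a x) {..<\<Lambda>}"
  have "?r \<in> {..<\<Lambda>} \<rightarrow>\<^sub>E {..<\<Theta>}" using le_less_trans[OF hyperlog_le assms(2)] by simp
  moreover have "ell_seq \<Lambda> ?r"
    using ell_seq_hyperlog by (rule ell_seq_cong) simp
  ultimately show r: "?r \<in> ell_seqs \<Theta> \<Lambda>" by (simp add: ell_seqs_iff)
  from sat_definable[OF assms(1)] obtain P where "definable \<Lambda> P \<and>
      (\<forall>g\<in>ell_seqs \<Theta> \<Lambda>. kripke_sat \<Theta> \<Lambda> g p \<longleftrightarrow> P g) \<and>
      (\<forall>x<\<Theta>. top_sat \<Theta> p x \<longleftrightarrow> P (\<lambda>a. hyperlog a x))" ..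
  then have P: "definable \<Lambda> P" "\<And>g. g \<in> ell_seqs \<Theta> \<Lambda> \<Longrightarrow> kripke_sat \<Theta> \<Lambda> g p \<longleftrightarrow> P g"
    "\<And>x. x < \<Theta> \<Longrightarrow> top_sat \<Theta> p x \<longleftrightarrow> P (\<lambda>a. hyperlog a x)"
    by simp_all
  from P(1) obtain D where "finite D \<and> (\<forall>q\<in>D. finite (snd q)) \<and>
      (\<forall>g. ell_seq \<Lambda> g \<longrightarrow> P g \<longleftrightarrow> (\<exists>q\<in>D. piece \<Lambda> q g))"
    unfolding definable_def ..
  then have D: "\<And>g. ell_seq \<Lambda> g \<Longrightarrow> P g \<longleftrightarrow> (\<exists>q\<in>D. piece \<Lambda> q g)"
    by simp
  \<comment> \<open>Pieces look only at coordinates below \<Lambda> and do not notice the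
    restriction.\<close>
  have "piece \<Lambda> q ?r \<longleftrightarrow> piece \<Lambda> q ?h" for q
    by (simp add: piece_def above_def)
  then have "P ?r \<longleftrightarrow> P ?h"
    using D[of ?r] D[OF ell_seq_hyperlog, of x] r by (simp add: ell_seqs_iff)
  then show "top_sat \<Theta> p x \<longleftrightarrow> kripke_sat \<Theta> \<Lambda> ?r p"
    using P(2)[OF r] P(3)[OF assms(2)] by simp
qed

theorem theorem8p1:
  fixes \<Theta> \<Lambda> :: "'a::infinite ordinal"
  assumes "GLP \<Lambda> p"
  shows "(\<forall>g\<in>ell_seqs \<Theta> \<Lambda>. kripke_sat \<Theta> \<Lambda> g p) \<and> (\<forall>x<\<Theta>. top_sat \<Theta> p x)"
  using kripke_sound[OF assms] top_sat_iff_kripke_sat[OF GLP_in_lang[OF assms]] by blast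

end
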